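(* Let $n\ge3$ and let $f(x_1,\dots,x_n)\in\mathbf{Q}[x_1,\dots,x_n]$ be an irreducible polynomial of degree $2$. Suppose that $f$ cannot be expressed as a polynomial in two linear forms in $(x_1,\dots,x_n)$, or that the homogeneous quadratic part of $f$ is irreducible in $\mathbf{Q}[x_1,\dots,x_n]$. Then for all $B\ge1$ and $\varepsilon>0$, $n(f;B)=O_{n,\varepsilon}(B^{n-2+\varepsilon})$.
   Context: For a polynomial $f\in\mathbf{Q}[x_1,\dots,x_n]$ and $B\ge1$, $n(f;B)$ denotes the number of integral $n$-tuples $(a_1,\dots,a_n)\in\mathbf{Z}^n\cap[-B,B]^n$ with $f(a_1,\dots,a_n)=0$. Subscripts on $O$ indicate the only parameters on which the implied constant depends. *)

theory Defs
  imports Complex_Main "HOL-Library.Poly_Mapping" "HOL-Computational_Algebra.Factorial_Ring"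
begin

text \<open>Multivariate polynomials over Q in the variables x_0, x_1, ... are represented
  as finitely supported maps from monomials (exponent vectors nat =>0 nat) to rational
  coefficients; this type is a commutative ring (an integral domain) via Poly_Mapping.\<close>

type_synonym mpoly = "(nat \<Rightarrow>\<^sub>0 nat) \<Rightarrow>\<^sub>0 rat"

definition mvar :: "nat \<Rightarrow> mpoly" where
  "mvar i = Poly_Mapping.single (Poly_Mapping.single i 1) 1"

definition mconst :: "rat \<Rightarrow> mpoly" where
  "mconst c = Poly_Mapping.single 0 c"

definition mon_degree :: "(nat \<Rightarrow>\<^sub>0 nat) \<Rightarrow> nat" where
  "mon_degree m = (\<Sum>i\<in>Poly_Mapping.keys m. Poly_Mapping.lookup m i)"

definition total_degree :: "mpoly \<Rightarrow> nat" where
  "total_degree f = Max (insert 0 (mon_degree ` Poly_Mapping.keys f))"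

definition vars_below :: "nat \<Rightarrow> mpoly \<Rightarrow> bool" where
  "vars_below n f \<longleftrightarrow> (\<forall>m\<in>Poly_Mapping.keys f. Poly_Mapping.keys m \<subseteq> {..<n})"

definition mpoly_eval :: "mpoly \<Rightarrow> (nat \<Rightarrow> rat) \<Rightarrow> rat" where
  "mpoly_eval f x = (\<Sum>m\<in>Poly_Mapping.keys f. Poly_Mapping.lookup f m * (\<Prod>i\<in>Poly_Mapping.keys m. x i ^ Poly_Mapping.lookup m i))"

definition hom_part :: "nat \<Rightarrow> mpoly \<Rightarrow> mpoly" where
  "hom_part d f = (\<Sum>m\<in>{m\<in>Poly_Mapping.keys f. mon_degree m = d}. Poly_Mapping.single m (Poly_Mapping.lookup f m))"

definition linear_form :: "nat \<Rightarrow> (nat \<Rightarrow> rat) \<Rightarrow> mpoly" where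
  "linear_form n c = (\<Sum>i<n. mconst (c i) * mvar i)"

definition subst2 :: "mpoly \<Rightarrow> mpoly \<Rightarrow> mpoly \<Rightarrow> mpoly" where
  "subst2 g L1 L2 = (\<Sum>m\<in>Poly_Mapping.keys g. mconst (Poly_Mapping.lookup g m) * L1 ^ Poly_Mapping.lookup m 0 * L2 ^ Poly_Mapping.lookup m 1)"

definition poly_in_two_linear_forms :: "nat \<Rightarrow> mpoly \<Rightarrow> bool" where
  "poly_in_two_linear_forms n f \<longleftrightarrow>
     (\<exists>g c1 c2. vars_below 2 g \<and> f = subst2 g (linear_form n c1) (linear_form n c2))"

text \<open>n(f;B): integral n-tuples in [-B,B]^n (stored as a : nat => int, zero beyond n) with f(a) = 0.\<close>
definition count_zeros :: "nat \<Rightarrow> mpoly \<Rightarrow> real \<Rightarrow> nat" where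
  "count_zeros n f B = card {a :: nat \<Rightarrow> int. (\<forall>i. n \<le> i \<longrightarrow> a i = 0) \<and>
       (\<forall>i<n. \<bar>real_of_int (a i)\<bar> \<le> B) \<and> mpoly_eval f (\<lambda>i. rat_of_int (a i)) = 0}"

end

theory Submission
  imports Defs "HOL-Computational_Algebra.Squarefree" "HOL-Computational_Algebra.Polynomial_Factorial"
    "HOL-Computational_Algebra.Field_as_Ring"
begin

text \<open>Completing the square twice writes the quadratic polynomial as
  \<open>f = \<alpha> ((x\<^sub>i + \<beta>)\<^sup>2 - d ((x\<^sub>j + e)\<^sup>2 - E))\<close> in coordinates adapted to an integral unimodular
  substitution; the second step is possible because otherwise \<open>f\<close> would be a square minus an
  affine form, which is a polynomial in two linear forms with reducible quadratic part. Fixing the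
  remaining \<open>n - 2\<close> coordinates leaves a conic. If \<open>E\<close> does not vanish there, the conic has
  \<open>O(B\<^sup>\<epsilon>)\<close> integral points: either they lie on a second conic, or the equation can be
  taken integral of height polynomial in \<open>B\<close>, and then one counts solutions of a Pell type equation
  \<open>x\<^sup>2 - D y\<^sup>2 = N\<close> by means of the divisor bound and the sparsity of units. The coordinates with
  \<open>E = 0\<close> are few unless \<open>E\<close> vanishes identically, and then irreducibility of \<open>f\<close> forces \<open>d\<close> to be
  a non-square, so that each slice has at most one point.\<close>

section \<open>The divisor bound and Pell type equations\<close>

text \<open>The delicate point is uniformity: the constant may depend on \<open>n\<close> and
  \<open>\<epsilon>\<close> only, while the coefficients of the polynomial, and with them
  \<open>\<beta>\<close>, \<open>d\<close>, \<open>e\<close> and \<open>E\<close>, are rationals of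
  unbounded height. The divisor bound applied to the slices directly would bring that height in. The
  coordinate changes use vectors with entries 0 and 1, so that lattice points stay lattice points
  and each projection at most doubles the box, whatever the coefficients are. The excluded shape, a
  square minus an affine form, is a real obstacle: x_0^2 = x_1 has about B^(n - 2 + 1/2) solutions
  in the box. Slices with E = 0 may be pairs of lines with about B points each; the bound survives
  because O(B^(n - 3)) such slices contribute only O(B^(n - 2)). Fundamental units and class numbers
  never enter: solutions of the Pell type equation are compared with a base solution by division,
  and all that is required of the quotients, which have norm 1, is that their sizes grow
  geometrically.\<close>

lemma card_divisors_prime_power_mult_le:
  fixes p m k :: nat
  assumes "prime p" "m > 0"
  shows "card {d. d dvd p ^ k * m} \<le> (k + 1) * card {d. d dvd m}"
proof -
  have fin: "finite {e. e dvd m}" using assms by simp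
  have "{d. d dvd p ^ k * m} \<subseteq> (\<lambda>(i, e). p ^ i * e) ` ({..k} \<times> {e. e dvd m})"
  proof
    fix d assume "d \<in> {d. d dvd p ^ k * m}"
    then have "d dvd p ^ k * m" by simp
    then obtain x y where xy: "d = x * y" "x dvd p ^ k" "y dvd m"
      by (rule dvd_productE)
    then obtain i where "i \<le> k" "x = p ^ i"
      using divides_primepow_nat[OF assms(1)] by blast
    with xy show "d \<in> (\<lambda>(i, e). p ^ i * e) ` ({..k} \<times> {e. e dvd m})"
      by (auto intro!: image_eqI[where x = "(i, y)"])
  qed
  then have "card {d. d dvd p ^ k * m} \<le> card ({..k} \<times> {e. e dvd m})"
    by (rule surj_card_le[rotated]) (use fin in auto)
  then show ?thesis by (simp add: card_cartesian_product)
qed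

text \<open>Bernoulli's inequality, with \<open>K\<close> at least 1/(r - 1). With r = 2 powr
  \<epsilon> it pays for the factor k + 1 by which a small prime raises the number of
  divisors.\<close>

lemma linear_le_exponential:
  fixes r :: real
  assumes "r > 1"
  obtains K where "K \<ge> 1" "\<And>k::nat. real k + 1 \<le> K * r ^ k"
proof
  define K where "K = max 1 (1 / (r - 1))"
  show "K \<ge> 1" by (simp add: K_def)
  fix k :: nat
  have K: "K * (r - 1) \<ge> 1"
    using assms by (simp add: K_def max_def field_simps)
  have "real k * 1 \<le> real k * (K * (r - 1))" using K by (intro mult_left_mono) auto
  then have "real k + 1 \<le> K * (1 + real k * (r - 1))"
    using \<open>K \<ge> 1\<close> by (simp add: algebra_simps)
  also have "\<dots> \<le> K * (1 + (r - 1)) ^ k"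
    using \<open>K \<ge> 1\<close> assms by (intro mult_left_mono Bernoulli_inequality) auto
  finally show "real k + 1 \<le> K * r ^ k" by simp
qed

text \<open>Prime powers are split off one at a time. A prime \<open>p\<close> with p powr
  \<epsilon> \<ge> 2 costs nothing, because k + 1 \<le> 2^k \<le> (p powr \<epsilon>)^k; every
  smaller prime costs one factor \<open>K\<close>. The smaller primes all lie below
  \<open>P\<close>, so \<open>K ^ P\<close> serves for every \<open>n\<close>.\<close>

lemma divisor_bound:
  fixes \<epsilon> :: real
  assumes "\<epsilon> > 0"
  obtains C where "C \<ge> 1" "\<And>n::nat. n > 0 \<Longrightarrow> real (card {d. d dvd n}) \<le> C * real n powr \<epsilon>"
proof -
  have "(2::real) powr \<epsilon> > 1" using assms by simp
  then obtain K where K: "K \<ge> 1" "\<And>k::nat. real k + 1 \<le> K * (2 powr \<epsilon>) ^ k"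
    using linear_le_exponential by blast
  define P where "P = nat \<lceil>(2::real) powr (1 / \<epsilon>)\<rceil>"
  have P: "real p powr \<epsilon> \<ge> 2" if "p \<ge> P" for p
  proof -
    have "(2::real) powr (1 / \<epsilon>) \<le> real p"
      using that unfolding P_def by linarith
    then have "((2::real) powr (1 / \<epsilon>)) powr \<epsilon> \<le> real p powr \<epsilon>"
      using assms by (intro powr_mono2) auto
    then show ?thesis using assms by (simp add: powr_powr)
  qed
  define W where "W n = {p. prime p \<and> p dvd n \<and> p < P}" for n :: nat
  have finW: "finite (W n)" for n
    by (rule finite_subset[of _ "{..<P}"]) (auto simp: W_def)
  have main: "real (card {d. d dvd n}) \<le> K ^ card (W n) * real n powr \<epsilon>" if "n > 0" for n
    using that
  proof (induction n rule: less_induct)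
    case (less n)
    show ?case
    proof (cases "n = 1")
      case True
      then show ?thesis using K(1) by (simp add: one_le_power)
    next
      case False
      then obtain p where p: "prime p" "p dvd n"
        using prime_factor_nat by blast
      define k where "k = multiplicity p n"
      have "n \<noteq> 0" "\<not> is_unit p" using less.prems p(1) not_prime_unit by blast+
      then obtain m where m: "n = p ^ k * m" "\<not> p dvd m"
        unfolding k_def by (rule multiplicity_decompose')
      have "k > 0" using m p by (cases k) auto
      have "p > 1" using p(1) prime_gt_1_nat by blast
      have m0: "m > 0" using m(1) less.prems by (cases m) auto
      have "p ^ k > 1" using \<open>p > 1\<close> \<open>k > 0\<close> by (rule one_less_power)
      then have "m < n" using m(1) m0 by simp
      have IH: "real (card {d. d dvd m}) \<le> K ^ card (W m) * real m powr \<epsilon>"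
        using less.IH \<open>m < n\<close> m0 by blast
      have step: "real k + 1 \<le> (if p < P then K else 1) * (real p powr \<epsilon>) ^ k"
      proof (cases "p < P")
        case True
        have "real k + 1 \<le> K * (2 powr \<epsilon>) ^ k" by (rule K(2))
        also have "\<dots> \<le> K * (real p powr \<epsilon>) ^ k"
          using K(1) \<open>p > 1\<close> assms by (intro mult_left_mono power_mono powr_mono2) auto
        finally show ?thesis using True by simp
      next
        case False
        have "real (Suc k) \<le> real (2 ^ k)" using less_exp[of k] by (intro of_nat_mono Suc_leI)
        then have "real k + 1 \<le> 2 ^ k" by simp
        also have "\<dots> \<le> (real p powr \<epsilon>) ^ k"
          using P False by (intro power_mono) auto
        finally show ?thesis using False by simp
      qed
      have pdiv: "q dvd n \<longleftrightarrow> q = p \<or> q dvd m" if "prime q" for q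
        using that p \<open>k > 0\<close> unfolding m(1)
        by (simp add: prime_dvd_mult_iff prime_dvd_power_iff primes_dvd_imp_eq)
          (meson dvd_refl primes_dvd_imp_eq)
      have Wn: "K ^ card (W n) = (if p < P then K else 1) * K ^ card (W m)"
      proof (cases "p < P")
        case True
        have "W n = insert p (W m)"
          using p(1) True pdiv unfolding W_def by auto
        moreover have "p \<notin> W m" using m(2) by (simp add: W_def)
        ultimately show ?thesis using finW True by simp
      next
        case False
        have "W n = W m"
          using p(1) False pdiv unfolding W_def by auto
        then show ?thesis using False by simp
      qed
      have "(real p ^ k) powr \<epsilon> = (real p powr real k) powr \<epsilon>"
        using \<open>p > 1\<close> by (simp add: powr_realpow)
      also have "\<dots> = (real p powr \<epsilon>) ^ k"
        using \<open>p > 1\<close> by (simp add: powr_powr powr_power mult.commute)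
      finally have npow: "real n powr \<epsilon> = (real p powr \<epsilon>) ^ k * real m powr \<epsilon>"
        unfolding m(1) by (simp add: powr_mult)
      have "real (card {d. d dvd n}) \<le> (real k + 1) * real (card {d. d dvd m})"
        using of_nat_mono[OF card_divisors_prime_power_mult_le[OF p(1) m0, of k], where 'a = real]
        unfolding m(1) by (simp add: algebra_simps)
      also have "\<dots> \<le> ((if p < P then K else 1) * (real p powr \<epsilon>) ^ k) * (K ^ card (W m) * real m powr \<epsilon>)"
        using step IH K(1) by (intro mult_mono) auto
      also have "\<dots> = K ^ card (W n) * real n powr \<epsilon>"
        unfolding Wn npow by simp
      finally show ?thesis .
    qed
  qed
  show ?thesis
  proof
    show "K ^ P \<ge> 1" using K(1) by (rule one_le_power)
    fix n :: nat assume "n > 0"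
    have "card (W n) \<le> card {..<P}" by (rule card_mono) (auto simp: W_def)
    then have "K ^ card (W n) \<le> K ^ P" using K(1) by (intro power_increasing) auto
    then have "K ^ card (W n) * real n powr \<epsilon> \<le> K ^ P * real n powr \<epsilon>"
      by (intro mult_right_mono) auto
    then show "real (card {d. d dvd n}) \<le> K ^ P * real n powr \<epsilon>"
      using main[OF \<open>n > 0\<close>] by linarith
  qed
qed

section \<open>Solutions of s^2 - D t^2 = 4 and their growth\<close>

text \<open>The quotient of (s' + t' sqrt D)/2 by (s + t sqrt D)/2 is (U + V sqrt D)/4, and
  multiplicativity of the norm gives U^2 - D V^2 = 16. Since V \<ge> 1, this forces U > 4, hence U
  \<ge> 5 by integrality. Multiplying back, 4 s' = s U + D t V \<ge> 5 s, which is the origin of the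
  ratio 5/4.\<close>

lemma pell4_gap:
  fixes D s t s' t' :: int
  assumes "D > 0" "s > 0" "t > 0" "s' > 0" "t < t'"
    and e1: "s\<^sup>2 - D * t\<^sup>2 = 4" and e2: "s'\<^sup>2 - D * t'\<^sup>2 = 4"
  shows "5 * s \<le> 4 * s'"
proof -
  define U where "U = s * s' - D * t * t'"
  define V where "V = s * t' - s' * t"
  have s2: "s\<^sup>2 = 4 + D * t\<^sup>2" "s'\<^sup>2 = 4 + D * t'\<^sup>2" using e1 e2 by auto
  have "U\<^sup>2 - D * V\<^sup>2 = (s\<^sup>2 - D * t\<^sup>2) * (s'\<^sup>2 - D * t'\<^sup>2)"
    unfolding U_def V_def by (simp add: power2_eq_square algebra_simps)
  then have UV: "U\<^sup>2 = 16 + D * V\<^sup>2" using e1 e2 by simp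
  have "t\<^sup>2 < t'\<^sup>2" using assms(3,5) by (intro power_strict_mono) auto
  have "0 < 4 * (t'\<^sup>2 - t\<^sup>2)" using \<open>t\<^sup>2 < t'\<^sup>2\<close> by simp
  also have "4 * (t'\<^sup>2 - t\<^sup>2) = (s * t')\<^sup>2 - (s' * t)\<^sup>2"
    unfolding power_mult_distrib s2 by (simp add: algebra_simps)
  finally have "(s' * t)\<^sup>2 < (s * t')\<^sup>2" by (simp only: diff_gt_0_iff_gt)
  then have "s' * t < s * t'"
    by (rule power_less_imp_less_base) (use assms(2-5) in simp)
  then have V: "V \<ge> 1" by (simp add: V_def)
  have "(D * t * t')\<^sup>2 < (s * s')\<^sup>2"
  proof -
    have "(D * t\<^sup>2) * (D * t'\<^sup>2) < s\<^sup>2 * s'\<^sup>2"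
      unfolding s2 using assms(1-5) by (intro mult_strict_mono) (auto intro: add_pos_nonneg)
    then show ?thesis by (simp add: power2_eq_square algebra_simps)
  qed
  then have "D * t * t' < s * s'"
    by (rule power_less_imp_less_base) (use assms(2-5) in simp)
  then have "U > 0" by (simp add: U_def)
  have "V\<^sup>2 \<ge> 1" using V by (simp add: one_le_power)
  then have "D * V\<^sup>2 \<ge> 1 * 1" using assms(1) by (intro mult_mono) auto
  then have "4\<^sup>2 < U\<^sup>2" using UV by simp
  then have "4 < U" by (rule power_less_imp_less_base) (use \<open>U > 0\<close> in auto)
  then have "U \<ge> 5" by simp
  have "4 * s' = s * U + D * t * V"
  proof -
    have "s * U + D * t * V = s' * (s\<^sup>2 - D * t\<^sup>2)"
      unfolding U_def V_def by (simp add: power2_eq_square algebra_simps)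
    then show ?thesis using e1 by simp
  qed
  moreover have "s * 5 \<le> s * U" using \<open>U \<ge> 5\<close> assms(2) by (intro mult_left_mono) auto
  moreover have "D * t * V \<ge> 0" using assms(1,3) V by auto
  ultimately show ?thesis by linarith
qed

text \<open>By \<open>pell4_gap\<close>, the integer part of the logarithm of \<open>s\<close> to
  base 5/4 increases strictly with \<open>t\<close>, so it separates the solutions; its values lie
  between 0 and the logarithm of \<open>M\<close>.\<close>

lemma pell4_positive_card:
  fixes D :: int and M :: real
  assumes "D > 0" "M \<ge> 1"
  defines "S \<equiv> {(s, t). s > 0 \<and> t > 0 \<and> s\<^sup>2 - D * t\<^sup>2 = 4 \<and> real_of_int s \<le> M}"
  shows "finite S" "real (card S) \<le> log (5/4) M + 1"
proof -
  define k where "k = nat \<lfloor>log (5/4) M\<rfloor>"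
  define \<phi> where "\<phi> = (\<lambda>(s::int, t::int). nat \<lfloor>log (5/4) (real_of_int s)\<rfloor>)"
  have less: "\<phi> (s, t) < \<phi> (s', t')" if "(s, t) \<in> S" "(s', t') \<in> S" "t < t'" for s t s' t'
  proof -
    have "5 * s \<le> 4 * s'" using that assms(1) by (intro pell4_gap[of D s t s' t']) (auto simp: S_def)
    then have "5 / 4 * real_of_int s \<le> real_of_int s'" by linarith
    moreover have "s > 0" "s' > 0" using that by (auto simp: S_def)
    ultimately have "log (5/4) (5 / 4 * real_of_int s) \<le> log (5/4) (real_of_int s')"
      by (subst log_le_cancel_iff) auto
    moreover have "log (5/4) (5 / 4 * real_of_int s) = 1 + log (5/4) (real_of_int s)"
      using \<open>s > 0\<close> by (subst log_mult) auto
    moreover have "log (5/4) (real_of_int s) \<ge> 0" using \<open>s > 0\<close> by simp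
    ultimately show ?thesis unfolding \<phi>_def by simp linarith
  qed
  have inj: "inj_on \<phi> S"
  proof (rule inj_onI)
    fix P Q assume PQ: "P \<in> S" "Q \<in> S" "\<phi> P = \<phi> Q"
    obtain s t s' t' where st: "P = (s, t)" "Q = (s', t')" by (cases P, cases Q) auto
    have "\<not> t < t'" "\<not> t' < t" using PQ less[of s t s' t'] less[of s' t' s t] st by auto
    then have "t = t'" by simp
    moreover have "s\<^sup>2 - D * t\<^sup>2 = 4" "s'\<^sup>2 - D * t'\<^sup>2 = 4" "s > 0" "s' > 0"
      using PQ st by (auto simp: S_def)
    moreover from calculation have "s\<^sup>2 = s'\<^sup>2" by (simp only: diff_eq_eq)
    then have "s = s'" by (rule power2_eq_imp_eq) (use calculation in auto)
    ultimately show "P = Q" using st by simp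
  qed
  have sub: "\<phi> ` S \<subseteq> {..k}"
  proof (clarsimp simp: \<phi>_def k_def)
    fix s t assume "(s, t) \<in> S"
    then have "s > 0" "real_of_int s \<le> M" by (auto simp: S_def)
    then have "log (5/4) (real_of_int s) \<le> log (5/4) M" by simp
    then show "nat \<lfloor>log (5/4) (real_of_int s)\<rfloor> \<le> nat \<lfloor>log (5/4) M\<rfloor>"
      by (intro nat_mono floor_mono)
  qed
  then have "finite (\<phi> ` S)" using finite_subset by blast
  then show "finite S" using inj finite_imageD by blast
  have "card S \<le> card {..k}" using inj sub by (intro card_inj_on_le) auto
  moreover have "log (5/4) M \<ge> 0" using assms by simp
  then have "real k \<le> log (5/4) M" unfolding k_def by linarith
  ultimately show "real (card S) \<le> log (5/4) M + 1" by simp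
qed

text \<open>For D > 0 the four choices of signs reduce to positive solutions, apart from (2, 0) and
  (-2, 0). For D < 0 both coordinates lie in [-2, 2], and the 25 points of that square account for
  the constant 25.\<close>

lemma pell4_card:
  fixes D :: int and M :: real
  assumes "D \<noteq> 0" "M \<ge> 1"
  defines "S \<equiv> {(s, t). s\<^sup>2 - D * t\<^sup>2 = 4 \<and> \<bar>real_of_int s\<bar> \<le> M}"
  shows "finite S" "real (card S) \<le> 4 * log (5/4) M + 25"
proof -
  have lg: "log (5/4) M \<ge> 0" using assms by simp
  have "finite S \<and> real (card S) \<le> 4 * log (5/4) M + 25"
  proof (cases "D > 0")
    case True
    define R where "R = {(s, t). s > 0 \<and> t > 0 \<and> s\<^sup>2 - D * t\<^sup>2 = 4 \<and> real_of_int s \<le> M}"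
    have R: "finite R" "real (card R) \<le> log (5/4) M + 1"
      using pell4_positive_card[OF True assms(2)] unfolding R_def by auto
    define G where "G = {(2, 0), (-2, 0)} \<union> (\<lambda>((\<sigma>, \<tau>), (s, t)). (\<sigma> * s, \<tau> * t)) ` (({1, -1} \<times> {1, -1}) \<times> R)"
    have "S \<subseteq> G"
    proof
      fix P assume "P \<in> S"
      then obtain s t where P: "P = (s, t)" "s\<^sup>2 - D * t\<^sup>2 = 4" "\<bar>real_of_int s\<bar> \<le> M"
        by (auto simp: S_def)
      show "P \<in> G"
      proof (cases "t = 0")
        case True
        then have "s\<^sup>2 = 2\<^sup>2" using P by simp
        then have "s = 2 \<or> s = -2" by (simp only: power2_eq_iff)
        then show ?thesis using True P by (auto simp: G_def)
      next
        case False
        have "s \<noteq> 0"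
        proof
          assume "s = 0"
          then have "D * t\<^sup>2 = -4" using P by simp
          moreover have "D * t\<^sup>2 \<ge> 0" using True by simp
          ultimately show False by simp
        qed
        then have "(\<bar>s\<bar>, \<bar>t\<bar>) \<in> R" using P False by (auto simp: R_def)
        then have "(sgn s * \<bar>s\<bar>, sgn t * \<bar>t\<bar>) \<in> (\<lambda>((\<sigma>, \<tau>), (s, t)). (\<sigma> * s, \<tau> * t)) ` (({1, -1} \<times> {1, -1}) \<times> R)"
          using \<open>s \<noteq> 0\<close> False
          by (intro image_eqI[where x = "((sgn s, sgn t), (\<bar>s\<bar>, \<bar>t\<bar>))"]) (auto simp: sgn_if)
        then show ?thesis unfolding G_def P(1) by (simp add: sgn_mult_abs)
      qed
    qed
    moreover have "finite G" using R by (simp add: G_def)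
    moreover have "card G \<le> 2 + 4 * card R"
    proof -
      have "card G \<le> card {(2::int, 0::int), (-2, 0)} + card ((\<lambda>((\<sigma>, \<tau>), (s, t)). (\<sigma> * s, \<tau> * t)) ` (({1, -1::int} \<times> {1, -1::int}) \<times> R))"
        unfolding G_def by (rule card_Un_le)
      also have "\<dots> \<le> 2 + card (({1, -1::int} \<times> {1, -1::int}) \<times> R)"
        using R by (intro add_mono card_image_le) auto
      also have "\<dots> = 2 + 4 * card R" by (simp add: card_cartesian_product)
      finally show ?thesis .
    qed
    ultimately have "finite S" "card S \<le> 2 + 4 * card R"
      using finite_subset[of S G] card_mono[of G S] by auto
    moreover from this(2) have "real (card S) \<le> 2 + 4 * real (card R)" by linarith
    ultimately show ?thesis using R by simp
  next
    case False
    have "S \<subseteq> {-2..2} \<times> {-2..2}"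
    proof (clarsimp simp: S_def)
      fix s t assume "s\<^sup>2 - D * t\<^sup>2 = 4"
      moreover have "1 * t\<^sup>2 \<le> - D * t\<^sup>2" using False assms by (intro mult_right_mono) auto
      moreover have "s\<^sup>2 \<ge> 0" "t\<^sup>2 \<ge> 0" by auto
      ultimately have "s\<^sup>2 \<le> 4" "t\<^sup>2 \<le> 4" by linarith+
      then have "s\<^sup>2 \<le> 2\<^sup>2" "t\<^sup>2 \<le> 2\<^sup>2" by auto
      then have "\<bar>s\<bar> \<le> 2" "\<bar>t\<bar> \<le> 2" using abs_le_square_iff[of s 2] abs_le_square_iff[of t 2] by auto
      then show "-2 \<le> s \<and> s \<le> 2 \<and> -2 \<le> t \<and> t \<le> 2" by auto
    qed
    moreover have "finite ({-2..2::int} \<times> {-2..2::int})" by simp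
    ultimately have "finite S" "card S \<le> card ({-2..2::int} \<times> {-2..2::int})"
      by (rule finite_subset, rule card_mono[rotated])
    then show ?thesis using lg by (simp add: card_cartesian_product)
  qed
  then show "finite S" "real (card S) \<le> 4 * log (5/4) M + 25" by auto
qed

lemma log_cube_nonneg:
  fixes H :: real
  assumes "H \<ge> 1"
  shows "log (5/4) (4 * H ^ 3) \<ge> 0"
proof -
  have "4 * H ^ 3 \<ge> 1" using one_le_power[OF assms, of 3] by linarith
  then show ?thesis using assms by (subst zero_le_log_cancel_iff) auto
qed

text \<open>Dividing x + y sqrt D by a base solution x0 + y0 sqrt D gives (s + t sqrt D)/2 with N s
  = 2 (x x0 - D y y0) and N t = 2 (x0 y - x y0). The congruences make \<open>s\<close> and
  \<open>t\<close> integral, the norm of the quotient is 1, so s^2 - D t^2 = 4, and |s| \<le> 2 (H^2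
  + H^3) \<le> 4 H^3. Thus a class is no larger than the set in \<open>pell4_card\<close>.\<close>

lemma pell_class_card:
  fixes D N :: int and H :: real
  assumes "D \<noteq> 0" "N \<noteq> 0" "H \<ge> 1" "\<bar>real_of_int D\<bar> \<le> H"
    and sol: "\<And>x y. (x, y) \<in> S \<Longrightarrow> x\<^sup>2 - D * y\<^sup>2 = N"
    and bd: "\<And>x y. (x, y) \<in> S \<Longrightarrow> \<bar>real_of_int x\<bar> \<le> H \<and> \<bar>real_of_int y\<bar> \<le> H"
    and eqv: "\<And>x y x' y'. (x, y) \<in> S \<Longrightarrow> (x', y') \<in> S \<Longrightarrow>
        N dvd 2 * (x' * y - x * y') \<and> N dvd 2 * (x * x' - D * y * y')"
  shows "real (card S) \<le> 4 * log (5/4) (4 * H ^ 3) + 25"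
proof (cases "S = {}")
  case True
  then show ?thesis using log_cube_nonneg[OF assms(3)] by simp
next
  case False
  then obtain x0 y0 where P0: "(x0, y0) \<in> S" by auto
  have M: "4 * H ^ 3 \<ge> 1" using one_le_power[OF assms(3), of 3] by linarith
  define T where "T = {(s, t). s\<^sup>2 - D * t\<^sup>2 = 4 \<and> \<bar>real_of_int s\<bar> \<le> 4 * H ^ 3}"
  define \<phi> where "\<phi> = (\<lambda>(x, y). ((2 * (x * x0 - D * y * y0)) div N, (2 * (x0 * y - x * y0)) div N))"
  have \<phi>: "\<exists>s t. \<phi> (x, y) = (s, t) \<and> N * s = 2 * (x * x0 - D * y * y0) \<and> N * t = 2 * (x0 * y - x * y0)"
    if "(x, y) \<in> S" for x y
    using eqv[OF that P0] by (auto simp: \<phi>_def)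
  \<comment> \<open>Multiplying the quotient by the base solution returns the point; this yields
    injectivity of \<open>\<phi>\<close> and the norm equation.\<close>
  have recover: "2 * x = x0 * s + D * y0 * t" "2 * y = y0 * s + x0 * t" "s\<^sup>2 - D * t\<^sup>2 = 4"
    if "(x, y) \<in> S" "N * s = 2 * (x * x0 - D * y * y0)" "N * t = 2 * (x0 * y - x * y0)" for x y s t
  proof -
    have e0: "x0\<^sup>2 - D * y0\<^sup>2 = N" and e: "x\<^sup>2 - D * y\<^sup>2 = N" using sol P0 that by auto
    have "N * (x0 * s + D * y0 * t) = x0 * (N * s) + D * y0 * (N * t)" by (simp add: algebra_simps)
    also have "\<dots> = 2 * x * (x0\<^sup>2 - D * y0\<^sup>2)" unfolding that by (simp add: power2_eq_square algebra_simps)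
    finally have "N * (2 * x) = N * (x0 * s + D * y0 * t)" using e0 by (simp only: mult_ac)
    then show "2 * x = x0 * s + D * y0 * t" using assms(2) by simp
    have "N * (y0 * s + x0 * t) = y0 * (N * s) + x0 * (N * t)" by (simp add: algebra_simps)
    also have "\<dots> = 2 * y * (x0\<^sup>2 - D * y0\<^sup>2)" unfolding that by (simp add: power2_eq_square algebra_simps)
    finally have "N * (2 * y) = N * (y0 * s + x0 * t)" using e0 by (simp only: mult_ac)
    then show "2 * y = y0 * s + x0 * t" using assms(2) by simp
    have "N\<^sup>2 * (s\<^sup>2 - D * t\<^sup>2) = (N * s)\<^sup>2 - D * (N * t)\<^sup>2" by (simp add: power_mult_distrib algebra_simps)
    also have "\<dots> = 4 * ((x\<^sup>2 - D * y\<^sup>2) * (x0\<^sup>2 - D * y0\<^sup>2))"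
      unfolding that by (simp add: power2_eq_square algebra_simps)
    also have "\<dots> = N\<^sup>2 * 4" using e e0 by (simp add: power2_eq_square)
    finally show "s\<^sup>2 - D * t\<^sup>2 = 4" using assms(2) by simp
  qed
  have "inj_on \<phi> S"
  proof (rule inj_onI)
    fix P Q assume PQ: "P \<in> S" "Q \<in> S" "\<phi> P = \<phi> Q"
    obtain x y x' y' where st: "P = (x, y)" "Q = (x', y')" by (cases P, cases Q) auto
    obtain s t where "\<phi> (x, y) = (s, t)" "N * s = 2 * (x * x0 - D * y * y0)" "N * t = 2 * (x0 * y - x * y0)"
      "N * s = 2 * (x' * x0 - D * y' * y0)" "N * t = 2 * (x0 * y' - x' * y0)"
      using \<phi>[of x y] \<phi>[of x' y'] PQ st by auto
    then have "2 * x = 2 * x'" "2 * y = 2 * y'"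
      using recover[of x y s t] recover[of x' y' s t] PQ st by auto
    then show "P = Q" using st by simp
  qed
  moreover have "\<phi> ` S \<subseteq> T"
  proof
    fix Q assume "Q \<in> \<phi> ` S"
    then obtain x y where xy: "(x, y) \<in> S" "Q = \<phi> (x, y)" by auto
    obtain s t where st: "\<phi> (x, y) = (s, t)" "N * s = 2 * (x * x0 - D * y * y0)" "N * t = 2 * (x0 * y - x * y0)"
      using \<phi> xy by blast
    have "s\<^sup>2 - D * t\<^sup>2 = 4" using recover(3)[OF xy(1) st(2,3)] .
    have H3: "H * H \<le> H * H * H" using assms(3) by (simp add: mult_le_cancel_left1)
    have "\<bar>real_of_int s\<bar> \<le> \<bar>real_of_int N\<bar> * \<bar>real_of_int s\<bar>"
      using assms(2) by (simp add: mult_le_cancel_right1) linarith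
    also have "\<dots> = \<bar>real_of_int (N * s)\<bar>" by (simp add: abs_mult)
    also have "\<dots> = 2 * \<bar>real_of_int x * real_of_int x0 - real_of_int D * real_of_int y * real_of_int y0\<bar>"
      unfolding st of_int_mult abs_mult by simp
    also have "\<dots> \<le> 2 * (\<bar>real_of_int x\<bar> * \<bar>real_of_int x0\<bar> + \<bar>real_of_int D\<bar> * \<bar>real_of_int y\<bar> * \<bar>real_of_int y0\<bar>)"
      unfolding abs_mult[symmetric] by (intro mult_left_mono abs_triangle_ineq4) auto
    also have "\<dots> \<le> 2 * (H * H + H * H * H)"
      using bd[OF xy(1)] bd[OF P0] assms(3,4) by (intro mult_left_mono add_mono mult_mono) auto
    also have "\<dots> \<le> 4 * H ^ 3" using H3 by (simp add: power3_eq_cube)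
    finally show "Q \<in> T" using \<open>s\<^sup>2 - D * t\<^sup>2 = 4\<close> xy st by (simp add: T_def)
  qed
  ultimately have "card S \<le> card T"
    using pell4_card(1)[OF assms(1) M] unfolding T_def by (intro card_inj_on_le) auto
  moreover have "real (card T) \<le> 4 * log (5/4) (4 * H ^ 3) + 25"
    using pell4_card(2)[OF assms(1) M] unfolding T_def .
  ultimately show ?thesis by simp
qed

section \<open>Solutions of x^2 - D y^2 = N grouped by residue classes\<close>

lemma squarefree_dvd_square_imp_dvd:
  fixes m x :: int
  assumes "squarefree m" "m dvd x\<^sup>2"
  shows "m dvd x"
proof -
  have "m \<noteq> 0" using assms by auto
  define g where "g = gcd m x"
  have "g \<noteq> 0" using \<open>m \<noteq> 0\<close> by (simp add: g_def)
  obtain m' x' where f: "m = m' * g" "x = x' * g" "coprime m' x'"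
    using gcd_coprime_exists[of m x] \<open>g \<noteq> 0\<close> unfolding g_def by auto
  have "g * m' dvd g * (g * x'\<^sup>2)"
    using assms(2) unfolding f by (simp add: power2_eq_square algebra_simps)
  then have "m' dvd g * x'\<^sup>2" using \<open>g \<noteq> 0\<close> by simp
  then have "m' dvd g" using f(3) by (simp add: coprime_dvd_mult_left_iff)
  then have "m'\<^sup>2 dvd m" unfolding f(1) by (simp add: power2_eq_square mult_dvd_mono)
  then have "is_unit m'" using assms(1) squarefreeD by blast
  then have "m' dvd x'" by (rule unit_imp_dvd)
  then show ?thesis unfolding f by (intro mult_dvd_mono) auto
qed

text \<open>In the product of the two Bezout combinations every term is a multiple of
  \<open>n\<close> or of \<open>a * b\<close>. So nothing of \<open>n\<close> is lost when it is
  shared out between the two factors.\<close>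

lemma dvd_gcd_mult_gcd:
  fixes n a b :: int
  assumes "n dvd a * b"
  shows "n dvd gcd n a * gcd n b"
proof -
  obtain u v where uv: "u * n + v * a = gcd n a" using bezout_int by blast
  obtain u' v' where uv': "u' * n + v' * b = gcd n b" using bezout_int by blast
  have "gcd n a * gcd n b = n * (u * u' * n + u * v' * b + v * a * u') + v * v' * (a * b)"
    unfolding uv[symmetric] uv'[symmetric] by (simp add: algebra_simps)
  then show ?thesis using assms by simp
qed

text \<open>Two primitive solutions differ by a half-integral unit as soon as they have the same residue
  \<open>x / y\<close> modulo \<open>N\<close>. Relative to a base solution, this root of \<open>\<lambda>\<^sup>2 = D\<close> is pinned down, up to a
  factor 2, by the divisors of \<open>N1\<close> modulo which it equals plus or minus \<open>x0 / y0\<close>.\<close>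

lemma primitive_pell_class:
  fixes D N N1 m x0 y0 x y x' y' :: int
  assumes D: "squarefree D" and N: "N \<noteq> 0"
    and m: "m = gcd D N" "N = m * N1"
    and e0: "x0\<^sup>2 - D * y0\<^sup>2 = N" "coprime x0 y0"
    and e: "x\<^sup>2 - D * y\<^sup>2 = N" "coprime x y"
    and e': "x'\<^sup>2 - D * y'\<^sup>2 = N" "coprime x' y'"
    and g: "gcd N1 (x * y0 - x0 * y) = gcd N1 (x' * y0 - x0 * y')"
    and h: "gcd N1 (x * y0 + x0 * y) = gcd N1 (x' * y0 + x0 * y')"
  shows "N dvd 2 * (x' * y - x * y') \<and> N dvd 2 * (x * x' - D * y * y')"
proof -
  have copN: "coprime N b" if "a\<^sup>2 - D * b\<^sup>2 = N" "coprime a b" for a b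
  proof -
    have "coprime (a\<^sup>2) b" using that by simp
    moreover have "a\<^sup>2 = N + (D * b) * b" using that by (simp add: power2_eq_square)
    ultimately have "gcd (N + (D * b) * b) b = 1" by simp
    then show ?thesis using gcd_add_mult[of b "D * b" N]
      by (simp add: coprime_iff_gcd_eq_1 gcd.commute[of _ b] add.commute)
  qed
  have md: "m dvd D" "m dvd N" unfolding m(1) by auto
  have mx: "m dvd a" if "a\<^sup>2 - D * b\<^sup>2 = N" for a b
  proof -
    have "a\<^sup>2 = N + D * b\<^sup>2" using that by simp
    then have "m dvd a\<^sup>2" using md by simp
    then show ?thesis using squarefree_mono[OF md(1) D] squarefree_dvd_square_imp_dvd by blast
  qed
  \<comment> \<open>A common divisor \<open>k\<close> of \<open>N1\<close> and \<open>D\<close>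
    divides \<open>m\<close>, so k^2 divides m N1 = N. As \<open>m\<close> divides \<open>x\<close>,
    k^2 also divides x^2, hence D y^2, hence \<open>D\<close> because \<open>k\<close> is prime to
    \<open>y\<close>. Squarefreeness of \<open>D\<close> makes \<open>k\<close> a unit.\<close>
  have cD: "coprime N1 D"
  proof -
    define k where "k = gcd N1 D"
    have k: "k dvd N1" "k dvd D" by (auto simp: k_def)
    then have "k dvd N" using m(2) by simp
    then have "k dvd m" using k m(1) by simp
    then have "k\<^sup>2 dvd N" using k(1) unfolding m(2) power2_eq_square by (rule mult_dvd_mono)
    moreover have "k\<^sup>2 dvd x\<^sup>2" using mx[OF e(1)] \<open>k dvd m\<close> by (intro dvd_power_same) auto
    moreover have "D * y\<^sup>2 = x\<^sup>2 - N" using e by simp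
    ultimately have "k\<^sup>2 dvd D * y\<^sup>2" by simp
    moreover have "coprime k y" using copN[OF e] \<open>k dvd N\<close> by (meson coprime_divisors dvd_refl)
    ultimately have "k\<^sup>2 dvd D" by (simp add: coprime_dvd_mult_left_iff)
    then have "is_unit k" using D squarefreeD by blast
    then show ?thesis by (simp add: k_def coprime_iff_gcd_eq_1)
  qed
  have N1N: "N1 dvd N" using m(2) by simp
  have cy: "coprime N1 y" "coprime N1 y0" 
    using copN[OF e] copN[OF e0] N1N by (meson coprime_divisors dvd_refl)+
  have cx: "coprime N1 x"
  proof -
    have "coprime N1 (D * y\<^sup>2)" using cD cy by simp
    moreover have "x\<^sup>2 = D * y\<^sup>2 + m * N1" using e m(2) by simp
    ultimately have "coprime N1 (x\<^sup>2)"
      using gcd_add_mult[of N1 m "D * y\<^sup>2"] by (simp add: coprime_iff_gcd_eq_1 add.commute)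
    then show ?thesis by simp
  qed
  define gg where "gg = gcd N1 (x * y0 - x0 * y)"
  define hh where "hh = gcd N1 (x * y0 + x0 * y)"
  define w where "w = x * y' - x' * y"
  \<comment> \<open>Modulo \<open>N1\<close>, x/y and x0/y0 are two square roots of
    \<open>D\<close>, so the product of their difference and their sum vanishes; its two gcds with
    \<open>N1\<close> therefore multiply to a multiple of \<open>N1\<close>.\<close>
  have "(x * y0 - x0 * y) * (x * y0 + x0 * y) = x\<^sup>2 * y0\<^sup>2 - x0\<^sup>2 * y\<^sup>2"
    by (simp add: power2_eq_square algebra_simps)
  also have "\<dots> = (N + D * y\<^sup>2) * y0\<^sup>2 - (N + D * y0\<^sup>2) * y\<^sup>2"
  proof -
    have "x\<^sup>2 = N + D * y\<^sup>2" "x0\<^sup>2 = N + D * y0\<^sup>2" using e e0 by auto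
    then show ?thesis by simp
  qed
  also have "\<dots> = N * (y0\<^sup>2 - y\<^sup>2)" by (simp add: algebra_simps)
  finally have "N1 dvd (x * y0 - x0 * y) * (x * y0 + x0 * y)" using N1N by simp
  then have N1gh: "N1 dvd gg * hh" unfolding gg_def hh_def by (rule dvd_gcd_mult_gcd)
  have cg: "coprime gg y0" "coprime hh y0"
    using cy(2) unfolding gg_def hh_def by (meson coprime_divisors dvd_refl gcd_dvd1)+
  \<comment> \<open>Modulo \<open>gg\<close> both solutions are proportional to (x0, y0), and modulo
    \<open>hh\<close> to (-x0, y0). In either case they are proportional to each other, so the
    determinant \<open>w\<close> vanishes.\<close>
  have "y0 * w = y' * (x * y0 - x0 * y) - y * (x' * y0 - x0 * y')"
    by (simp add: w_def algebra_simps)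
  moreover have "gg dvd x * y0 - x0 * y" by (simp add: gg_def)
  moreover have "gg dvd x' * y0 - x0 * y'" unfolding gg_def g by simp
  ultimately have "gg dvd y0 * w" by simp
  then have gw: "gg dvd w" using cg(1) by (simp add: coprime_dvd_mult_right_iff)
  have "y0 * w = y' * (x * y0 + x0 * y) - y * (x' * y0 + x0 * y')"
    by (simp add: w_def algebra_simps)
  moreover have "hh dvd x * y0 + x0 * y" by (simp add: hh_def)
  moreover have "hh dvd x' * y0 + x0 * y'" unfolding hh_def h by simp
  ultimately have "hh dvd y0 * w" by simp
  then have hw: "hh dvd w" using cg(2) by (simp add: coprime_dvd_mult_right_iff)
  \<comment> \<open>Sum and difference of x/y and x0/y0 can vanish together only modulo divisors of
    2, since \<open>x\<close> and \<open>y0\<close> are units modulo \<open>N1\<close>. Passing from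
    the product of \<open>gg\<close> and \<open>hh\<close> to their lcm thus loses at most a factor
    2, the 2 of the conclusion.\<close>
  define \<delta> where "\<delta> = gcd gg hh"
  have "\<delta> dvd 2"
  proof -
    have \<delta>: "\<delta> dvd gg" "\<delta> dvd hh" by (auto simp: \<delta>_def)
    have gh: "gg dvd x * y0 - x0 * y" "hh dvd x * y0 + x0 * y" "gg dvd N1" by (auto simp: gg_def hh_def)
    have "\<delta> dvd (x * y0 - x0 * y) + (x * y0 + x0 * y)"
      by (intro dvd_add dvd_trans[OF \<delta>(1) gh(1)] dvd_trans[OF \<delta>(2) gh(2)])
    then have "\<delta> dvd 2 * (x * y0)" by (simp add: algebra_simps)
    moreover have "\<delta> dvd N1" using \<delta>(1) gh(3) by (rule dvd_trans)
    then have "coprime \<delta> x" "coprime \<delta> y0" using cx cy coprime_divisors dvd_refl by blast+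
    then have "coprime \<delta> (x * y0)" by simp
    ultimately show ?thesis by (simp add: coprime_dvd_mult_left_iff)
  qed
  have "gg * hh dvd \<delta> * lcm gg hh" unfolding \<delta>_def by (simp add: abs_mult[symmetric])
  also have "\<delta> * lcm gg hh dvd 2 * w" using \<open>\<delta> dvd 2\<close> gw hw by (intro mult_dvd_mono) auto
  finally have "N1 dvd 2 * w" using N1gh dvd_trans by blast
  moreover have "m dvd 2 * w" using mx[OF e(1)] mx[OF e'(1)] by (simp add: w_def)
  moreover have "coprime m N1" using cD md by (meson coprime_commute coprime_divisors dvd_refl)
  ultimately have Nw: "N dvd 2 * w" unfolding m(2) by (intro divides_mult)
  have "y' * (2 * (x * x' - D * y * y')) = x' * (2 * w) + 2 * y * (x'\<^sup>2 - D * y'\<^sup>2)"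
    by (simp add: w_def power2_eq_square algebra_simps)
  then have "N dvd y' * (2 * (x * x' - D * y * y'))" using Nw e' by simp
  then have "N dvd 2 * (x * x' - D * y * y')" using copN[OF e'] by (simp add: coprime_dvd_mult_right_iff)
  moreover have "2 * (x' * y - x * y') = - (2 * w)" by (simp add: w_def)
  ultimately show ?thesis using Nw by (metis dvd_minus_iff)
qed

lemma card_fibres_le:
  assumes "finite A" "finite B" "\<And>x. x \<in> A \<Longrightarrow> \<phi> x \<in> B"
    and "\<And>b. b \<in> B \<Longrightarrow> real (card {x \<in> A. \<phi> x = b}) \<le> M"
  shows "real (card A) \<le> real (card B) * M"
proof -
  have "A = (\<Union>b\<in>B. {x \<in> A. \<phi> x = b})" using assms(3) by auto
  then have "card A = card (\<Union>b\<in>B. {x \<in> A. \<phi> x = b})" by (rule arg_cong)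
  then have "card A \<le> (\<Sum>b\<in>B. card {x \<in> A. \<phi> x = b})"
    using card_UN_le[OF assms(2)] by (rule ord_eq_le_trans)
  then have "real (card A) \<le> (\<Sum>b\<in>B. real (card {x \<in> A. \<phi> x = b}))"
    unfolding of_nat_sum[symmetric] of_nat_le_iff .
  also have "\<dots> \<le> (\<Sum>b\<in>B. M)" using assms(4) by (intro sum_mono)
  finally show ?thesis by simp
qed

lemma abs_le_imp_floor:
  fixes x :: int and H :: real
  assumes "\<bar>real_of_int x\<bar> \<le> H"
  shows "- \<lfloor>H\<rfloor> \<le> x \<and> x \<le> \<lfloor>H\<rfloor>"
  using assms by linarith

text \<open>The two gcds that fix the class of a solution are divisors of \<open>N\<close>, so there
  are at most d(N)^2 classes, each of logarithmic size by \<open>pell_class_card\<close>.\<close>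

lemma primitive_pell_card:
  fixes D N :: int and H :: real
  assumes D: "squarefree D" and N: "N \<noteq> 0" and H: "H \<ge> 1" "\<bar>real_of_int D\<bar> \<le> H"
  defines "S \<equiv> {(x, y). x\<^sup>2 - D * y\<^sup>2 = N \<and> coprime x y \<and> \<bar>real_of_int x\<bar> \<le> H \<and> \<bar>real_of_int y\<bar> \<le> H}"
  shows "finite S" "real (card S) \<le> real (card {d. d dvd nat \<bar>N\<bar>}) ^ 2 * (4 * log (5/4) (4 * H ^ 3) + 25)"
proof -
  have "S \<subseteq> {-\<lfloor>H\<rfloor>..\<lfloor>H\<rfloor>} \<times> {-\<lfloor>H\<rfloor>..\<lfloor>H\<rfloor>}"
    unfolding S_def using abs_le_imp_floor by fastforce
  then show fin: "finite S" using finite_subset by blast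
  have D0: "D \<noteq> 0" using D by auto
  have lg: "log (5/4) (4 * H ^ 3) \<ge> 0" using log_cube_nonneg[OF H(1)] .
  show "real (card S) \<le> real (card {d. d dvd nat \<bar>N\<bar>}) ^ 2 * (4 * log (5/4) (4 * H ^ 3) + 25)"
  proof (cases "S = {}")
    case True
    then show ?thesis using lg by simp
  next
    case False
    then obtain x0 y0 where P0: "(x0, y0) \<in> S" by auto
    define m where "m = gcd D N"
    obtain N1 where N1: "N = m * N1" unfolding m_def by (meson dvdE gcd_dvd2)
    define \<phi> where "\<phi> = (\<lambda>(x, y). (nat (gcd N1 (x * y0 - x0 * y)), nat (gcd N1 (x * y0 + x0 * y))))"
    define T where "T = {d. d dvd nat \<bar>N\<bar>}"
    have dT: "nat (gcd N1 a) \<in> T" for a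
    proof -
      have "gcd N1 a dvd \<bar>N\<bar>" using N1 by simp
      then show ?thesis unfolding T_def by (simp add: nat_dvd_iff)
    qed
    have finT: "finite T" unfolding T_def using N by (intro finite_divisors_nat) simp
    have "real (card S) \<le> real (card (T \<times> T)) * (4 * log (5/4) (4 * H ^ 3) + 25)"
    proof (rule card_fibres_le[where \<phi> = \<phi>])
      show "finite S" by (rule fin)
      show "finite (T \<times> T)" using finT by simp
      show "\<phi> P \<in> T \<times> T" for P using dT by (auto simp: \<phi>_def split: prod.splits)
      fix c assume "c \<in> T \<times> T"
      show "real (card {P \<in> S. \<phi> P = c}) \<le> 4 * log (5/4) (4 * H ^ 3) + 25"
      proof (rule pell_class_card[OF D0 N H])
        fix x y x' y' assume "(x, y) \<in> {P \<in> S. \<phi> P = c}" and "(x', y') \<in> {P \<in> S. \<phi> P = c}"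
        then have 1: "(x, y) \<in> S" "(x', y') \<in> S" and 2: "\<phi> (x, y) = \<phi> (x', y')" by auto
        have "gcd N1 (x * y0 - x0 * y) = gcd N1 (x' * y0 - x0 * y')"
          "gcd N1 (x * y0 + x0 * y) = gcd N1 (x' * y0 + x0 * y')"
          using 2 unfolding \<phi>_def by (auto simp: eq_nat_nat_iff)
        then show "N dvd 2 * (x' * y - x * y') \<and> N dvd 2 * (x * x' - D * y * y')"
          using 1 P0 by (intro primitive_pell_class[OF D N m_def N1, of x0 y0]) (auto simp: S_def)
      qed (auto simp: S_def)
    qed
    then show ?thesis unfolding T_def by (simp add: card_cartesian_product power2_eq_square)
  qed
qed

text \<open>The square of g = gcd x y divides \<open>N\<close>. Dividing by \<open>g\<close> leaves
  a primitive solution for N/g^2, which has no more divisors than \<open>N\<close>; the choice of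
  \<open>g\<close> accounts for the third factor d(N).\<close>

lemma squarefree_pell_card:
  fixes D N :: int and H :: real
  assumes D: "squarefree D" and N: "N \<noteq> 0" and H: "H \<ge> 1" "\<bar>real_of_int D\<bar> \<le> H"
  defines "S \<equiv> {(x, y). x\<^sup>2 - D * y\<^sup>2 = N \<and> \<bar>real_of_int x\<bar> \<le> H \<and> \<bar>real_of_int y\<bar> \<le> H}"
  shows "finite S" "real (card S) \<le> real (card {d. d dvd nat \<bar>N\<bar>}) ^ 3 * (4 * log (5/4) (4 * H ^ 3) + 25)"
proof -
  have "S \<subseteq> {-\<lfloor>H\<rfloor>..\<lfloor>H\<rfloor>} \<times> {-\<lfloor>H\<rfloor>..\<lfloor>H\<rfloor>}"
    unfolding S_def using abs_le_imp_floor by fastforce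
  then show fin: "finite S" using finite_subset by blast
  have lg: "log (5/4) (4 * H ^ 3) \<ge> 0" using log_cube_nonneg[OF H(1)] .
  define T where "T = {d. d dvd nat \<bar>N\<bar>}"
  have finT: "finite T" unfolding T_def using N by (intro finite_divisors_nat) simp
  define \<phi> where "\<phi> = (\<lambda>(x::int, y). nat (gcd x y))"
  have sq: "(gcd x y)\<^sup>2 dvd N" if "(x, y) \<in> S" for x y
  proof -
    have "x\<^sup>2 - D * y\<^sup>2 = N" using that by (simp add: S_def)
    moreover have "(gcd x y)\<^sup>2 dvd x\<^sup>2 - D * y\<^sup>2"
      by (intro dvd_diff dvd_mult dvd_power_same) auto
    ultimately show ?thesis by simp
  qed
  have "real (card S) \<le> real (card T) * (real (card T) ^ 2 * (4 * log (5/4) (4 * H ^ 3) + 25))"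
  proof (rule card_fibres_le[where \<phi> = \<phi>])
    show "finite S" by (rule fin)
    show "finite T" by (rule finT)
    fix P assume "P \<in> S"
    obtain x y where P: "P = (x, y)" by (cases P)
    have "gcd x y dvd N" using sq[of x y] \<open>P \<in> S\<close> P by (metis dvd_trans dvd_power pos2)
    then show "\<phi> P \<in> T" unfolding T_def \<phi>_def P by (simp add: nat_dvd_iff)
  next
    fix g assume "g \<in> T"
    define R where "R = {P \<in> S. \<phi> P = g}"
    show "real (card R) \<le> real (card T) ^ 2 * (4 * log (5/4) (4 * H ^ 3) + 25)"
    proof (cases "R = {}")
      case True
      then show ?thesis using lg by simp
    next
      case False
      then obtain x1 y1 where 1: "(x1, y1) \<in> S" "\<phi> (x1, y1) = g" by (auto simp: R_def)
      then have "int g = gcd x1 y1" by (auto simp: \<phi>_def)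
      then have "(int g)\<^sup>2 dvd N" using sq[OF 1(1)] by simp
      then obtain N' where N': "N = (int g)\<^sup>2 * N'" by blast
      have g0: "g > 0" and N'0: "N' \<noteq> 0" using N' N by (auto intro: Nat.gr0I)
      define Q where "Q = {(x, y). x\<^sup>2 - D * y\<^sup>2 = N' \<and> coprime x y \<and> \<bar>real_of_int x\<bar> \<le> H \<and> \<bar>real_of_int y\<bar> \<le> H}"
      have Q: "finite Q" "real (card Q) \<le> real (card {d. d dvd nat \<bar>N'\<bar>}) ^ 2 * (4 * log (5/4) (4 * H ^ 3) + 25)"
        using primitive_pell_card[OF D N'0 H] unfolding Q_def by auto
      have "R \<subseteq> (\<lambda>(x, y). (int g * x, int g * y)) ` Q"
      proof
        fix P assume "P \<in> R"
        then obtain x y where P: "P = (x, y)" "(x, y) \<in> S" "gcd x y = int g"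
          by (cases P) (auto simp: R_def \<phi>_def)
        obtain x' y' where f: "x = x' * int g" "y = y' * int g" "coprime x' y'"
          using gcd_coprime_exists[of x y] P g0 by auto
        have "(int g)\<^sup>2 * (x'\<^sup>2 - D * y'\<^sup>2) = (int g)\<^sup>2 * N'"
          using P(2) unfolding S_def f N'[symmetric] by (simp add: power_mult_distrib algebra_simps)
        then have "x'\<^sup>2 - D * y'\<^sup>2 = N'" using g0 by simp
        moreover have le: "\<bar>real_of_int a\<bar> \<le> \<bar>real_of_int (a * int g)\<bar>" for a
          using g0 by (simp add: abs_mult mult_le_cancel_left1)
        have "\<bar>real_of_int x'\<bar> \<le> H" "\<bar>real_of_int y'\<bar> \<le> H"
          using le[of x'] le[of y'] P(2) unfolding S_def f by auto
        ultimately have "(x', y') \<in> Q" using f(3) by (simp add: Q_def)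
        then show "P \<in> (\<lambda>(x, y). (int g * x, int g * y)) ` Q"
          using P f by (intro image_eqI[where x = "(x', y')"]) auto
      qed
      then have "card R \<le> card Q" by (rule surj_card_le[rotated]) (rule Q)
      moreover have "{d. d dvd nat \<bar>N'\<bar>} \<subseteq> T"
        unfolding T_def N' by (auto simp: abs_mult nat_mult_distrib)
      then have "card {d. d dvd nat \<bar>N'\<bar>} \<le> card T" using finT card_mono by blast
      then have "real (card {d. d dvd nat \<bar>N'\<bar>}) ^ 2 * (4 * log (5/4) (4 * H ^ 3) + 25)
          \<le> real (card T) ^ 2 * (4 * log (5/4) (4 * H ^ 3) + 25)"
        using lg by (intro mult_right_mono power_mono) auto
      ultimately show ?thesis using Q(2) by linarith
    qed
  qed
  then show "real (card S) \<le> real (card {d. d dvd nat \<bar>N\<bar>}) ^ 3 * (4 * log (5/4) (4 * H ^ 3) + 25)"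
    unfolding T_def by (simp add: power2_eq_square power3_eq_cube)
qed

lemma log_le_powr:
  fixes \<epsilon> :: real
  assumes "\<epsilon> > 0"
  obtains C where "C \<ge> 0" "\<And>H. H \<ge> 1 \<Longrightarrow> 4 * log (5/4) (4 * H ^ 3) + 25 \<le> C * H powr \<epsilon>"
proof
  define c where "c = 4 / ln (5/4::real)"
  have c: "c > 0" by (simp add: c_def)
  show "c * (ln 4 + 3 / \<epsilon>) + 25 \<ge> 0" using c assms by simp
  fix H :: real assume H: "H \<ge> 1"
  have "ln H \<le> H powr \<epsilon> / \<epsilon>" using ln_powr_bound[OF H assms] .
  moreover have "ln (4 * H ^ 3) = ln 4 + 3 * ln H" using H by (simp add: ln_mult ln_realpow)
  ultimately have 1: "ln (4 * H ^ 3) \<le> ln 4 + 3 * (H powr \<epsilon> / \<epsilon>)" by simp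
  have p1: "1 \<le> H powr \<epsilon>" using H assms by (simp add: ge_one_powr_ge_zero)
  have "4 * log (5/4) (4 * H ^ 3) = c * ln (4 * H ^ 3)" by (simp add: log_def c_def)
  also have "\<dots> \<le> c * (ln 4 + 3 * (H powr \<epsilon> / \<epsilon>))" using 1 c by (intro mult_left_mono) auto
  also have "\<dots> \<le> c * (ln 4 * H powr \<epsilon> + 3 * (H powr \<epsilon> / \<epsilon>))"
    using c p1 by (intro mult_left_mono add_mono) (auto simp: mult_le_cancel_left1)
  finally have "4 * log (5/4) (4 * H ^ 3) + 25 \<le> c * (ln 4 * H powr \<epsilon> + 3 * (H powr \<epsilon> / \<epsilon>)) + 25 * H powr \<epsilon>"
    using p1 by linarith
  then show "4 * log (5/4) (4 * H ^ 3) + 25 \<le> (c * (ln 4 + 3 / \<epsilon>) + 25) * H powr \<epsilon>"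
    by (simp add: algebra_simps)
qed

text \<open>Writing D = D' k^2 with D' squarefree and replacing \<open>y\<close> by
  \<open>k * y\<close> reduces to squarefree D'. As |k| \<le> H, the new variable is bounded by L =
  H^2.\<close>

lemma pell_bound:
  fixes \<epsilon> :: real
  assumes "\<epsilon> > 0"
  obtains C where "C \<ge> 0"
    "\<And>D N H. D \<noteq> 0 \<Longrightarrow> N \<noteq> 0 \<Longrightarrow> H \<ge> 1 \<Longrightarrow> \<bar>real_of_int D\<bar> \<le> H \<Longrightarrow> \<bar>real_of_int N\<bar> \<le> H \<Longrightarrow>
      finite {(x::int, y). x\<^sup>2 - D * y\<^sup>2 = N \<and> \<bar>real_of_int x\<bar> \<le> H \<and> \<bar>real_of_int y\<bar> \<le> H} \<and>
      real (card {(x::int, y). x\<^sup>2 - D * y\<^sup>2 = N \<and> \<bar>real_of_int x\<bar> \<le> H \<and> \<bar>real_of_int y\<bar> \<le> H}) \<le> C * H powr \<epsilon>"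
proof -
  \<comment> \<open>The cube of the divisor function uses exponent 3 \<delta> and the logarithm at L
    = H^2 uses 2 \<delta>; the total 5 \<delta> stays below \<open>\<epsilon>\<close>.\<close>
  define \<delta> where "\<delta> = \<epsilon> / 8"
  have d: "\<delta> > 0" using assms by (simp add: \<delta>_def)
  obtain C1 where C1: "C1 \<ge> 1" "\<And>n::nat. n > 0 \<Longrightarrow> real (card {d. d dvd n}) \<le> C1 * real n powr \<delta>"
    using divisor_bound[OF d] by blast
  obtain C2 where C2: "C2 \<ge> 0" "\<And>H. H \<ge> 1 \<Longrightarrow> 4 * log (5/4) (4 * H ^ 3) + 25 \<le> C2 * H powr \<delta>"
    using log_le_powr[OF d] by blast
  show ?thesis
  proof
    show "C1 ^ 3 * C2 \<ge> 0" using C1 C2 by simp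
    fix D N :: int and H :: real
    assume as: "D \<noteq> 0" "N \<noteq> 0" "H \<ge> 1" "\<bar>real_of_int D\<bar> \<le> H" "\<bar>real_of_int N\<bar> \<le> H"
    define D' where "D' = squarefree_part D"
    define k where "k = square_part D"
    have Dk: "D = D' * k\<^sup>2" unfolding D'_def k_def by (rule squarefree_decompose)
    have "squarefree D'" by (simp add: D'_def)
    have k0: "k \<noteq> 0" "D' \<noteq> 0" using Dk as by auto
    define L where "L = H\<^sup>2"
    have L: "L \<ge> 1" "H \<le> L" using as(3) by (auto simp: L_def power2_eq_square mult_le_cancel_left1 intro: one_le_power order_trans)
    have Dr: "\<bar>real_of_int D\<bar> = \<bar>real_of_int D'\<bar> * (real_of_int k)\<^sup>2" unfolding Dk by (simp add: abs_mult)
    have k1: "1 \<le> (real_of_int k)\<^sup>2" "\<bar>real_of_int k\<bar> \<le> (real_of_int k)\<^sup>2" "\<bar>real_of_int D'\<bar> \<ge> 1"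
    proof -
      have ak: "\<bar>real_of_int k\<bar> \<ge> 1" using k0 by linarith
      then have "\<bar>real_of_int k\<bar> * 1 \<le> \<bar>real_of_int k\<bar> * \<bar>real_of_int k\<bar>" by (intro mult_left_mono) auto
      then show 1: "\<bar>real_of_int k\<bar> \<le> (real_of_int k)\<^sup>2" by (simp add: power2_eq_square)
      then show "1 \<le> (real_of_int k)\<^sup>2" using ak by linarith
      show "\<bar>real_of_int D'\<bar> \<ge> 1" using k0 by linarith
    qed
    have "\<bar>real_of_int D'\<bar> * 1 \<le> \<bar>real_of_int D'\<bar> * (real_of_int k)\<^sup>2" using k1 by (intro mult_left_mono) auto
    then have D'L: "\<bar>real_of_int D'\<bar> \<le> L" using Dr as L by linarith
    have "1 * (real_of_int k)\<^sup>2 \<le> \<bar>real_of_int D'\<bar> * (real_of_int k)\<^sup>2" using k1 by (intro mult_right_mono) auto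
    then have kH: "\<bar>real_of_int k\<bar> \<le> H" using Dr as k1 by linarith
    define S where "S = {(x::int, y). x\<^sup>2 - D * y\<^sup>2 = N \<and> \<bar>real_of_int x\<bar> \<le> H \<and> \<bar>real_of_int y\<bar> \<le> H}"
    define T where "T = {(x::int, y). x\<^sup>2 - D' * y\<^sup>2 = N \<and> \<bar>real_of_int x\<bar> \<le> L \<and> \<bar>real_of_int y\<bar> \<le> L}"
    have T: "finite T" "real (card T) \<le> real (card {d. d dvd nat \<bar>N\<bar>}) ^ 3 * (4 * log (5/4) (4 * L ^ 3) + 25)"
      using squarefree_pell_card[OF \<open>squarefree D'\<close> as(2) L(1) D'L] unfolding T_def by auto
    have inj: "inj_on (\<lambda>(x, y). (x, k * y)) S" using k0 by (auto simp: inj_on_def)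
    have sub: "(\<lambda>(x, y). (x, k * y)) ` S \<subseteq> T"
    proof
      fix P assume "P \<in> (\<lambda>(x, y). (x, k * y)) ` S"
      then obtain x y where xy: "(x, y) \<in> S" "P = (x, k * y)" by auto
      have "\<bar>real_of_int (k * y)\<bar> \<le> H * H" using xy kH as unfolding S_def of_int_mult abs_mult
        by (intro mult_mono) auto
      then show "P \<in> T" using xy L unfolding S_def T_def
        by (auto simp: Dk power_mult_distrib L_def[symmetric] power2_eq_square[symmetric] mult.assoc)
    qed
    have finS: "finite S" using finite_imageD[OF _ inj] finite_subset[OF sub T(1)] by blast
    have "card S \<le> card T" using card_inj_on_le[OF inj sub T(1)] .
    then have "real (card S) \<le> real (card {d. d dvd nat \<bar>N\<bar>}) ^ 3 * (4 * log (5/4) (4 * L ^ 3) + 25)"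
      using T(2) by linarith
    also have "\<dots> \<le> (C1 * H powr \<delta>) ^ 3 * (C2 * L powr \<delta>)"
    proof (intro mult_mono power_mono)
      have "real (card {d. d dvd nat \<bar>N\<bar>}) \<le> C1 * real (nat \<bar>N\<bar>) powr \<delta>" using as(2) by (intro C1(2)) auto
      also have "\<dots> \<le> C1 * H powr \<delta>" using C1(1) as d by (intro mult_left_mono powr_mono2) auto
      finally show "real (card {d. d dvd nat \<bar>N\<bar>}) \<le> C1 * H powr \<delta>" .
      show "4 * log (5/4) (4 * L ^ 3) + 25 \<le> C2 * L powr \<delta>" using C2(2) L by simp
      have "log (5/4) (4 * L ^ 3) \<ge> 0" using log_cube_nonneg[OF L(1)] .
      then show "0 \<le> 4 * log (5/4) (4 * L ^ 3) + 25" by simp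
    qed (use C1 in auto)
    also have "\<dots> = C1 ^ 3 * C2 * (H powr \<delta>) ^ 5"
      using as(3) unfolding L_def by (simp add: power2_eq_square powr_mult power_mult_distrib eval_nat_numeral)
    also have "(H powr \<delta>) ^ 5 = H powr (5 * \<delta>)" using as(3) by (simp add: powr_power mult.commute)
    also have "C1 ^ 3 * C2 * H powr (5 * \<delta>) \<le> C1 ^ 3 * C2 * H powr \<epsilon>"
      using C1 C2 as assms by (intro mult_left_mono powr_mono) (auto simp: \<delta>_def)
    finally show "finite S \<and> real (card S) \<le> C1 ^ 3 * C2 * H powr \<epsilon>" using finS by blast
  qed
qed

section \<open>Integral points on conics\<close>

text \<open>In the spirit of Siegel's lemma, but for any number of vectors: a nontrivial rational
  relation among the coordinates can be exchanged for an integral one whose height depends on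
  \<open>I\<close> and on the size \<open>H\<close> of the vectors only, not on the given
  coefficients \<open>c\<close>. Coordinates are eliminated one by one, as in Gaussian elimination,
  with a vector of \<open>V\<close> as pivot.\<close>

lemma siegel_height:
  fixes I :: "'i set"
  assumes "finite I"
  shows "\<exists>A::int. \<exists>k::nat. A \<ge> 1 \<and> (\<forall>H V (c :: 'i \<Rightarrow> rat). H \<ge> 1 \<longrightarrow> (\<forall>v\<in>V. \<forall>i\<in>I. \<bar>v i\<bar> \<le> H) \<longrightarrow>
      (\<exists>i\<in>I. c i \<noteq> 0) \<longrightarrow> (\<forall>v\<in>V. (\<Sum>i\<in>I. c i * of_int (v i)) = 0) \<longrightarrow>
      (\<exists>c' :: 'i \<Rightarrow> int. (\<exists>i\<in>I. c' i \<noteq> 0) \<and> (\<forall>i\<in>I. \<bar>c' i\<bar> \<le> A * H ^ k) \<and>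
         (\<forall>v\<in>V. (\<Sum>i\<in>I. c' i * v i) = 0)))"
  using assms
proof (induction I rule: finite_induct)
  case empty
  then show ?case by (intro exI[of _ 1]) auto
next
  case (insert j I)
  from insert.IH obtain A k where A: "A \<ge> 1" and IH: "\<forall>H V (c :: 'i \<Rightarrow> rat). H \<ge> 1 \<longrightarrow> (\<forall>v\<in>V. \<forall>i\<in>I. \<bar>v i\<bar> \<le> H) \<longrightarrow>
      (\<exists>i\<in>I. c i \<noteq> 0) \<longrightarrow> (\<forall>v\<in>V. (\<Sum>i\<in>I. c i * of_int (v i)) = 0) \<longrightarrow>
      (\<exists>c' :: 'i \<Rightarrow> int. (\<exists>i\<in>I. c' i \<noteq> 0) \<and> (\<forall>i\<in>I. \<bar>c' i\<bar> \<le> A * H ^ k) \<and>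
         (\<forall>v\<in>V. (\<Sum>i\<in>I. c' i * v i) = 0))"
    by blast
  \<comment> \<open>The coefficient at \<open>j\<close> will be a sum of \<open>card I\<close> terms
    of size at most H A (2 H^2)^k; the extra 1 keeps \<open>A'\<close> at least 1 even for empty
    \<open>I\<close>.\<close>
  define A' where "A' = (int (card I) + 1) * A * 2 ^ k"
  define k' where "k' = 2 * k + 1"
  have p2: "(1::int) \<le> 2 ^ k" by simp
  have A': "A' \<ge> 1"
  proof -
    have "1 * 1 * 1 \<le> (int (card I) + 1) * A * 2 ^ k"
      using A p2 by (intro mult_mono) auto
    then show ?thesis by (simp add: A'_def)
  qed
  show ?case
  proof (intro exI[of _ A'] exI[of _ k'] conjI allI impI A')
    fix H :: int and V :: "('i \<Rightarrow> int) set" and c :: "'i \<Rightarrow> rat"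
    assume H: "H \<ge> 1" and V: "\<forall>v\<in>V. \<forall>i\<in>insert j I. \<bar>v i\<bar> \<le> H"
      and c: "\<exists>i\<in>insert j I. c i \<noteq> 0" and sol: "\<forall>v\<in>V. (\<Sum>i\<in>insert j I. c i * of_int (v i)) = 0"
    show "\<exists>c' :: 'i \<Rightarrow> int. (\<exists>i\<in>insert j I. c' i \<noteq> 0) \<and> (\<forall>i\<in>insert j I. \<bar>c' i\<bar> \<le> A' * H ^ k') \<and>
         (\<forall>v\<in>V. (\<Sum>i\<in>insert j I. c' i * v i) = 0)"
    proof (cases "\<forall>v\<in>V. v j = 0")
      case True
      define c' where "c' = (\<lambda>i. if i = j then 1 else 0 :: int)"
      have "1 * 1 \<le> A' * H ^ k'" using A' H by (intro mult_mono one_le_power) auto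
      moreover have "(\<Sum>i\<in>insert j I. c' i * v i) = 0" if "v \<in> V" for v
        using True that by (intro sum.neutral) (auto simp: c'_def)
      ultimately show ?thesis by (intro exI[of _ c']) (auto simp: c'_def)
    next
      case False
      then obtain v0 where v0: "v0 \<in> V" "v0 j \<noteq> 0" by auto
      \<comment> \<open>Elimination with pivot \<open>v0\<close>: these vectors vanish at
        \<open>j\<close>, satisfy the relation \<open>c\<close> restricted to \<open>I\<close>, and
        have entries at most 2 H^2.\<close>
      define w where "w v i = v0 j * v i - v j * v0 i" for v i
      have split: "(\<Sum>i\<in>I. c i * of_int (v i)) = - c j * of_int (v j)" if "v \<in> V" for v
        using sol insert.hyps that by (simp add: eq_neg_iff_add_eq_0 add.commute)
      have w0: "(\<Sum>i\<in>I. c i * of_int (w v i)) = 0" if "v \<in> V" for v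
      proof -
        have "(\<Sum>i\<in>I. c i * of_int (w v i)) =
            of_int (v0 j) * (\<Sum>i\<in>I. c i * of_int (v i)) - of_int (v j) * (\<Sum>i\<in>I. c i * of_int (v0 i))"
          by (simp add: w_def sum_distrib_left sum_subtractf[symmetric] algebra_simps)
        then show ?thesis unfolding split[OF that] split[OF v0(1)] by simp
      qed
      have cI: "\<exists>i\<in>I. c i \<noteq> 0"
      proof (rule ccontr)
        assume "\<not> (\<exists>i\<in>I. c i \<noteq> 0)"
        then have "(\<Sum>i\<in>I. c i * of_int (v0 i)) = 0" and "c j \<noteq> 0" using c by auto
        then show False using split[OF v0(1)] v0(2) by simp
      qed
      have wb: "\<bar>w v i\<bar> \<le> 2 * H\<^sup>2" if "v \<in> V" "i \<in> I" for v i
      proof -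
        have "\<bar>w v i\<bar> \<le> \<bar>v0 j\<bar> * \<bar>v i\<bar> + \<bar>v j\<bar> * \<bar>v0 i\<bar>"
          unfolding w_def abs_mult[symmetric] by (rule abs_triangle_ineq4)
        also have "\<dots> \<le> H * H + H * H" using V v0 that H by (intro add_mono mult_mono) auto
        finally show ?thesis by (simp add: power2_eq_square)
      qed
      have "2 * H\<^sup>2 \<ge> 1" using one_le_power[OF H, of 2] by linarith
      moreover have "\<forall>v\<in>w ` V. \<forall>i\<in>I. \<bar>v i\<bar> \<le> 2 * H\<^sup>2" using wb by auto
      moreover have "\<forall>v\<in>w ` V. (\<Sum>i\<in>I. c i * of_int (v i)) = 0" using w0 by auto
      ultimately have "\<exists>c' :: 'i \<Rightarrow> int. (\<exists>i\<in>I. c' i \<noteq> 0) \<and> (\<forall>i\<in>I. \<bar>c' i\<bar> \<le> A * (2 * H\<^sup>2) ^ k) \<and>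
         (\<forall>v\<in>w ` V. (\<Sum>i\<in>I. c' i * v i) = 0)"
        using IH cI by blast
      then obtain c'' where
        c'': "\<exists>i\<in>I. c'' i \<noteq> 0" "\<forall>i\<in>I. \<bar>c'' i\<bar> \<le> A * (2 * H\<^sup>2) ^ k" "\<forall>v\<in>V. (\<Sum>i\<in>I. c'' i * w v i) = 0"
        by auto
      define M where "M = A * (2 * H\<^sup>2) ^ k"
      have M0: "M \<ge> 0" using A H by (simp add: M_def)
      have AM: "A' * H ^ k' = (int (card I) + 1) * (H * M)"
        unfolding A'_def k'_def M_def by (simp add: power_mult_distrib power_mult[symmetric] mult.commute algebra_simps)
      \<comment> \<open>Pull-back of the relation along \<open>w\<close>: the value of
        \<open>c'\<close> at a vector is the value of \<open>c''\<close> at its eliminated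
        version.\<close>
      define c' where "c' i = (if i = j then - (\<Sum>i\<in>I. v0 i * c'' i) else v0 j * c'' i)" for i
      have ji: "i \<noteq> j" if "i \<in> I" for i using that insert.hyps by auto
      have "\<exists>i\<in>insert j I. c' i \<noteq> 0"
        using c''(1) v0(2) ji by (auto simp: c'_def)
      moreover have "\<bar>c' i\<bar> \<le> A' * H ^ k'" if "i \<in> insert j I" for i
      proof (cases "i = j")
        case True
        have "\<bar>\<Sum>i\<in>I. v0 i * c'' i\<bar> \<le> (\<Sum>i\<in>I. \<bar>v0 i * c'' i\<bar>)" by (rule sum_abs)
        also have "\<dots> \<le> (\<Sum>i\<in>I. H * M)" unfolding abs_mult
          using V v0(1) c''(2) H M0 unfolding M_def by (intro sum_mono mult_mono) auto
        also have "\<dots> \<le> A' * H ^ k'" unfolding AM using M0 H by (simp add: algebra_simps)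
        finally show ?thesis using True by (simp add: c'_def)
      next
        case False
        have "\<bar>v0 j * c'' i\<bar> \<le> H * M" unfolding abs_mult
          using V v0(1) c''(2) H M0 False that unfolding M_def by (intro mult_mono) auto
        also have "\<dots> \<le> A' * H ^ k'" unfolding AM using M0 H by (simp add: algebra_simps)
        finally show ?thesis using False by (simp add: c'_def)
      qed
      moreover have "(\<Sum>i\<in>insert j I. c' i * v i) = 0" if "v \<in> V" for v
      proof -
        have "(\<Sum>i\<in>I. c' i * v i) = (\<Sum>i\<in>I. v0 j * c'' i * v i)"
          using ji by (intro sum.cong) (auto simp: c'_def)
        then have "(\<Sum>i\<in>insert j I. c' i * v i) = (\<Sum>i\<in>I. c'' i * w v i)"
          using insert.hyps by (simp add: c'_def w_def sum_distrib_left sum_distrib_right sum_subtractf algebra_simps)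
        then show ?thesis using c''(3) that by simp
      qed
      ultimately show ?thesis by (intro exI[of _ c']) auto
    qed
  qed
qed

text \<open>If \<open>p\<close> were nonzero, \<open>\<Delta>\<close> would be the square of a
  linear polynomial, but its discriminant is 4 d^2 E. In \<open>conic_bound\<close> this says that
  eliminating \<open>t\<close> between the given conic and a second one leaves a nonzero polynomial
  in \<open>s\<close>.\<close>

lemma nonsquare_times_square:
  fixes p q \<Delta> :: "rat poly" and d e E :: rat
  assumes "d \<noteq> 0" "E \<noteq> 0" and \<Delta>: "\<Delta> = [:d * (e\<^sup>2 - E), 2 * d * e, d:]" and eq: "p\<^sup>2 * \<Delta> = q\<^sup>2"
  shows "p = 0"
proof (rule ccontr)
  assume "p \<noteq> 0"
  have "p\<^sup>2 dvd q\<^sup>2" unfolding eq[symmetric] by (rule dvd_triv_left)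
  then have "p dvd q" by simp
  then obtain k where "q = p * k" by blast
  then have "p\<^sup>2 * \<Delta> = p\<^sup>2 * k\<^sup>2" using eq by (simp add: power_mult_distrib)
  then have k: "\<Delta> = k\<^sup>2" using \<open>p \<noteq> 0\<close> by simp
  have "degree (k\<^sup>2) = 2" unfolding k[symmetric] \<Delta> using assms by simp
  moreover from this have "k \<noteq> 0" by auto
  ultimately have "degree k = 1" by (simp add: degree_power_eq)
  then have kk: "k = [:coeff k 0, coeff k 1:]"
    by (intro poly_eqI) (auto simp: coeff_pCons coeff_eq_0 split: nat.splits)
  define k0 k1 where "k0 = coeff k 0" and "k1 = coeff k 1"
  have "[:d * (e\<^sup>2 - E), 2 * d * e, d:] = [:k0, k1:] * [:k0, k1:]"
    using k kk unfolding \<Delta> k0_def k1_def power2_eq_square by metis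
  then have co: "d * (e\<^sup>2 - E) = k0 * k0" "2 * d * e = 2 * k0 * k1" "d = k1 * k1" by auto
  have "(2 * d * e) * (2 * d * e) = 4 * (k0 * k0) * (k1 * k1)" unfolding co(2) by simp
  then have "(2 * d * e) * (2 * d * e) = 4 * (d * (e\<^sup>2 - E)) * d" unfolding co(1)[symmetric] co(3)[symmetric] .
  then have "d\<^sup>2 * E = 0" by (simp add: power2_eq_square algebra_simps)
  then show False using assms by simp
qed

lemma card_square_eq_le:
  fixes u v :: rat
  shows "finite {t::int. (of_int t + u)\<^sup>2 = v} \<and> card {t::int. (of_int t + u)\<^sup>2 = v} \<le> 2"
proof (cases "{t::int. (of_int t + u)\<^sup>2 = v} = {}")
  case False
  then obtain t0 :: int where t0: "(of_int t0 + u)\<^sup>2 = v" by auto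
  \<comment> \<open>The other root is the reflection of \<open>t0\<close> in -u; the floor merely
    provides an integer equal to it whenever it is integral.\<close>
  have "{t::int. (of_int t + u)\<^sup>2 = v} \<subseteq> {t0, \<lfloor>- 2 * u - of_int t0\<rfloor>}"
  proof
    fix t :: int assume "t \<in> {t::int. (of_int t + u)\<^sup>2 = v}"
    then have "(of_int t + u)\<^sup>2 = (of_int t0 + u)\<^sup>2" using t0 by simp
    then have "of_int t + u = of_int t0 + u \<or> of_int t + u = - (of_int t0 + u)"
      by (simp only: power2_eq_iff)
    then have "t = t0 \<or> of_int t = - 2 * u - of_int t0" by auto
    then show "t \<in> {t0, \<lfloor>- 2 * u - of_int t0\<rfloor>}" by (metis floor_of_int insert_iff)
  qed
  moreover have "card {t0, \<lfloor>- 2 * u - of_int t0\<rfloor>} \<le> 2" by (simp add: card_insert_if)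
  ultimately show ?thesis
    by (meson card_mono finite.emptyI finite_insert finite_subset le_trans)
qed (simp only: card.empty, simp)

text \<open>The equation in question is \<open>X\<^sup>2 = D s\<^sup>2 + e s + g\<close> with \<open>X = 2 a t + h s + l\<close>, and
  \<open>Z = 2 D s + e\<close> turns it into \<open>Z\<^sup>2 - 4 D X\<^sup>2 = e\<^sup>2 - 4 D g\<close>.\<close>

lemma integral_conic_card:
  fixes \<epsilon> :: real
  assumes "\<epsilon> > 0"
  obtains C where "C \<ge> 0"
    "\<And>(a::int) h k l m c (M::real) (b::nat). a \<noteq> 0 \<Longrightarrow> h\<^sup>2 - 4 * a * k \<noteq> 0 \<Longrightarrow>
      (2 * h * l - 4 * a * m)\<^sup>2 - 4 * (h\<^sup>2 - 4 * a * k) * (l\<^sup>2 - 4 * a * c) \<noteq> 0 \<Longrightarrow> M \<ge> 1 \<Longrightarrow> b \<ge> 1 \<Longrightarrow>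
      (\<And>u. u \<in> {a, h, k, l, m, c} \<Longrightarrow> \<bar>real_of_int u\<bar> \<le> M) \<Longrightarrow>
      real (card {(s::int, t::int). \<bar>s\<bar> \<le> int b \<and> \<bar>t\<bar> \<le> int b \<and> a * t\<^sup>2 + h * t * s + k * s\<^sup>2 + l * t + m * s + c = 0})
        \<le> C * (136 * M ^ 4 * real b) powr \<epsilon>"
proof -
  obtain C where C: "C \<ge> 0"
    "\<And>D N H. D \<noteq> 0 \<Longrightarrow> N \<noteq> 0 \<Longrightarrow> H \<ge> 1 \<Longrightarrow> \<bar>real_of_int D\<bar> \<le> H \<Longrightarrow> \<bar>real_of_int N\<bar> \<le> H \<Longrightarrow>
      finite {(x::int, y). x\<^sup>2 - D * y\<^sup>2 = N \<and> \<bar>real_of_int x\<bar> \<le> H \<and> \<bar>real_of_int y\<bar> \<le> H} \<and>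
      real (card {(x::int, y). x\<^sup>2 - D * y\<^sup>2 = N \<and> \<bar>real_of_int x\<bar> \<le> H \<and> \<bar>real_of_int y\<bar> \<le> H}) \<le> C * H powr \<epsilon>"
    using pell_bound[OF assms] by blast
  show ?thesis
  proof
    show "C \<ge> 0" by (rule C)
    fix a h k l m c :: int and M :: real and b :: nat
    assume a0: "a \<noteq> 0" and D0: "h\<^sup>2 - 4 * a * k \<noteq> 0"
      and N0: "(2 * h * l - 4 * a * m)\<^sup>2 - 4 * (h\<^sup>2 - 4 * a * k) * (l\<^sup>2 - 4 * a * c) \<noteq> 0"
      and M: "M \<ge> 1" and b: "b \<ge> 1" and coef: "\<And>u. u \<in> {a, h, k, l, m, c} \<Longrightarrow> \<bar>real_of_int u\<bar> \<le> M"
    define D where "D = h\<^sup>2 - 4 * a * k"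
    define e where "e = 2 * h * l - 4 * a * m"
    define g where "g = l\<^sup>2 - 4 * a * c"
    define N where "N = e\<^sup>2 - 4 * D * g"
    \<comment> \<open>The number 136 comes from \<open>N\<close>: |e|^2 \<le> 36 M^4 and 4 |D g|
      \<le> 100 M^4. The factor \<open>b\<close> leaves room for the new coordinates, |X| \<le> 4 M
      b and |Z| \<le> 16 M^2 b.\<close>
    define H where "H = 136 * M ^ 4 * real b"
    have prodb: "\<bar>real_of_int (u * v)\<bar> \<le> M\<^sup>2" if "u \<in> {a, h, k, l, m, c}" "v \<in> {a, h, k, l, m, c}" for u v
      unfolding of_int_mult abs_mult power2_eq_square
      using coef[OF that(1)] coef[OF that(2)] M by (intro mult_mono) auto
    have Db: "\<bar>real_of_int D\<bar> \<le> 5 * M\<^sup>2"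
    proof -
      have "real_of_int D = real_of_int (h * h) - 4 * real_of_int (a * k)"
        by (simp add: D_def power2_eq_square)
      moreover have "\<bar>real_of_int (h * h)\<bar> \<le> M\<^sup>2" "\<bar>real_of_int (a * k)\<bar> \<le> M\<^sup>2" by (rule prodb; simp)+
      ultimately show ?thesis by linarith
    qed
    have eb: "\<bar>real_of_int e\<bar> \<le> 6 * M\<^sup>2"
    proof -
      have "real_of_int e = 2 * real_of_int (h * l) - 4 * real_of_int (a * m)"
        by (simp add: e_def power2_eq_square)
      moreover have "\<bar>real_of_int (h * l)\<bar> \<le> M\<^sup>2" "\<bar>real_of_int (a * m)\<bar> \<le> M\<^sup>2" by (rule prodb; simp)+
      ultimately show ?thesis by linarith
    qed
    have gb: "\<bar>real_of_int g\<bar> \<le> 5 * M\<^sup>2"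
    proof -
      have "real_of_int g = real_of_int (l * l) - 4 * real_of_int (a * c)"
        by (simp add: g_def power2_eq_square)
      moreover have "\<bar>real_of_int (l * l)\<bar> \<le> M\<^sup>2" "\<bar>real_of_int (a * c)\<bar> \<le> M\<^sup>2" by (rule prodb; simp)+
      ultimately show ?thesis by linarith
    qed
    have b1: "real b \<ge> 1" using b by simp
    have M2: "1 \<le> M\<^sup>2" "M \<le> M\<^sup>2" "M\<^sup>2 \<le> M ^ 4"
      using M by (auto intro: one_le_power power_increasing self_le_power)
    have Nb: "\<bar>real_of_int N\<bar> \<le> 136 * M ^ 4"
    proof -
      have "\<bar>real_of_int e * real_of_int e\<bar> \<le> (6 * M\<^sup>2) * (6 * M\<^sup>2)"
        unfolding abs_mult using eb by (intro mult_mono) auto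
      moreover have "\<bar>real_of_int D * real_of_int g\<bar> \<le> (5 * M\<^sup>2) * (5 * M\<^sup>2)"
        unfolding abs_mult using Db gb by (intro mult_mono) auto
      moreover have "real_of_int N = real_of_int e * real_of_int e - 4 * (real_of_int D * real_of_int g)"
        by (simp add: N_def power2_eq_square)
      moreover have "(6 * M\<^sup>2) * (6 * M\<^sup>2) = 36 * M ^ 4" "(5 * M\<^sup>2) * (5 * M\<^sup>2) = 25 * M ^ 4"
        by (simp_all add: power2_eq_square power4_eq_xxxx)
      ultimately show ?thesis by linarith
    qed
    have bM: "M ^ 4 * 1 \<le> M ^ 4 * real b" "1 * real b \<le> M ^ 4 * real b" "M\<^sup>2 * real b \<le> M ^ 4 * real b"
      using M2 b1 M by (auto intro!: mult_mono one_le_power)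
    have H1: "H \<ge> 1" unfolding H_def using bM b1 by linarith
    have DH: "\<bar>real_of_int (4 * D)\<bar> \<le> H" 
    proof -
      have "\<bar>real_of_int (4 * D)\<bar> = 4 * \<bar>real_of_int D\<bar>" by (simp add: abs_mult)
      moreover have "5 * M\<^sup>2 \<le> 5 * (M ^ 4 * real b)" using bM(1) M2(3) by linarith
      ultimately show ?thesis unfolding H_def using Db bM(1) M2 by linarith
    qed
    have NH: "\<bar>real_of_int N\<bar> \<le> H" unfolding H_def using Nb bM by simp
    define S where "S = {(s::int, t::int). \<bar>s\<bar> \<le> int b \<and> \<bar>t\<bar> \<le> int b \<and> a * t\<^sup>2 + h * t * s + k * s\<^sup>2 + l * t + m * s + c = 0}"
    define T where "T = {(x::int, y). x\<^sup>2 - 4 * D * y\<^sup>2 = N \<and> \<bar>real_of_int x\<bar> \<le> H \<and> \<bar>real_of_int y\<bar> \<le> H}"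
    have T: "finite T" "real (card T) \<le> C * H powr \<epsilon>"
      using C(2)[of "4 * D" N H] D0 N0 H1 DH NH unfolding T_def D_def e_def g_def N_def by auto
    define \<phi> where "\<phi> = (\<lambda>(s, t). (2 * D * s + e, 2 * a * t + h * s + l))"
    have "inj_on \<phi> S" using a0 D0 unfolding \<phi>_def D_def[symmetric] by (auto simp: inj_on_def)
    moreover have "\<phi> ` S \<subseteq> T"
    proof
      fix Q assume "Q \<in> \<phi> ` S"
      then obtain s t where st: "(s, t) \<in> S" and Q: "Q = (2 * D * s + e, 2 * a * t + h * s + l)"
        by (auto simp: \<phi>_def)
      define X where "X = 2 * a * t + h * s + l"
      define Z where "Z = 2 * D * s + e"
      have sb: "\<bar>real_of_int s\<bar> \<le> real b" "\<bar>real_of_int t\<bar> \<le> real b" using st by (auto simp: S_def)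
      have "X\<^sup>2 - (D * s\<^sup>2 + e * s + g) = 4 * a * (a * t\<^sup>2 + h * t * s + k * s\<^sup>2 + l * t + m * s + c)"
        unfolding X_def D_def e_def g_def by (simp add: power2_eq_square algebra_simps)
      also have "\<dots> = 0" using st by (simp add: S_def)
      finally have "X\<^sup>2 = D * s\<^sup>2 + e * s + g" by simp
      then have eq: "Z\<^sup>2 - 4 * D * X\<^sup>2 = N" unfolding Z_def N_def by (simp add: power2_eq_square algebra_simps)
      have "\<bar>real_of_int a * real_of_int t\<bar> \<le> M * real b" "\<bar>real_of_int h * real_of_int s\<bar> \<le> M * real b"
      proof -
        have "\<bar>real_of_int a\<bar> \<le> M" "\<bar>real_of_int h\<bar> \<le> M" by (rule coef; simp)+
        then show "\<bar>real_of_int a * real_of_int t\<bar> \<le> M * real b" "\<bar>real_of_int h * real_of_int s\<bar> \<le> M * real b"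
          unfolding abs_mult using sb M by (simp_all add: mult_mono)
      qed
      moreover have "\<bar>real_of_int l\<bar> \<le> M * real b"
      proof -
        have "\<bar>real_of_int l\<bar> \<le> M" by (rule coef) simp
        then have "\<bar>real_of_int l\<bar> \<le> M * 1" by simp
        also have "\<dots> \<le> M * real b" using b1 M by (intro mult_left_mono) auto
        finally show ?thesis .
      qed
      moreover have "real_of_int X = 2 * (real_of_int a * real_of_int t) + real_of_int h * real_of_int s + real_of_int l"
        by (simp add: X_def)
      ultimately have "\<bar>real_of_int X\<bar> \<le> 4 * (M * real b)" by linarith
      moreover have "M * real b \<le> M\<^sup>2 * real b" using M2 b1 by (intro mult_right_mono) auto
      moreover have "M\<^sup>2 * real b \<ge> 0" using M by simp
      ultimately have XH: "\<bar>real_of_int X\<bar> \<le> H" unfolding H_def using bM(3) by linarith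
      have "\<bar>real_of_int D * real_of_int s\<bar> \<le> (5 * M\<^sup>2) * real b"
        unfolding abs_mult using Db sb M by (intro mult_mono) auto
      moreover have "\<bar>real_of_int e\<bar> \<le> 6 * (M\<^sup>2 * real b)"
        using eb b1 M2 mult_left_mono[of 1 "real b" "M\<^sup>2"] by linarith
      moreover have "real_of_int Z = 2 * (real_of_int D * real_of_int s) + real_of_int e"
        by (simp add: Z_def)
      ultimately have "\<bar>real_of_int Z\<bar> \<le> 16 * (M\<^sup>2 * real b)" by linarith
      moreover have "M\<^sup>2 * real b \<ge> 0" using M by simp
      ultimately have ZH: "\<bar>real_of_int Z\<bar> \<le> H" unfolding H_def using bM(3) by linarith
      show "Q \<in> T" using eq XH ZH unfolding Q T_def X_def Z_def by simp
    qed
    ultimately have "card S \<le> card T" using T(1) by (rule card_inj_on_le)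
    then show "real (card S) \<le> C * (136 * M ^ 4 * real b) powr \<epsilon>" using T(2) unfolding H_def by linarith
  qed
qed

text \<open>By \<open>siegel_height\<close> the lattice points of the conic either determine it, and then
  it has an integral equation of polynomially bounded height, or lie on a second conic.\<close>

lemma conic_bound:
  fixes \<epsilon> :: real
  assumes "\<epsilon> > 0"
  obtains C where "C \<ge> 0"
    "\<And>(h::rat) l d e E (b::nat). d \<noteq> 0 \<Longrightarrow> E \<noteq> 0 \<Longrightarrow> b \<ge> 1 \<Longrightarrow>
      real (card {(s::int, t::int). \<bar>s\<bar> \<le> int b \<and> \<bar>t\<bar> \<le> int b \<and>
        (of_int t + (h * of_int s + l))\<^sup>2 = d * ((of_int s + e)\<^sup>2 - E)}) \<le> C * real b powr \<epsilon>"
proof -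
  obtain A :: int and k :: nat where A: "A \<ge> 1" and siegel: "\<forall>H V (c :: nat \<Rightarrow> rat). H \<ge> 1 \<longrightarrow> (\<forall>v\<in>V. \<forall>i\<in>{..<6}. \<bar>v i\<bar> \<le> H) \<longrightarrow>
      (\<exists>i\<in>{..<6}. c i \<noteq> 0) \<longrightarrow> (\<forall>v\<in>V. (\<Sum>i\<in>{..<6}. c i * of_int (v i)) = 0) \<longrightarrow>
      (\<exists>c' :: nat \<Rightarrow> int. (\<exists>i\<in>{..<6}. c' i \<noteq> 0) \<and> (\<forall>i\<in>{..<6}. \<bar>c' i\<bar> \<le> A * H ^ k) \<and>
         (\<forall>v\<in>V. (\<Sum>i\<in>{..<6}. c' i * v i) = 0))"
    using siegel_height[of "{..<6::nat}"] by blast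
  \<comment> \<open>The monomials are bounded by b^2, so the integral equation has height M = A b^(2
    k), and 136 M^4 b is a constant times b^(8 k + 1).\<close>
  define \<delta> where "\<delta> = \<epsilon> / (8 * real k + 1)"
  have \<delta>: "\<delta> > 0" using assms by (simp add: \<delta>_def)
  obtain C where C: "C \<ge> 0"
    "\<And>(a::int) h k l m c (M::real) (b::nat). a \<noteq> 0 \<Longrightarrow> h\<^sup>2 - 4 * a * k \<noteq> 0 \<Longrightarrow>
      (2 * h * l - 4 * a * m)\<^sup>2 - 4 * (h\<^sup>2 - 4 * a * k) * (l\<^sup>2 - 4 * a * c) \<noteq> 0 \<Longrightarrow> M \<ge> 1 \<Longrightarrow> b \<ge> 1 \<Longrightarrow>
      (\<And>u. u \<in> {a, h, k, l, m, c} \<Longrightarrow> \<bar>real_of_int u\<bar> \<le> M) \<Longrightarrow>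
      real (card {(s::int, t::int). \<bar>s\<bar> \<le> int b \<and> \<bar>t\<bar> \<le> int b \<and> a * t\<^sup>2 + h * t * s + k * s\<^sup>2 + l * t + m * s + c = 0})
        \<le> C * (136 * M ^ 4 * real b) powr \<delta>"
    using integral_conic_card[OF \<delta>] by blast
  define K where "K = C * (136 * real_of_int A ^ 4) powr \<delta>"
  have K0: "K \<ge> 0" using C by (simp add: K_def)
  show ?thesis
  proof
    show "K + 8 \<ge> 0" using K0 by simp
    fix h l d e E :: rat and b :: nat
    assume d0: "d \<noteq> 0" and E0: "E \<noteq> 0" and b: "b \<ge> 1"
    define S where "S = {(s::int, t::int). \<bar>s\<bar> \<le> int b \<and> \<bar>t\<bar> \<le> int b \<and>
        (of_int t + (h * of_int s + l))\<^sup>2 = d * ((of_int s + e)\<^sup>2 - E)}"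
    have bpow: "1 \<le> real b powr \<epsilon>" using b assms by (simp add: ge_one_powr_ge_zero)
    have "S \<subseteq> {-int b..int b} \<times> {-int b..int b}" unfolding S_def by auto
    then have finS: "finite S" using finite_subset by blast
    define mon where "mon = (\<lambda>(s::int, t::int) (i::nat). [t\<^sup>2, t * s, s\<^sup>2, t, s, 1] ! i)"
    \<comment> \<open>Coefficients of the expanded equation in the order t^2, t s, s^2, t, s, 1. The
      leading 1 makes the rational relation nontrivial.\<close>
    define c where "c i = [1, 2 * h, h\<^sup>2 - d, 2 * l, 2 * h * l - 2 * d * e, l\<^sup>2 - d * e\<^sup>2 + d * E] ! i" for i :: nat
    have six: "{..<6::nat} = {0, 1, 2, 3, 4, 5}" by auto
    have mb: "\<forall>v\<in>mon ` S. \<forall>i\<in>{..<6}. \<bar>v i\<bar> \<le> (int b)\<^sup>2"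
    proof (intro ballI)
      fix v and i :: nat assume "v \<in> mon ` S" and i: "i \<in> {..<6}"
      then obtain s t where st: "(s, t) \<in> S" and v: "v = mon (s, t)" by auto
      have b2: "1 \<le> (int b)\<^sup>2" "int b \<le> (int b)\<^sup>2" using b by (auto intro: one_le_power self_le_power)
      have "\<bar>s\<bar> \<le> int b" "\<bar>t\<bar> \<le> int b" using st by (auto simp: S_def)
      moreover have "\<bar>u * v\<bar> \<le> (int b)\<^sup>2" if "\<bar>u\<bar> \<le> int b" "\<bar>v\<bar> \<le> int b" for u v
        unfolding abs_mult power2_eq_square by (rule mult_mono) (use that in auto)
      ultimately have "\<bar>s\<bar> \<le> int b" "\<bar>t\<bar> \<le> int b" "\<bar>t * s\<bar> \<le> (int b)\<^sup>2" "\<bar>t * t\<bar> \<le> (int b)\<^sup>2" "\<bar>s * s\<bar> \<le> (int b)\<^sup>2"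
        by blast+
      moreover from this b2 have "\<bar>s\<bar> \<le> (int b)\<^sup>2" "\<bar>t\<bar> \<le> (int b)\<^sup>2" by linarith+
      ultimately show "\<bar>v i\<bar> \<le> (int b)\<^sup>2"
        using i b2(1) unfolding six v mon_def by (auto simp: power2_eq_square[of s] power2_eq_square[of t])
    qed
    have sum6: "(\<Sum>i\<in>{..<6}. f i) = f 0 + f 1 + f 2 + f 3 + f 4 + f 5" for f :: "nat \<Rightarrow> 'z::comm_ring_1"
      unfolding six by (simp add: algebra_simps)
    have ms: "\<forall>v\<in>mon ` S. (\<Sum>i\<in>{..<6}. c i * of_int (v i)) = 0"
    proof
      fix v assume "v \<in> mon ` S"
      then obtain s t where st: "(s, t) \<in> S" and v: "v = mon (s, t)" by auto
      have "(\<Sum>i\<in>{..<6}. c i * of_int (mon (s, t) i)) =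
         (of_int t + (h * of_int s + l))\<^sup>2 - d * ((of_int s + e)\<^sup>2 - E)"
        unfolding sum6 c_def mon_def by (simp add: power2_eq_square algebra_simps)
      also have "\<dots> = 0" using st by (simp add: S_def)
      finally show "(\<Sum>i\<in>{..<6}. c i * of_int (v i)) = 0" unfolding v .
    qed
    have c0: "\<exists>i\<in>{..<6}. c i \<noteq> 0" by (rule bexI[of _ 0]) (auto simp: c_def)
    have b2: "1 \<le> (int b)\<^sup>2" using b by (auto intro: one_le_power)
    obtain c' where c'0: "\<exists>i\<in>{..<6}. c' i \<noteq> 0" and c'b: "\<forall>i\<in>{..<6}. \<bar>c' i\<bar> \<le> A * ((int b)\<^sup>2) ^ k"
      and c's: "\<forall>v\<in>mon ` S. (\<Sum>i\<in>{..<6}. c' i * v i) = 0"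
      using siegel[THEN spec, THEN spec, THEN spec, THEN mp, OF b2, THEN mp, OF mb, THEN mp, OF c0, THEN mp, OF ms]
      by blast
    have c's': "c' 0 * t\<^sup>2 + c' 1 * t * s + c' 2 * s\<^sup>2 + c' 3 * t + c' 4 * s + c' 5 = 0" if "(s, t) \<in> S" for s t
    proof -
      have "(\<Sum>i\<in>{..<6}. c' i * mon (s, t) i) = 0" using c's that by blast
      then show ?thesis unfolding sum6 mon_def by (simp add: mult.assoc)
    qed
    show "real (card S) \<le> (K + 8) * real b powr \<epsilon>"
    proof (cases "\<forall>i\<in>{..<6}. of_int (c' i) = of_int (c' 0) * c i")
      case True
      define a where "a = (of_int (c' 0) :: rat)"
      have cc: "of_int (c' 1) = a * (2 * h)" "of_int (c' 2) = a * (h\<^sup>2 - d)" "of_int (c' 3) = a * (2 * l)"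
        "of_int (c' 4) = a * (2 * h * l - 2 * d * e)" "of_int (c' 5) = a * (l\<^sup>2 - d * e\<^sup>2 + d * E)"
        using True unfolding six c_def a_def by auto
      have a0: "c' 0 \<noteq> 0" using True c'0 by force
      then have "a \<noteq> 0" by (simp add: a_def)
      have D: "of_int ((c' 1)\<^sup>2 - 4 * c' 0 * c' 2) = 4 * a\<^sup>2 * d"
        unfolding of_int_diff of_int_mult of_int_power cc a_def[symmetric] by (simp add: power2_eq_square algebra_simps)
      then have D0: "(c' 1)\<^sup>2 - 4 * c' 0 * c' 2 \<noteq> 0" using \<open>a \<noteq> 0\<close> d0
        by (metis mult_eq_0_iff of_int_0 power_not_zero zero_neq_numeral)
      \<comment> \<open>Up to the common factor this is the right-hand side of the Pell type
        equation; here E \<noteq> 0 prevents it from vanishing.\<close>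
      have "of_int ((2 * c' 1 * c' 3 - 4 * c' 0 * c' 4)\<^sup>2 - 4 * ((c' 1)\<^sup>2 - 4 * c' 0 * c' 2) * ((c' 3)\<^sup>2 - 4 * c' 0 * c' 5)) = 64 * a ^ 4 * d\<^sup>2 * E"
        unfolding of_int_diff of_int_mult of_int_power cc a_def[symmetric] by (simp add: power2_eq_square power4_eq_xxxx algebra_simps)
      then have N0: "(2 * c' 1 * c' 3 - 4 * c' 0 * c' 4)\<^sup>2 - 4 * ((c' 1)\<^sup>2 - 4 * c' 0 * c' 2) * ((c' 3)\<^sup>2 - 4 * c' 0 * c' 5) \<noteq> 0"
        using \<open>a \<noteq> 0\<close> d0 E0 by (metis mult_eq_0_iff of_int_0 power_not_zero zero_neq_numeral)
      define M where "M = real_of_int (A * ((int b)\<^sup>2) ^ k)"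
      have Meq: "M = real_of_int A * real b ^ (2 * k)" unfolding M_def by (simp add: power_mult)
      have "1 * 1 \<le> A * ((int b)\<^sup>2) ^ k" using A b by (intro mult_mono one_le_power) auto
      then have M1: "M \<ge> 1" unfolding M_def by linarith
      have cM: "\<bar>real_of_int u\<bar> \<le> M" if "u \<in> {c' 0, c' 1, c' 2, c' 3, c' 4, c' 5}" for u
        using that c'b unfolding M_def six of_int_abs[symmetric] of_int_le_iff by auto
      define S' where "S' = {(s::int, t::int). \<bar>s\<bar> \<le> int b \<and> \<bar>t\<bar> \<le> int b \<and> c' 0 * t\<^sup>2 + c' 1 * t * s + c' 2 * s\<^sup>2 + c' 3 * t + c' 4 * s + c' 5 = 0}"
      have "S' \<subseteq> {-int b..int b} \<times> {-int b..int b}" unfolding S'_def by auto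
      then have "finite S'" using finite_subset by blast
      moreover have "S \<subseteq> S'" using c's' by (auto simp: S'_def S_def)
      ultimately have "card S \<le> card S'" by (rule card_mono)
      also have "real (card S') \<le> C * (136 * M ^ 4 * real b) powr \<delta>"
        unfolding S'_def using C(2)[OF a0 D0 N0 M1 b cM] .
      also have "136 * M ^ 4 * real b = (136 * real_of_int A ^ 4) * real b ^ (8 * k + 1)"
        unfolding Meq by (simp add: power_mult_distrib power_mult[symmetric] power_add mult.commute)
      also have "\<dots> powr \<delta> = (136 * real_of_int A ^ 4) powr \<delta> * real b powr \<epsilon>"
      proof -
        have "(real b ^ (8 * k + 1)) powr \<delta> = (real b powr real (8 * k + 1)) powr \<delta>"
          using b by (subst powr_realpow) auto
        also have "\<dots> = real b powr \<epsilon>"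
          unfolding powr_powr \<delta>_def using assms by (simp add: add.commute)
        finally show ?thesis using A by (simp only: powr_mult)
      qed
      finally have "real (card S) \<le> K * real b powr \<epsilon>" unfolding K_def by (simp add: mult.assoc)
      then show ?thesis using bpow by (simp add: algebra_simps)
    next
      case False
      define a where "a = (of_int (c' 0) :: rat)"
      \<comment> \<open>Subtracting \<open>c' 0\<close> times the given equation removes t^2 and
        leaves p(s) t + q0(s) = 0, that is p(s) (t + h s + l) = q(s). Squaring and inserting the
        conic gives p^2 \<Delta> = q^2 at the first coordinate of every point.\<close>
      define p where "p = [:of_int (c' 3) - a * c 3, of_int (c' 1) - a * c 1:]"
      define q0 where "q0 = [:of_int (c' 5) - a * c 5, of_int (c' 4) - a * c 4, of_int (c' 2) - a * c 2:]"
      define q where "q = p * [:l, h:] - q0"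
      define \<Delta> where "\<Delta> = [:d * (e\<^sup>2 - E), 2 * d * e, d:]"
      define r where "r = p\<^sup>2 * \<Delta> - q\<^sup>2"
      have root: "poly r (of_int s) = 0" if st: "(s, t) \<in> S" for s t
      proof -
        define x y where "x = (of_int s :: rat)" and "y = (of_int t :: rat)"
        have 1: "(y + (h * x + l))\<^sup>2 = d * ((x + e)\<^sup>2 - E)" using st by (simp add: S_def x_def y_def)
        have "of_int (c' 0 * t\<^sup>2 + c' 1 * t * s + c' 2 * s\<^sup>2 + c' 3 * t + c' 4 * s + c' 5) = (0 :: rat)"
          unfolding c's'[OF st] by simp
        then have 2: "a * y\<^sup>2 + of_int (c' 1) * y * x + of_int (c' 2) * x\<^sup>2 + of_int (c' 3) * y + of_int (c' 4) * x + of_int (c' 5) = 0"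
          by (simp add: a_def x_def y_def)
        have 3: "y\<^sup>2 + c 1 * y * x + c 2 * x\<^sup>2 + c 3 * y + c 4 * x + c 5 = 0"
          using 1 unfolding c_def by (simp add: power2_eq_square algebra_simps)
        have "poly p x * y + poly q0 x =
           (a * y\<^sup>2 + of_int (c' 1) * y * x + of_int (c' 2) * x\<^sup>2 + of_int (c' 3) * y + of_int (c' 4) * x + of_int (c' 5))
           - a * (y\<^sup>2 + c 1 * y * x + c 2 * x\<^sup>2 + c 3 * y + c 4 * x + c 5)"
          unfolding p_def q0_def by (simp add: power2_eq_square algebra_simps)
        then have "poly p x * y + poly q0 x = 0" unfolding 2 3 by simp
        then have "poly q x = poly p x * (y + (h * x + l))"
          unfolding q_def by (simp add: algebra_simps eq_neg_iff_add_eq_0)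
        moreover have "poly \<Delta> x = d * ((x + e)\<^sup>2 - E)" unfolding \<Delta>_def by (simp add: power2_eq_square algebra_simps)
        ultimately show ?thesis using 1 unfolding r_def x_def[symmetric] by (simp add: power_mult_distrib)
      qed
      have "r \<noteq> 0"
      proof
        assume "r = 0"
        then have "p\<^sup>2 * \<Delta> = q\<^sup>2" by (simp add: r_def)
        then have p0: "p = 0" using nonsquare_times_square[OF d0 E0 \<Delta>_def] by blast
        then have "q = 0" using \<open>r = 0\<close> by (simp add: r_def)
        then have "q0 = 0" using p0 by (simp add: q_def)
        then have "\<forall>i\<in>{..<6}. of_int (c' i) = of_int (c' 0) * c i"
          using p0 unfolding p_def q0_def six a_def[symmetric] by (simp add: c_def a_def)
        then show False using False by simp
      qed
      define R where "R = {s::int. poly r (of_int s) = 0}"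
      have "degree r \<le> 4"
      proof -
        have "degree p \<le> 1" "degree q0 \<le> 2" "degree \<Delta> \<le> 2" unfolding p_def q0_def \<Delta>_def by (auto simp: degree_pCons_eq_if)
        moreover have "degree [:l, h:] \<le> 1" by (auto simp: degree_pCons_eq_if)
        ultimately have "degree q \<le> 2" unfolding q_def
          using degree_mult_le[of p "[:l, h:]"] by (intro degree_diff_le) auto
        moreover have "degree (p\<^sup>2) \<le> 2" using degree_power_le[of p 2] \<open>degree p \<le> 1\<close> by simp
        ultimately show ?thesis unfolding r_def
          using degree_mult_le[of "p\<^sup>2" \<Delta>] degree_power_le[of q 2] \<open>degree \<Delta> \<le> 2\<close>
          by (intro degree_diff_le) auto
      qed
      moreover have "card R \<le> card {x. poly r x = 0}"
        unfolding R_def by (rule card_inj_on_le[where f = of_int]) (auto simp: inj_on_def poly_roots_finite[OF \<open>r \<noteq> 0\<close>])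
      ultimately have R4: "card R \<le> 4" using card_poly_roots_bound[OF \<open>r \<noteq> 0\<close>] by linarith
      have finR: "finite R" unfolding R_def
        by (rule finite_imageD[of of_int]) (auto intro: finite_subset[OF _ poly_roots_finite[OF \<open>r \<noteq> 0\<close>]] simp: inj_on_def)
      have "real (card S) \<le> real (card R) * 2"
      proof (rule card_fibres_le[where \<phi> = fst, OF finS finR])
        show "fst P \<in> R" if "P \<in> S" for P using root that by (cases P) (auto simp: R_def)
        fix s assume "s \<in> R"
        define F where "F = {t::int. (of_int t + (h * of_int s + l))\<^sup>2 = d * ((of_int s + e)\<^sup>2 - E)}"
        have F: "finite F" "card F \<le> 2" using card_square_eq_le unfolding F_def by auto
        have "{P \<in> S. fst P = s} \<subseteq> Pair s ` F" by (auto simp: S_def F_def)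
        then have "card {P \<in> S. fst P = s} \<le> card F" by (rule surj_card_le[rotated]) (rule F)
        then show "real (card {P \<in> S. fst P = s}) \<le> 2" using F by linarith
      qed
      \<comment> \<open>\<open>r\<close> has degree at most 4, and each \<open>s\<close> admits at
        most two values of \<open>t\<close>.\<close>
      then have "real (card S) \<le> 8" using R4 by simp
      moreover have "8 * 1 \<le> (K + 8) * real b powr \<epsilon>" using K0 bpow by (intro mult_mono) auto
      ultimately show ?thesis by simp
    qed
  qed
qed

section \<open>Completing the square\<close>

text \<open>Affine and quadratic maps are handled as functions on rational vectors, so that a change
  of coordinates is a composition; \<open>mpoly\<close> returns only when irreducibility is used.
  The set \<open>J\<close> records which coordinates may occur and shrinks by one with each
  completed square.\<close>

definition aff :: "nat set \<Rightarrow> ((nat \<Rightarrow> rat) \<Rightarrow> rat) \<Rightarrow> bool" where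
  "aff J L \<longleftrightarrow> (\<exists>c0 c. \<forall>x. L x = c0 + (\<Sum>i\<in>J. c i * x i))"

definition quad :: "nat set \<Rightarrow> ((nat \<Rightarrow> rat) \<Rightarrow> rat) \<Rightarrow> bool" where
  "quad J F \<longleftrightarrow> (\<exists>A b c0. \<forall>x. F x = (\<Sum>i\<in>J. \<Sum>j\<in>J. A i j * x i * x j) + (\<Sum>i\<in>J. b i * x i) + c0)"

lemma affI: "(\<And>x. L x = r + (\<Sum>i\<in>J. c i * x i)) \<Longrightarrow> aff J L"
  unfolding aff_def by (intro exI allI)

lemma affE:
  assumes "aff J L"
  obtains r c where "\<And>x. L x = r + (\<Sum>i\<in>J. c i * x i)"
proof -
  from assms obtain r c where "\<forall>x. L x = r + (\<Sum>i\<in>J. c i * x i)"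
    unfolding aff_def by (elim exE) (rule that)
  then show ?thesis by (intro that) (erule spec)
qed

lemma quadI:
  "(\<And>x. F x = (\<Sum>i\<in>J. \<Sum>j\<in>J. A i j * x i * x j) + (\<Sum>i\<in>J. b i * x i) + c) \<Longrightarrow> quad J F"
  unfolding quad_def by (intro exI allI)

lemma quadE:
  assumes "quad J F"
  obtains A b c where "\<And>x. F x = (\<Sum>i\<in>J. \<Sum>j\<in>J. A i j * x i * x j) + (\<Sum>i\<in>J. b i * x i) + c"
proof -
  from assms obtain A b c where "\<forall>x. F x = (\<Sum>i\<in>J. \<Sum>j\<in>J. A i j * x i * x j) + (\<Sum>i\<in>J. b i * x i) + c"
    unfolding quad_def by (elim exE) (rule that)
  then show ?thesis by (intro that) (erule spec)
qed

lemma aff_coord: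
  assumes "finite J" "i \<in> J"
  shows "aff J (\<lambda>x. x i)"
  using assms by (intro affI[where r = 0 and c = "\<lambda>k. if k = i then 1 else 0"]) (simp add: if_distrib[of "\<lambda>c. c * _"] cong: if_cong)

lemma aff_add:
  assumes "aff J L" "aff J M"
  shows "aff J (\<lambda>x. L x + M x)"
proof -
  obtain c0 c where "\<And>x. L x = c0 + (\<Sum>i\<in>J. c i * x i)"
    by (rule affE[OF assms(1)]) (rule that)
  moreover obtain d0 d where "\<And>x. M x = d0 + (\<Sum>i\<in>J. d i * x i)"
    by (rule affE[OF assms(2)]) (rule that)
  ultimately show ?thesis
    by (intro affI[where r = "c0 + d0" and c = "\<lambda>i. c i + d i"]) (simp add: sum.distrib algebra_simps)
qed

lemma aff_cmult:
  assumes "aff J L"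
  shows "aff J (\<lambda>x. r * L x)"
proof -
  obtain c0 c where "\<And>x. L x = c0 + (\<Sum>i\<in>J. c i * x i)"
    by (rule affE[OF assms(1)]) (rule that)
  then show ?thesis
    by (intro affI[where r = "r * c0" and c = "\<lambda>i. r * c i"]) (simp add: sum_distrib_left algebra_simps)
qed

lemma quad_add:
  assumes "quad J F" "quad J G"
  shows "quad J (\<lambda>x. F x + G x)"
proof -
  obtain A b c where
    "\<And>x. F x = (\<Sum>i\<in>J. \<Sum>j\<in>J. A i j * x i * x j) + (\<Sum>i\<in>J. b i * x i) + c"
    by (rule quadE[OF assms(1)]) (rule that)
  moreover obtain A' b' c' where
    "\<And>x. G x = (\<Sum>i\<in>J. \<Sum>j\<in>J. A' i j * x i * x j) + (\<Sum>i\<in>J. b' i * x i) + c'"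
    by (rule quadE[OF assms(2)]) (rule that)
  ultimately show ?thesis 
    by (intro quadI[where A = "\<lambda>i j. A i j + A' i j" and b = "\<lambda>i. b i + b' i" and c = "c + c'"])
      (simp add: sum.distrib algebra_simps)
qed

lemma quad_cmult:
  assumes "quad J F"
  shows "quad J (\<lambda>x. r * F x)"
proof -
  obtain A b c where
    "\<And>x. F x = (\<Sum>i\<in>J. \<Sum>j\<in>J. A i j * x i * x j) + (\<Sum>i\<in>J. b i * x i) + c"
    by (rule quadE[OF assms(1)]) (rule that)
  then show ?thesis 
    by (intro quadI[where A = "\<lambda>i j. r * A i j" and b = "\<lambda>i. r * b i" and c = "r * c"])
      (simp add: sum_distrib_left algebra_simps)
qed

lemma quad_aff_mult:
  assumes "aff J L" "aff J M"
  shows "quad J (\<lambda>x. L x * M x)"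
proof -
  obtain c0 c where L: "\<And>x. L x = c0 + (\<Sum>i\<in>J. c i * x i)"
    by (rule affE[OF assms(1)]) (rule that)
  obtain d0 d where M: "\<And>x. M x = d0 + (\<Sum>i\<in>J. d i * x i)"
    by (rule affE[OF assms(2)]) (rule that)
  have "(\<Sum>i\<in>J. \<Sum>j\<in>J. (c i * d j) * x i * x j) = (\<Sum>i\<in>J. c i * x i) * (\<Sum>i\<in>J. d i * x i)" for x
    unfolding sum_product by (simp add: algebra_simps)
  moreover have "(\<Sum>i\<in>J. (c0 * d i + d0 * c i) * x i) = c0 * (\<Sum>i\<in>J. d i * x i) + d0 * (\<Sum>i\<in>J. c i * x i)" for x
    by (simp add: sum_distrib_left sum.distrib algebra_simps)
  ultimately show ?thesis unfolding L M
    by (intro quadI[where A = "\<lambda>i j. c i * d j" and b = "\<lambda>i. c0 * d i + d0 * c i" and c = "c0 * d0"])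
      (simp add: algebra_simps)
qed

text \<open>For v i = 1 this is the projection along \<open>v\<close> onto the hyperplane where
  coordinate \<open>i\<close> is 0. The ring is left open because it acts on lattice points, to
  index slices, and on rational points, where the functions live.\<close>

definition proj :: "nat \<Rightarrow> (nat \<Rightarrow> int) \<Rightarrow> (nat \<Rightarrow> 'a::comm_ring_1) \<Rightarrow> nat \<Rightarrow> 'a" where
  "proj i v x = (\<lambda>k. x k - x i * of_int (v k))"

lemma proj_of_int: "(\<lambda>k. of_int (proj i v a k)) = proj i v (\<lambda>k. of_int (a k))"
  by (simp add: proj_def)

lemma aff_proj:
  assumes "aff (J - {i}) L" "finite J" "i \<in> J"
  shows "aff J (\<lambda>x. L (proj i v x))"
proof -
  obtain c0 c where L: "\<And>x. L x = c0 + (\<Sum>k\<in>J-{i}. c k * x k)"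
    by (rule affE[OF assms(1)]) (rule that)
  define c' where "c' k = (if k = i then - (\<Sum>k\<in>J-{i}. c k * of_int (v k)) else c k)" for k
  have "(\<Sum>k\<in>J. c' k * x k) = c' i * x i + (\<Sum>k\<in>J-{i}. c' k * x k)" for x
    using assms by (simp add: sum.remove)
  moreover have "(\<Sum>k\<in>J-{i}. c' k * x k) = (\<Sum>k\<in>J-{i}. c k * x k)" for x
    by (rule sum.cong) (auto simp: c'_def)
  ultimately show ?thesis
    by (intro affI[where r = c0 and c = c'])
      (simp add: L proj_def c'_def sum_subtractf sum_distrib_left sum_distrib_right algebra_simps)
qed

text \<open>A vector is its projection plus y j times \<open>w\<close>, so \<open>h\<close> is the
  linear part of \<open>L\<close> at \<open>w\<close>. It becomes the slope in the slices and is the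
  same for all of them.\<close>

lemma aff_along_proj:
  assumes "aff J L"
  obtains h where "\<And>y. L y = L (proj j w y) + h * y j"
proof -
  obtain c0 c where L: "\<And>x. L x = c0 + (\<Sum>k\<in>J. c k * x k)"
    by (rule affE[OF assms(1)]) (rule that)
  have "L y = L (proj j w y) + (\<Sum>k\<in>J. c k * of_int (w k)) * y j" for y
    by (simp add: L proj_def sum_subtractf sum_distrib_left sum_distrib_right algebra_simps)
  then show ?thesis by (rule that)
qed

text \<open>A basis vector works if some diagonal entry is nonzero, and a sum of two basis vectors
  if the diagonal vanishes but some A i j + A j i does not; otherwise the matrix is antisymmetric
  and the form is 0. With v i = 1, the vector \<open>v\<close> completes the other basis vectors to
  a unimodular basis.\<close>

lemma exists_nonisotropic:
  fixes A :: "nat \<Rightarrow> nat \<Rightarrow> rat"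
  assumes "finite J"
  shows "(\<forall>x. (\<Sum>k\<in>J. \<Sum>l\<in>J. A k l * x k * x l) = 0) \<or>
    (\<exists>i\<in>J. \<exists>v::nat \<Rightarrow> int. v i = 1 \<and> (\<forall>k. v k = 0 \<or> v k = 1) \<and> (\<forall>k. k \<notin> J \<longrightarrow> v k = 0) \<and>
      (\<Sum>k\<in>J. \<Sum>l\<in>J. A k l * of_int (v k) * of_int (v l)) \<noteq> 0)"
proof -
  define P where "P i v \<longleftrightarrow> v i = 1 \<and> (\<forall>k. v k = 0 \<or> v k = 1) \<and> (\<forall>k. k \<notin> J \<longrightarrow> v k = 0) \<and>
      (\<Sum>k\<in>J. \<Sum>l\<in>J. A k l * of_int (v k) * of_int (v l)) \<noteq> 0" for i and v :: "nat \<Rightarrow> int"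
  have ind: "(\<Sum>k\<in>J. \<Sum>l\<in>J. A k l * of_int (if k \<in> V then 1 else 0) * of_int (if l \<in> V then 1 else 0))
      = (\<Sum>k\<in>V. \<Sum>l\<in>V. A k l)" if "V \<subseteq> J" for V
  proof -
    have "(\<Sum>l\<in>V. A k l) = (\<Sum>l\<in>J. A k l * of_int (if l \<in> V then 1 else 0))" for k
      using that assms by (intro sum.mono_neutral_cong_left) auto
    then have "(\<Sum>k\<in>V. \<Sum>l\<in>V. A k l) = (\<Sum>k\<in>V. \<Sum>l\<in>J. A k l * of_int (if l \<in> V then 1 else 0))" by simp
    also have "\<dots> = (\<Sum>k\<in>J. \<Sum>l\<in>J. A k l * of_int (if k \<in> V then 1 else 0) * of_int (if l \<in> V then 1 else 0))"
      using that assms by (intro sum.mono_neutral_cong_left) auto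
    finally show ?thesis by simp
  qed
  have PI: "P i (\<lambda>k. if k \<in> V then 1 else 0)" if "V \<subseteq> J" "i \<in> V" "(\<Sum>k\<in>V. \<Sum>l\<in>V. A k l) \<noteq> 0" for i V
    unfolding P_def using that ind[OF that(1)] by auto
  consider (diag) i where "i \<in> J" "A i i \<noteq> 0"
    | (off) i j where "i \<in> J" "j \<in> J" "i \<noteq> j" "A i i = 0" "A j j = 0" "A i j + A j i \<noteq> 0"
    | (none) "\<forall>i\<in>J. \<forall>j\<in>J. A i j + A j i = 0"
  proof -
    have "A i j + A j i = 0" if "\<forall>i\<in>J. A i i = 0" "\<forall>i\<in>J. \<forall>j\<in>J. i \<noteq> j \<longrightarrow> A i j + A j i = 0" "i \<in> J" "j \<in> J" for i j
      using that by (cases "i = j") auto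
    then show thesis using that by metis
  qed
  then show ?thesis
  proof cases
    case diag
    then have "P i (\<lambda>k. if k \<in> {i} then 1 else 0)" by (intro PI) auto
    with diag(1) have "\<exists>i\<in>J. \<exists>v. P i v" by (intro bexI exI)
    then show ?thesis unfolding P_def by (rule disjI2)
  next
    case off
    then have "P i (\<lambda>k. if k \<in> {i, j} then 1 else 0)" by (intro PI) (auto simp: add.commute)
    with off(1) have "\<exists>i\<in>J. \<exists>v. P i v" by (intro bexI exI)
    then show ?thesis unfolding P_def by (rule disjI2)
  next
    case none
    have "(\<Sum>k\<in>J. \<Sum>l\<in>J. A k l * x k * x l) = 0" for x
    proof -
      have "(\<Sum>k\<in>J. \<Sum>l\<in>J. A k l * x k * x l) = (\<Sum>k\<in>J. \<Sum>l\<in>J. A l k * x k * x l)"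
        by (subst sum.swap) (simp add: mult_ac)
      then have "2 * (\<Sum>k\<in>J. \<Sum>l\<in>J. A k l * x k * x l) = (\<Sum>k\<in>J. \<Sum>l\<in>J. (A k l + A l k) * x k * x l)"
        by (simp add: sum.distrib algebra_simps)
      also have "\<dots> = 0" using none by simp
      finally show ?thesis by simp
    qed
    then show ?thesis by (intro disjI1 allI)
  qed
qed

text \<open>Put x = y + t v with t = x i and \<open>y\<close> the projection. Then F(x) = \<alpha>
  t^2 + 2 \<alpha> \<beta>(y) t + F(y), where \<open>\<alpha>\<close> is the quadratic part at
  \<open>v\<close>, nonzero by the choice of \<open>v\<close>. Completing the square in
  \<open>t\<close> leaves \<Delta> = \<beta>^2 - F/\<alpha> at \<open>y\<close>.\<close>

lemma complete_square:
  assumes "finite J" "quad J F" "\<not> aff J F"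
  obtains i v \<alpha> \<beta> \<Delta> where "i \<in> J" "v i = 1" "\<And>k. v k = 0 \<or> v k = 1" "\<And>k. k \<notin> J \<Longrightarrow> v k = 0"
    "\<alpha> \<noteq> 0" "aff (J - {i}) \<beta>" "quad (J - {i}) \<Delta>"
    "\<And>x. F x = \<alpha> * ((x i + \<beta> (proj i v x))\<^sup>2 - \<Delta> (proj i v x))"
proof -
  obtain A b c where F: "\<And>x. F x = (\<Sum>k\<in>J. \<Sum>l\<in>J. A k l * x k * x l) + (\<Sum>k\<in>J. b k * x k) + c"
    by (rule quadE[OF assms(2)]) (rule that)
  have "\<not> (\<forall>x. (\<Sum>k\<in>J. \<Sum>l\<in>J. A k l * x k * x l) = 0)"
  proof
    assume "\<forall>x. (\<Sum>k\<in>J. \<Sum>l\<in>J. A k l * x k * x l) = 0"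
    then have "aff J F" by (intro affI[where r = c and c = b]) (simp add: F)
    then show False using assms by simp
  qed
  then obtain i and v :: "nat \<Rightarrow> int" where iv: "i \<in> J" "v i = 1" "\<And>k. v k = 0 \<or> v k = 1" "\<And>k. k \<notin> J \<Longrightarrow> v k = 0"
      "(\<Sum>k\<in>J. \<Sum>l\<in>J. A k l * of_int (v k) * of_int (v l)) \<noteq> 0"
    using exists_nonisotropic[OF assms(1), of A] by blast
  define \<alpha> where "\<alpha> = (\<Sum>k\<in>J. \<Sum>l\<in>J. A k l * of_int (v k) * of_int (v l))"
  have a0: "\<alpha> \<noteq> 0" using iv(5) by (simp add: \<alpha>_def)
  define J' where "J' = J - {i}"
  \<comment> \<open>The polar form of the quadratic part against \<open>v\<close>; together with the
    linear part at \<open>v\<close> it is the coefficient of \<open>t\<close> in F(y + t v).\<close>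
  define g where "g l = (\<Sum>k\<in>J. (A l k + A k l) * of_int (v k))" for l
  define \<beta> where "\<beta> y = (\<Sum>k\<in>J. b k * of_int (v k)) / (2 * \<alpha>) + (\<Sum>l\<in>J'. g l / (2 * \<alpha>) * y l)" for y
  \<comment> \<open>\<open>F\<close> at points whose coordinate \<open>i\<close> is 0, written
    without that coordinate, so that \<open>\<Delta>\<close> is visibly quadratic in the remaining
    ones.\<close>
  define F0 where "F0 y = (\<Sum>k\<in>J'. \<Sum>l\<in>J'. A k l * y k * y l) + (\<Sum>k\<in>J'. b k * y k) + c" for y
  define \<Delta> where "\<Delta> y = (\<beta> y)\<^sup>2 + (- 1 / \<alpha>) * F0 y" for y
  have affb: "aff J' \<beta>" by (rule affI[OF \<beta>_def])
  moreover have "quad J' F0" by (rule quadI[OF F0_def])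
  ultimately have "quad J' \<Delta>" unfolding \<Delta>_def power2_eq_square by (intro quad_add quad_cmult quad_aff_mult)
  moreover have "F x = \<alpha> * ((x i + \<beta> (proj i v x))\<^sup>2 - \<Delta> (proj i v x))" for x
  proof -
    define y where "y = proj i v x"
    define t where "t = x i"
    define u where "u k = (of_int (v k) :: rat)" for k
    have xk: "x k = y k + t * u k" for k by (simp add: y_def t_def proj_def u_def)
    have yi: "y i = 0" using iv(2) by (simp add: y_def proj_def)
    have red: "(\<Sum>k\<in>J. f k * y k) = (\<Sum>k\<in>J'. f k * y k)" for f :: "nat \<Rightarrow> rat"
      unfolding J'_def using assms(1) iv(1) yi by (simp add: sum.remove[of J i])
    have F0y: "F0 y = F y"
    proof -
      have "(\<Sum>k\<in>J. \<Sum>l\<in>J. A k l * y k * y l) = (\<Sum>k\<in>J. (\<Sum>l\<in>J'. A k l * y l) * y k)"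
        unfolding red[symmetric] by (simp add: sum_distrib_left sum_distrib_right algebra_simps)
      also have "\<dots> = (\<Sum>k\<in>J'. \<Sum>l\<in>J'. A k l * y k * y l)"
        unfolding red by (simp add: sum_distrib_left sum_distrib_right algebra_simps)
      finally show ?thesis unfolding F F0_def red by simp
    qed
    have \<beta>y: "2 * \<alpha> * \<beta> y = (\<Sum>k\<in>J. b k * u k) + (\<Sum>l\<in>J. g l * y l)"
      using a0 unfolding red \<beta>_def u_def by (simp add: sum_distrib_left field_simps)
    have gsum: "(\<Sum>l\<in>J. g l * y l) = (\<Sum>k\<in>J. \<Sum>l\<in>J. A k l * y k * u l) + (\<Sum>k\<in>J. \<Sum>l\<in>J. A k l * u k * y l)"
    proof -
      have "(\<Sum>l\<in>J. g l * y l) = (\<Sum>l\<in>J. \<Sum>k\<in>J. A l k * y l * u k) + (\<Sum>l\<in>J. \<Sum>k\<in>J. A k l * u k * y l)"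
        unfolding g_def u_def by (simp add: sum_distrib_left sum_distrib_right sum.distrib algebra_simps)
      also have "(\<Sum>l\<in>J. \<Sum>k\<in>J. A k l * u k * y l) = (\<Sum>k\<in>J. \<Sum>l\<in>J. A k l * u k * y l)"
        by (rule sum.swap)
      finally show ?thesis .
    qed
    have "F x = (\<Sum>k\<in>J. \<Sum>l\<in>J. A k l * (y k + t * u k) * (y l + t * u l)) + (\<Sum>k\<in>J. b k * (y k + t * u k)) + c"
      unfolding F xk ..
    also have "(\<Sum>k\<in>J. \<Sum>l\<in>J. A k l * (y k + t * u k) * (y l + t * u l)) =
        (\<Sum>k\<in>J. \<Sum>l\<in>J. A k l * y k * y l) + t * (\<Sum>l\<in>J. g l * y l) + t\<^sup>2 * \<alpha>"
      unfolding gsum \<alpha>_def u_def[symmetric]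
      by (simp add: sum.distrib sum_distrib_left power2_eq_square algebra_simps)
    also have "(\<Sum>k\<in>J. b k * (y k + t * u k)) = (\<Sum>k\<in>J. b k * y k) + t * (\<Sum>k\<in>J. b k * u k)"
      by (simp add: sum.distrib sum_distrib_left algebra_simps)
    finally have "F x = F y + t * (2 * \<alpha> * \<beta> y) + t\<^sup>2 * \<alpha>"
      unfolding \<beta>y F by (simp add: algebra_simps)
    then show ?thesis unfolding y_def[symmetric] \<Delta>_def F0y t_def using a0
      by (simp add: power2_eq_square field_simps)
  qed
  ultimately show ?thesis using iv(1-4) a0 affb unfolding J'_def by (intro that) auto
qed

section \<open>Slicing a quadric by conics\<close>

definition box :: "nat set \<Rightarrow> nat \<Rightarrow> (nat \<Rightarrow> int) set" where
  "box J b = {a. (\<forall>k. k \<notin> J \<longrightarrow> a k = 0) \<and> (\<forall>k\<in>J. \<bar>a k\<bar> \<le> int b)}"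

lemma card_int_interval: "card {- int b..int b} = 2 * b + 1"
  by simp

lemma card_box:
  assumes "finite J"
  shows "finite (box J b) \<and> card (box J b) = (2 * b + 1) ^ card J"
  using assms
proof (induction J rule: finite_induct)
  case empty
  have "box {} b = {\<lambda>_. 0}" by (auto simp: box_def)
  then show ?case by simp
next
  case (insert i J)
  define g where "g = (\<lambda>(a, t). a(i := t) :: nat \<Rightarrow> int)"
  have "box (insert i J) b = g ` (box J b \<times> {- int b..int b})"
  proof (intro equalityI subsetI)
    fix a assume "a \<in> box (insert i J) b"
    then have "(a(i := 0), a i) \<in> box J b \<times> {- int b..int b}" by (auto simp: box_def)
    moreover have "a = g (a(i := 0), a i)" by (simp add: g_def)
    ultimately show "a \<in> g ` (box J b \<times> {- int b..int b})" by (rule image_eqI[rotated])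
  next
    fix a assume "a \<in> g ` (box J b \<times> {- int b..int b})"
    then show "a \<in> box (insert i J) b" by (auto simp: box_def g_def)
  qed
  moreover have "inj_on g (box J b \<times> {- int b..int b})"
  proof (rule inj_onI)
    fix P Q assume P: "P \<in> box J b \<times> {- int b..int b}" and Q: "Q \<in> box J b \<times> {- int b..int b}" and eq: "g P = g Q"
    obtain a t a' t' where PQ: "P = (a, t)" "Q = (a', t')" by (cases P, cases Q) auto
    have "a i = 0" "a' i = 0" using P Q PQ insert.hyps by (auto simp: box_def)
    moreover have "(a(i := t)) k = (a'(i := t')) k" for k using eq PQ by (simp add: g_def)
    ultimately have "a k = a' k" for k by (cases "k = i") (auto split: if_splits, metis fun_upd_other)
    moreover have "t = t'" using eq PQ by (metis case_prod_conv fun_upd_same g_def)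
    ultimately show "P = Q" using PQ by auto
  qed
  ultimately have "card (box (insert i J) b) = card (box J b) * (2 * b + 1)"
    "finite (box (insert i J) b)"
    using insert.IH by (simp_all only: card_image card_cartesian_product card_int_interval) simp
  then show ?case using insert by (simp add: mult.commute)
qed

text \<open>Along a coordinate line \<open>F\<close> is a polynomial of degree at most 2. This
  dichotomy, with the dependence on \<open>J\<close> alone, is all that the zero count in a box asks
  of \<open>F\<close>, and it passes to restrictions of \<open>F\<close>.\<close>

lemma quad_slice:
  assumes "quad J F" "finite J"
  shows "(\<forall>t. F (x(i := t)) = 0) \<or> (finite {t. F (x(i := t)) = 0} \<and> card {t. F (x(i := t)) = 0} \<le> 2)"
proof -
  obtain A b c where F: "\<And>x. F x = (\<Sum>k\<in>J. \<Sum>l\<in>J. A k l * x k * x l) + (\<Sum>k\<in>J. b k * x k) + c"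
    by (rule quadE[OF assms(1)]) (rule that)
  define u where "u k = (if k = i then [:0, 1:] else [:x k:])" for k
  have u: "(x(i := t)) k = poly (u k) t" for k t by (simp add: u_def)
  have du: "degree (u k) \<le> 1" for k by (simp add: u_def)
  define p where "p = (\<Sum>k\<in>J. \<Sum>l\<in>J. smult (A k l) (u k * u l)) + (\<Sum>k\<in>J. smult (b k) (u k)) + [:c:]"
  have p: "F (x(i := t)) = poly p t" for t
    unfolding F u p_def by (simp add: poly_sum mult.assoc)
  have "degree (smult (A k l) (u k * u l)) \<le> 2" for k l
    using degree_smult_le[of "A k l" "u k * u l"] degree_mult_le[of "u k" "u l"] du[of k] du[of l] by linarith
  moreover have "degree (smult (b k) (u k)) \<le> 2" for k
    using degree_smult_le[of "b k" "u k"] du[of k] by linarith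
  ultimately have "degree p \<le> 2"
    unfolding p_def by (intro degree_add_le degree_sum_le assms(2)) auto
  then show ?thesis
    using card_poly_roots_bound[of p] poly_roots_finite[of p] unfolding p
    by (cases "p = 0") auto
qed

lemma quad_depends:
  assumes "quad J F" "\<And>k. k \<in> J \<Longrightarrow> x k = y k"
  shows "F x = F y"
proof -
  obtain A b c where F: "\<And>x. F x = (\<Sum>k\<in>J. \<Sum>l\<in>J. A k l * x k * x l) + (\<Sum>k\<in>J. b k * x k) + c"
    by (rule quadE[OF assms(1)]) (rule that)
  have "(\<Sum>k\<in>J. \<Sum>l\<in>J. A k l * x k * x l) = (\<Sum>k\<in>J. \<Sum>l\<in>J. A k l * y k * y l)"
    "(\<Sum>k\<in>J. b k * x k) = (\<Sum>k\<in>J. b k * y k)"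
    using assms(2) by (intro sum.cong; simp)+
  then show ?thesis unfolding F by simp
qed

lemma card_split_le: "card A \<le> card {a \<in> A. g a \<notin> B} + card {a \<in> A. g a \<in> B}"
proof -
  have "{a \<in> A. g a \<notin> B} \<union> {a \<in> A. g a \<in> B} = A" by auto
  then show ?thesis using card_Un_le[of "{a \<in> A. g a \<notin> B}" "{a \<in> A. g a \<in> B}"] by simp
qed

text \<open>A Schwartz--Zippel bound. Multiplying both sides by \<open>2 b + 1\<close> avoids the exponent \<open>card J - 1\<close>.\<close>

lemma card_zeros_box_le:
  fixes F :: "(nat \<Rightarrow> rat) \<Rightarrow> rat"
  assumes "finite J"
    and "\<And>x i. (\<forall>t. F (x(i := t)) = 0) \<or> (finite {t. F (x(i := t)) = 0} \<and> card {t. F (x(i := t)) = 0} \<le> 2)"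
    and "\<And>x y. (\<And>k. k \<in> J \<Longrightarrow> x k = y k) \<Longrightarrow> F x = F y"
    and "F x0 \<noteq> 0"
  shows "real (card {a \<in> box J b. F (\<lambda>k. of_int (a k)) = 0}) * (2 * real b + 1)
    \<le> 2 * real (card J) * (2 * real b + 1) ^ card J"
  using assms
proof (induction J arbitrary: F x0 rule: finite_induct)
  case empty
  have "F (\<lambda>k. of_int (a k)) = F x0" for a :: "nat \<Rightarrow> int" by (rule empty.prems(2)) simp
  then show ?case using empty.prems(3) by simp
next
  case (insert i J)
  define q where "q = 2 * real b + 1"
  have q: "q > 0" by (simp add: q_def)
  define Z where "Z = {a \<in> box (insert i J) b. F (\<lambda>k. of_int (a k)) = 0}"
  have finZ: "finite Z" unfolding Z_def using card_box[of "insert i J" b] insert.hyps by simp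
  \<comment> \<open>The line through \<open>x0\<close> is not contained in the zero set, so at most
    two values \<open>t\<close> are bad. For the others \<open>x0\<close> remains a witness that the
    slice is nonzero, and the induction hypothesis applies; the bad slices are bounded by the whole
    box.\<close>
  define T where "T = {t \<in> {- int b..int b}. F (x0(i := of_int t)) = 0}"
  have finT: "finite T" unfolding T_def by (rule finite_subset[of _ "{- int b..int b}"]) auto
  have T2: "card T \<le> 2"
  proof -
    have "F (x0(i := x0 i)) \<noteq> 0" using insert.prems(3) by simp
    then have *: "finite {t. F (x0(i := t)) = 0}" "card {t. F (x0(i := t)) = 0} \<le> 2"
      using insert.prems(1)[of x0 i] by blast+
    have "card T \<le> card {t. F (x0(i := t)) = 0}"
      by (rule card_inj_on_le[where f = of_int]) (auto simp: T_def inj_on_def *)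
    then show ?thesis using * by linarith
  qed
  define Ft where "Ft t x = F (x(i := of_int t))" for t :: int and x
  have fibre: "card {a \<in> Z. a i = t} \<le> card {a \<in> box J b. Ft t (\<lambda>k. of_int (a k)) = 0}" for t
  proof (rule card_inj_on_le[where f = "\<lambda>a. a(i := 0)"])
    show "inj_on (\<lambda>a. a(i := 0)) {a \<in> Z. a i = t}"
    proof (rule inj_onI)
      fix a a' assume a: "a \<in> {a \<in> Z. a i = t}" "a' \<in> {a \<in> Z. a i = t}" "a(i := 0) = a'(i := 0)"
      then have "(a(i := 0))(i := t) = (a'(i := 0))(i := t)" by simp
      then show "a = a'" using a by (metis (mono_tags, lifting) fun_upd_triv fun_upd_upd mem_Collect_eq)
    qed
    show "(\<lambda>a. a(i := 0)) ` {a \<in> Z. a i = t} \<subseteq> {a \<in> box J b. Ft t (\<lambda>k. of_int (a k)) = 0}"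
    proof (intro image_subsetI)
      fix a assume a: "a \<in> {a \<in> Z. a i = t}"
      have "(\<lambda>k. of_int ((a(i := 0)) k))(i := of_int t) = (\<lambda>k. of_int (a k) :: rat)" using a by auto
      then show "a(i := 0) \<in> {a \<in> box J b. Ft t (\<lambda>k. of_int (a k)) = 0}"
        using a insert.hyps by (auto simp: Z_def box_def Ft_def)
    qed
    show "finite {a \<in> box J b. Ft t (\<lambda>k. of_int (a k)) = 0}" using card_box[of J b] insert.hyps by simp
  qed
  have good: "real (card {a \<in> Z. a i = t}) \<le> 2 * real (card J) * q ^ card J / q" if "F (x0(i := of_int t)) \<noteq> 0" for t
  proof -
    have "real (card {a \<in> box J b. Ft t (\<lambda>k. of_int (a k)) = 0}) * (2 * real b + 1)
      \<le> 2 * real (card J) * (2 * real b + 1) ^ card J"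
    proof (rule insert.IH)
      fix x k
      show "(\<forall>s. Ft t (x(k := s)) = 0) \<or> (finite {s. Ft t (x(k := s)) = 0} \<and> card {s. Ft t (x(k := s)) = 0} \<le> 2)"
      proof (cases "k = i")
        case True
        then show ?thesis by (cases "F (x(i := of_int t)) = 0") (auto simp: Ft_def)
      next
        case False
        then have twist: "x(k := s, i := of_int t) = x(i := of_int t, k := s)" for s by (rule fun_upd_twist)
        show ?thesis unfolding Ft_def twist by (rule insert.prems(1))
      qed
    next
      fix x y :: "nat \<Rightarrow> rat" assume "\<And>k. k \<in> J \<Longrightarrow> x k = y k"
      then show "Ft t x = Ft t y" unfolding Ft_def by (intro insert.prems(2)) auto
    next
      show "Ft t x0 \<noteq> 0" using that by (simp add: Ft_def)
    qed
    then have "real (card {a \<in> box J b. Ft t (\<lambda>k. of_int (a k)) = 0}) \<le> 2 * real (card J) * q ^ card J / q"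
      unfolding q_def[symmetric] using q by (simp add: pos_le_divide_eq)
    then show ?thesis using fibre[of t] by linarith
  qed
  have bad: "real (card {a \<in> Z. a i = t}) \<le> q ^ card J" for t
  proof -
    have "card {a \<in> box J b. Ft t (\<lambda>k. of_int (a k)) = 0} \<le> card (box J b)"
      using card_box[of J b] insert.hyps by (intro card_mono) auto
    then have "card {a \<in> Z. a i = t} \<le> (2 * b + 1) ^ card J" using fibre[of t] card_box[of J b] insert.hyps by simp
    then have "real (card {a \<in> Z. a i = t}) \<le> real ((2 * b + 1) ^ card J)" by (rule of_nat_mono)
    moreover have "real (2 * b + 1) = q" by (simp add: q_def)
    ultimately show ?thesis by (simp only: of_nat_power)
  qed
  have Z1: "real (card {a \<in> Z. a i \<notin> T}) \<le> real (card {- int b..int b}) * (2 * real (card J) * q ^ card J / q)"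
  proof (rule card_fibres_le[where \<phi> = "\<lambda>a. a i"])
    show "a i \<in> {- int b..int b}" if "a \<in> {a \<in> Z. a i \<notin> T}" for a using that by (auto simp: Z_def box_def)
    show "real (card {a \<in> {a \<in> Z. a i \<notin> T}. a i = t}) \<le> 2 * real (card J) * q ^ card J / q"
      if "t \<in> {- int b..int b}" for t
    proof (cases "t \<in> T")
      case True
      then have "{a \<in> {a \<in> Z. a i \<notin> T}. a i = t} = {}" by auto
      then show ?thesis using q by (simp only: card.empty) simp
    next
      case False
      then have "{a \<in> {a \<in> Z. a i \<notin> T}. a i = t} = {a \<in> Z. a i = t}" by auto
      then show ?thesis using good[of t] False that by (simp add: T_def)
    qed
  qed (use finZ in auto)
  have "real (card {- int b..int b}) = q" unfolding card_int_interval q_def by simp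
  with Z1 have Z1: "real (card {a \<in> Z. a i \<notin> T}) \<le> 2 * real (card J) * q ^ card J" using q by simp
  have Z2: "real (card {a \<in> Z. a i \<in> T}) \<le> real (card T) * q ^ card J"
  proof (rule card_fibres_le[where \<phi> = "\<lambda>a. a i"])
    show "real (card {a \<in> {a \<in> Z. a i \<in> T}. a i = t}) \<le> q ^ card J" if "t \<in> T" for t
    proof -
      have "{a \<in> {a \<in> Z. a i \<in> T}. a i = t} = {a \<in> Z. a i = t}" using that by auto
      then show ?thesis using bad[of t] by simp
    qed
  qed (use finZ finT in auto)
  have "real (card T) * q ^ card J \<le> 2 * q ^ card J" using T2 q by (intro mult_right_mono) auto
  with Z2 have Z2: "real (card {a \<in> Z. a i \<in> T}) \<le> 2 * q ^ card J" by linarith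
  have "card Z \<le> card {a \<in> Z. a i \<notin> T} + card {a \<in> Z. a i \<in> T}" by (rule card_split_le)
  then have "real (card Z) \<le> 2 * (real (card J) + 1) * q ^ card J" using Z1 Z2 by (simp add: algebra_simps)
  then have "real (card Z) * q \<le> 2 * (real (card J) + 1) * q ^ card J * q" using q by (intro mult_right_mono) auto
  then show ?case unfolding Z_def[symmetric] q_def[symmetric] using insert.hyps by (simp add: algebra_simps)
qed

lemma proj_box:
  assumes "a \<in> box J b" "i \<in> J" "v i = 1" "\<And>k. v k = 0 \<or> v k = 1" "\<And>k. k \<notin> J \<Longrightarrow> v k = 0"
  shows "proj i v a \<in> box (J - {i}) (2 * b)"
proof -
  have "proj i v a k = 0" if "k \<notin> J - {i}" for k
    using assms that by (cases "k = i") (auto simp: proj_def box_def)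
  moreover have "\<bar>proj i v a k\<bar> \<le> int (2 * b)" if "k \<in> J" for k
  proof -
    have "\<bar>a k\<bar> \<le> int b" "\<bar>a i\<bar> \<le> int b" using assms that by (auto simp: box_def)
    then show ?thesis using assms(4)[of k] by (auto simp: proj_def)
  qed
  ultimately show ?thesis by (auto simp: box_def)
qed

lemma proj_inj: "proj i v x = proj i v y \<Longrightarrow> x i = y i \<Longrightarrow> x = y"
  by (auto simp: proj_def fun_eq_iff)

text \<open>Each \<open>s\<close> admits at most two \<open>t\<close>. This serves the slices with E
  = 0, which can contain lines, so that a bound linear in \<open>b\<close> is the right order
  there.\<close>

lemma slice_card_le:
  fixes h l d e E :: rat
  shows "real (card {(s::int, t::int). \<bar>s\<bar> \<le> int b \<and> \<bar>t\<bar> \<le> int b \<and>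
        (of_int t + (h * of_int s + l))\<^sup>2 = d * ((of_int s + e)\<^sup>2 - E)}) \<le> 2 * (2 * real b + 1)"
proof -
  define T where "T = {(s::int, t::int). \<bar>s\<bar> \<le> int b \<and> \<bar>t\<bar> \<le> int b \<and>
        (of_int t + (h * of_int s + l))\<^sup>2 = d * ((of_int s + e)\<^sup>2 - E)}"
  have "T \<subseteq> {- int b..int b} \<times> {- int b..int b}" by (auto simp: T_def)
  then have finT: "finite T" using finite_subset by blast
  have "real (card T) \<le> real (card {- int b..int b}) * 2"
  proof (rule card_fibres_le[where \<phi> = fst, OF finT])
    show "fst P \<in> {- int b..int b}" if "P \<in> T" for P using that by (auto simp: T_def)
    fix s
    define F where "F = {t::int. (of_int t + (h * of_int s + l))\<^sup>2 = d * ((of_int s + e)\<^sup>2 - E)}"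
    have F: "finite F" "card F \<le> 2" using card_square_eq_le unfolding F_def by auto
    have "{P \<in> T. fst P = s} \<subseteq> Pair s ` F" by (auto simp: T_def F_def)
    then have "card {P \<in> T. fst P = s} \<le> card F" by (rule surj_card_le[rotated]) (rule F)
    then show "real (card {P \<in> T. fst P = s}) \<le> 2" using F by linarith
  qed simp
  then show ?thesis unfolding T_def[symmetric] card_int_interval by simp
qed

text \<open>The two exclusions are stated for functions: \<open>F\<close> is not a product of affine
  functions with zeros, and not a constant times a square minus an affine function. The second makes
  both completions of the square possible; the first is called upon only when \<open>E\<close>
  vanishes identically.\<close>

lemma quadric_bound:
  fixes \<epsilon> :: real and n :: nat
  assumes "\<epsilon> > 0" "n \<ge> 2"
  obtains C where "C \<ge> 0"
    "\<And>J F b. finite J \<Longrightarrow> card J = n \<Longrightarrow> quad J F \<Longrightarrow> b \<ge> 1 \<Longrightarrow>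
      (\<And>L M. aff J L \<Longrightarrow> aff J M \<Longrightarrow> \<exists>x. L x = 0 \<Longrightarrow> \<exists>x. M x = 0 \<Longrightarrow> \<not> (\<forall>x. F x = L x * M x)) \<Longrightarrow>
      (\<And>\<kappa> L M. aff J L \<Longrightarrow> aff J M \<Longrightarrow> \<not> (\<forall>x. F x = \<kappa> * ((L x)\<^sup>2 - M x))) \<Longrightarrow>
      real (card {a \<in> box J b. F (\<lambda>k. of_int (a k)) = 0}) \<le> C * real b ^ (n - 2) * real b powr \<epsilon>"
proof -
  obtain C where C: "C \<ge> 0"
    "\<And>(h::rat) l d e E (b::nat). d \<noteq> 0 \<Longrightarrow> E \<noteq> 0 \<Longrightarrow> b \<ge> 1 \<Longrightarrow>
      real (card {(s::int, t::int). \<bar>s\<bar> \<le> int b \<and> \<bar>t\<bar> \<le> int b \<and>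
        (of_int t + (h * of_int s + l))\<^sup>2 = d * ((of_int s + e)\<^sup>2 - E)}) \<le> C * real b powr \<epsilon>"
    using conic_bound[OF assms(1)] by blast
  define m where "m = n - 2"
  \<comment> \<open>The side of the box of slices satisfies 8 b + 1 \<le> 9 b, whence 9^m. The three
    summands stand for the slices with E \<noteq> 0, whose coordinates reach 2 b, for the zeros of
    \<open>E\<close>, and for the case where \<open>E\<close> is identically 0.\<close>
  define K where "K = 9 ^ m * (C * 2 powr \<epsilon> + 4 * real m + 1)"
  have K0: "C * 2 powr \<epsilon> + 4 * real m + 1 \<ge> 0" using C by simp
  show ?thesis
  proof
    show "K \<ge> 0" unfolding K_def using K0 by simp
    fix J :: "nat set" and F :: "(nat \<Rightarrow> rat) \<Rightarrow> rat" and b :: nat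
    assume J: "finite J" "card J = n" and qF: "quad J F" and b: "b \<ge> 1"
      and I: "\<And>L M. aff J L \<Longrightarrow> aff J M \<Longrightarrow> \<exists>x. L x = 0 \<Longrightarrow> \<exists>x. M x = 0 \<Longrightarrow> \<not> (\<forall>x. F x = L x * M x)"
      and II: "\<And>\<kappa> L M. aff J L \<Longrightarrow> aff J M \<Longrightarrow> \<not> (\<forall>x. F x = \<kappa> * ((L x)\<^sup>2 - M x))"
    have nF: "\<not> aff J F"
    proof
      assume "aff J F"
      then have "aff J (\<lambda>x. (- 1) * F x)" by (rule aff_cmult)
      moreover have "aff J (\<lambda>x. 0)" by (rule affI[where r = 0 and c = "\<lambda>_. 0"]) simp
      \<comment> \<open>An affine \<open>F\<close> has the excluded shape with L = 0, M = -F and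
        \<kappa> = 1.\<close>
      ultimately show False using II[of "\<lambda>x. 0" "\<lambda>x. (- 1) * F x" 1] by simp
    qed
    obtain i v \<alpha> \<beta> \<Delta> where iv: "i \<in> J" "v i = 1" "\<And>k. v k = 0 \<or> v k = 1" "\<And>k. k \<notin> J \<Longrightarrow> v k = 0"
      and a0: "\<alpha> \<noteq> 0" and \<beta>: "aff (J - {i}) \<beta>" and \<Delta>: "quad (J - {i}) \<Delta>"
      and F: "\<And>x. F x = \<alpha> * ((x i + \<beta> (proj i v x))\<^sup>2 - \<Delta> (proj i v x))"
      by (rule complete_square[OF J(1) qF nF]) (rule that)
    define J1 where "J1 = J - {i}"
    have J1: "finite J1" "card J1 = n - 1" using J iv(1) by (auto simp: J1_def)
    have affT: "aff J (\<lambda>x. x i + \<beta> (proj i v x))"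
      by (intro aff_add aff_coord aff_proj \<beta> J iv(1))
    have n\<Delta>: "\<not> aff J1 \<Delta>"
    proof
      assume "aff J1 \<Delta>"
      then have "aff J (\<lambda>x. \<Delta> (proj i v x))" unfolding J1_def by (intro aff_proj J iv(1))
      from II[OF affT this, of \<alpha>] show False using F by simp
    qed
    have q\<Delta>: "quad J1 \<Delta>" using \<Delta> by (simp add: J1_def)
    obtain j w d e E where jw: "j \<in> J1" "w j = 1" "\<And>k. w k = 0 \<or> w k = 1" "\<And>k. k \<notin> J1 \<Longrightarrow> w k = 0"
      and d0: "d \<noteq> 0" and e: "aff (J1 - {j}) e" and E: "quad (J1 - {j}) E"
      and \<Delta>: "\<And>x. \<Delta> x = d * ((x j + e (proj j w x))\<^sup>2 - E (proj j w x))"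
      by (rule complete_square[OF J1(1) q\<Delta> n\<Delta>]) (rule that)
    define J2 where "J2 = J1 - {j}"
    have J2: "finite J2" "card J2 = m" using J1 jw(1) assms(2) by (auto simp: J2_def m_def)
    obtain h where h: "\<And>y. \<beta> y = \<beta> (proj j w y) + h * y j"
      using aff_along_proj[OF \<beta>] by blast
    define S where "S = {a \<in> box J b. F (\<lambda>k. of_int (a k)) = 0}"
    have finS: "finite S" using card_box[OF J(1)] by (simp add: S_def)
    define \<phi> where "\<phi> a = proj j w (proj i v a)" for a :: "nat \<Rightarrow> int"
    \<comment> \<open>Each of the two projections at most doubles the coordinates.\<close>
    define Q where "Q = box J2 (4 * b)"
    define r where "r z = (\<lambda>k. of_int (z k) :: rat)" for z :: "nat \<Rightarrow> int"
    \<comment> \<open>The conic over \<open>z\<close>, with \<open>s\<close> the coordinate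
      \<open>j\<close> after one projection and \<open>t\<close> the coordinate \<open>i\<close>.
      The former reaches 2 b, and the same range is allowed to the latter so that
      \<open>conic_bound\<close> applies.\<close>
    define T where "T z = {(s::int, t::int). \<bar>s\<bar> \<le> int (2 * b) \<and> \<bar>t\<bar> \<le> int (2 * b) \<and>
        (of_int t + (h * of_int s + \<beta> (r z)))\<^sup>2 = d * ((of_int s + e (r z))\<^sup>2 - E (r z))}" for z
    have finT: "finite (T z)" for z
    proof -
      have "T z \<subseteq> {- int (2 * b)..int (2 * b)} \<times> {- int (2 * b)..int (2 * b)}" by (auto simp: T_def)
      then show ?thesis using finite_subset by blast
    qed
    have \<phi>Q: "\<phi> a \<in> Q" if "a \<in> S" for a
    proof -
      have "proj i v a \<in> box J1 (2 * b)" unfolding J1_def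
        using that iv by (intro proj_box) (auto simp: S_def)
      then have "proj j w (proj i v a) \<in> box J2 (2 * (2 * b))" unfolding J2_def
        using jw by (intro proj_box) auto
      then show ?thesis by (simp add: \<phi>_def Q_def)
    qed
    have fibre: "card {a \<in> S. \<phi> a = z} \<le> card (T z)" for z
    proof (rule card_inj_on_le[where f = "\<lambda>a. (proj i v a j, a i)"])
      show "inj_on (\<lambda>a. (proj i v a j, a i)) {a \<in> S. \<phi> a = z}"
      proof (rule inj_onI)
        fix a a' assume a: "a \<in> {a \<in> S. \<phi> a = z}" "a' \<in> {a \<in> S. \<phi> a = z}"
          "(proj i v a j, a i) = (proj i v a' j, a' i)"
        then have "proj j w (proj i v a) = proj j w (proj i v a')" "proj i v a j = proj i v a' j" "a i = a' i"
          by (auto simp: \<phi>_def)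
        then show "a = a'" by (blast dest: proj_inj)
      qed
      show "(\<lambda>a. (proj i v a j, a i)) ` {a \<in> S. \<phi> a = z} \<subseteq> T z"
      proof (intro image_subsetI)
        fix a assume a: "a \<in> {a \<in> S. \<phi> a = z}"
        define y where "y = proj i v a"
        have aS: "a \<in> S" and z: "z = proj j w y" using a by (auto simp: \<phi>_def y_def)
        have "y \<in> box J1 (2 * b)" unfolding J1_def y_def
          using aS iv by (intro proj_box) (auto simp: S_def)
        then have yj: "\<bar>y j\<bar> \<le> int (2 * b)" using jw(1) by (auto simp: box_def)
        have ai: "\<bar>a i\<bar> \<le> int (2 * b)" using aS iv(1) by (auto simp: S_def box_def)
        have ry: "proj i v (r a) = r y" unfolding r_def y_def proj_of_int ..
        have rz: "proj j w (r y) = r z" unfolding r_def z proj_of_int ..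
        have "F (r a) = 0" using aS by (simp add: S_def r_def)
        then have "(r a i + \<beta> (r y))\<^sup>2 = \<Delta> (r y)" using a0 unfolding F ry by simp
        then have "(r a i + (h * r y j + \<beta> (r z)))\<^sup>2 = d * ((r y j + e (r z))\<^sup>2 - E (r z))"
          unfolding h[of "r y"] \<Delta> rz by (simp add: add.commute)
        then show "(proj i v a j, a i) \<in> T z"
          using yj ai unfolding y_def[symmetric] T_def by (simp add: r_def)
      qed
    qed (rule finT)
    have finQ: "finite Q" unfolding Q_def using card_box[OF J2(1)] by simp
    define q where "q = 8 * real b + 1"
    have cardQ: "real (card Q) = q ^ m" unfolding Q_def using card_box[OF J2(1)] by (simp add: q_def J2(2) add.commute)
    have q0: "q > 0" by (simp add: q_def)
    have bpow: "1 \<le> real b powr \<epsilon>" using b assms by (simp add: ge_one_powr_ge_zero)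
    have main: "real (card S) \<le> q ^ m * (C * (2 * real b) powr \<epsilon> + 4 * real m + 1)"
    proof (cases "\<exists>x. E x \<noteq> 0")
      case True
      then obtain x0 where x0: "E x0 \<noteq> 0" by blast
      have qE: "quad J2 E" using E by (simp add: J2_def)
      define Z where "Z = {z \<in> Q. E (r z) = 0}"
      have "real (card {a \<in> box J2 (4 * b). E (\<lambda>k. of_int (a k)) = 0}) * (2 * real (4 * b) + 1)
          \<le> 2 * real (card J2) * (2 * real (4 * b) + 1) ^ card J2"
        by (rule card_zeros_box_le[OF J2(1) quad_slice[OF qE J2(1)] quad_depends[OF qE] x0])
      then have Zq: "real (card Z) * q \<le> 2 * real m * q ^ m"
        unfolding Z_def Q_def r_def q_def J2(2) by simp
      have S1: "real (card {a \<in> S. \<phi> a \<notin> Z}) \<le> real (card Q) * (C * real (2 * b) powr \<epsilon>)"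
      proof (rule card_fibres_le[where \<phi> = \<phi>])
        show "real (card {a \<in> {a \<in> S. \<phi> a \<notin> Z}. \<phi> a = z}) \<le> C * real (2 * b) powr \<epsilon>" if "z \<in> Q" for z
        proof (cases "z \<in> Z")
          case True
          then have "{a \<in> {a \<in> S. \<phi> a \<notin> Z}. \<phi> a = z} = {}" by auto
          then show ?thesis using C(1) by (simp only: card.empty) simp
        next
          case False
          then have eq: "{a \<in> {a \<in> S. \<phi> a \<notin> Z}. \<phi> a = z} = {a \<in> S. \<phi> a = z}" by auto
          have "E (r z) \<noteq> 0" using False that by (simp add: Z_def)
          moreover have "2 * b \<ge> 1" using b by simp
          ultimately have "real (card (T z)) \<le> C * real (2 * b) powr \<epsilon>"
            unfolding T_def by (intro C(2) d0)
          then show ?thesis unfolding eq using fibre[of z] by linarith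
        qed
      qed (use finS finQ \<phi>Q in auto)
      \<comment> \<open>The linear bound for a slice meets the Schwartz--Zippel saving:
        \<open>Zq\<close> bounds the number of such slices by 2 m q^m / q, so they hold at most 4 m
        q^m points.\<close>
      have S2: "real (card {a \<in> S. \<phi> a \<in> Z}) \<le> real (card Z) * (2 * q)"
      proof (rule card_fibres_le[where \<phi> = \<phi>])
        show "real (card {a \<in> {a \<in> S. \<phi> a \<in> Z}. \<phi> a = z}) \<le> 2 * q" if "z \<in> Z" for z
        proof -
          have eq: "{a \<in> {a \<in> S. \<phi> a \<in> Z}. \<phi> a = z} = {a \<in> S. \<phi> a = z}" using that by auto
          have "real (card (T z)) \<le> 2 * (2 * real (2 * b) + 1)" unfolding T_def by (rule slice_card_le)
          also have "\<dots> \<le> 2 * q" by (simp add: q_def)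
          finally show ?thesis unfolding eq using fibre[of z] by linarith
        qed
      qed (use finS finQ in \<open>auto simp: Z_def\<close>)
      have "card S \<le> card {a \<in> S. \<phi> a \<notin> Z} + card {a \<in> S. \<phi> a \<in> Z}" by (rule card_split_le)
      then have "real (card S) \<le> q ^ m * (C * real (2 * b) powr \<epsilon>) + 2 * (2 * real m * q ^ m)"
        using S1 S2 Zq unfolding cardQ by (simp add: algebra_simps)
      also have "\<dots> \<le> q ^ m * (C * (2 * real b) powr \<epsilon> + 4 * real m + 1)"
        using q0 by (simp add: algebra_simps)
      finally show ?thesis .
    next
      case False
      then have E0: "E x = 0" for x by simp
      define X where "X x = x i + \<beta> (proj i v x)" for x
      define Y where "Y x = proj i v x j + e (proj j w (proj i v x))" for x
      have affY: "aff J Y"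
      proof -
        have "aff J1 (\<lambda>y. y j + e (proj j w y))" by (intro aff_add aff_coord aff_proj e J1(1) jw(1))
        then show ?thesis unfolding Y_def J1_def by (rule aff_proj[OF _ J(1) iv(1)])
      qed
      have FXY: "F x = \<alpha> * ((X x)\<^sup>2 - d * (Y x)\<^sup>2)" for x
        unfolding F \<Delta> E0 X_def Y_def by simp
      have nonsq: "d \<noteq> \<rho>\<^sup>2" for \<rho>
      proof
        assume d: "d = \<rho>\<^sup>2"
        \<comment> \<open>On multiples of \<open>v\<close> the projection is constantly 0, so there
          X + \<sigma> Y equals \<open>t\<close> plus a constant and takes the value 0. Hence both
          factors of X^2 - \<rho>^2 Y^2 have zeros, as the first exclusion demands.\<close>
        have zero: "\<exists>x. X x + \<sigma> * Y x = 0" for \<sigma>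
        proof -
          define t where "t = - (X (\<lambda>_. 0) + \<sigma> * Y (\<lambda>_. 0))"
          define x where "x = (\<lambda>k. t * of_int (v k))"
          have "proj i v x = (\<lambda>_. 0)" "proj i v (\<lambda>_. 0::rat) = (\<lambda>_. 0)" "x i = t"
            using iv(2) by (auto simp: x_def proj_def)
          then have "X x + \<sigma> * Y x = t + (X (\<lambda>_. 0) + \<sigma> * Y (\<lambda>_. 0))" unfolding X_def Y_def by simp
          then have "X x + \<sigma> * Y x = 0" by (simp add: t_def)
          then show ?thesis by blast
        qed
        have affX: "aff J X" unfolding X_def by (rule affT)
        have aff1: "aff J (\<lambda>x. \<alpha> * (X x + \<rho> * Y x))" and aff2: "aff J (\<lambda>x. X x + (- \<rho>) * Y x)"
          by (intro aff_cmult aff_add affX affY)+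
        have z1: "\<exists>x. \<alpha> * (X x + \<rho> * Y x) = 0" using zero[of \<rho>] by auto
        have "F x = (\<alpha> * (X x + \<rho> * Y x)) * (X x + (- \<rho>) * Y x)" for x
          unfolding FXY d by (simp add: power2_eq_square algebra_simps)
        then show False using I[OF aff1 aff2 z1 zero] by blast
      qed
      \<comment> \<open>For \<open>d\<close> not a rational square, p^2 = d p'^2 has only the zero
        solution, which determines \<open>s\<close> and \<open>t\<close>.\<close>
      have T1: "card (T z) \<le> 1" for z
      proof -
        have sol: "of_int s = - e (r z) \<and> of_int t = - (h * of_int s + \<beta> (r z))" if "(s, t) \<in> T z" for s t
        proof -
          define p where "p = of_int t + (h * of_int s + \<beta> (r z))"
          define p' where "p' = of_int s + e (r z)"
          have pp: "p\<^sup>2 = d * p'\<^sup>2" using that by (simp add: T_def p_def p'_def E0)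
          have "p' = 0"
          proof (rule ccontr)
            assume "p' \<noteq> 0"
            then have "d = (p / p')\<^sup>2" using pp by (simp add: power_divide)
            then show False using nonsq by blast
          qed
          then have "p = 0" using pp by simp
          then show ?thesis using \<open>p' = 0\<close> unfolding p_def p'_def by (simp add: eq_neg_iff_add_eq_0)
        qed
        have "P = P'" if "P \<in> T z" "P' \<in> T z" for P P'
        proof -
          obtain s t s' t' where P: "P = (s, t)" "P' = (s', t')" by (cases P, cases P') auto
          have 1: "(of_int s :: rat) = - e (r z)" "(of_int t :: rat) = - (h * of_int s + \<beta> (r z))" using sol that P by blast+
          have 2: "(of_int s' :: rat) = - e (r z)" "(of_int t' :: rat) = - (h * of_int s' + \<beta> (r z))" using sol that P by blast+
          have s: "s = s'" using 1(1) 2(1) by (metis of_int_eq_iff)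
          then have "t = t'" using 1(2) 2(2) by (metis of_int_eq_iff)
          then show ?thesis using s P by simp
        qed
        then show ?thesis using finT[of z] by (simp add: card_le_Suc0_iff_eq)
      qed
      have "real (card S) \<le> real (card Q) * 1"
      proof (rule card_fibres_le[where \<phi> = \<phi>])
        show "real (card {a \<in> S. \<phi> a = z}) \<le> 1" for z
          using fibre[of z] T1[of z] by linarith
      qed (use finS finQ \<phi>Q in auto)
      also have "\<dots> \<le> q ^ m * (C * (2 * real b) powr \<epsilon> + 4 * real m + 1)"
        unfolding cardQ using q0 C(1) by (intro mult_left_mono) auto
      finally show ?thesis .
    qed
    have "q ^ m \<le> (9 * real b) ^ m" using b q0 by (intro power_mono) (auto simp: q_def)
    moreover have "C * (2 * real b) powr \<epsilon> + 4 * real m + 1 \<le> (C * 2 powr \<epsilon> + 4 * real m + 1) * real b powr \<epsilon>"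
    proof -
      have "(4 * real m + 1) * 1 \<le> (4 * real m + 1) * real b powr \<epsilon>" using bpow by (intro mult_left_mono) auto
      then show ?thesis by (simp add: powr_mult algebra_simps)
    qed
    ultimately have "q ^ m * (C * (2 * real b) powr \<epsilon> + 4 * real m + 1)
        \<le> (9 * real b) ^ m * ((C * 2 powr \<epsilon> + 4 * real m + 1) * real b powr \<epsilon>)"
      using C(1) q0 by (intro mult_mono) auto
    also have "\<dots> = K * real b ^ (n - 2) * real b powr \<epsilon>"
      unfolding K_def m_def by (simp add: power_mult_distrib)
    finally show "real (card S) \<le> K * real b ^ (n - 2) * real b powr \<epsilon>" using main by linarith
  qed
qed

section \<open>Evaluation of multivariate polynomials\<close>

definition mon_eval :: "(nat \<Rightarrow>\<^sub>0 nat) \<Rightarrow> (nat \<Rightarrow> rat) \<Rightarrow> rat" where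
  "mon_eval m x = (\<Prod>i\<in>Poly_Mapping.keys m. x i ^ Poly_Mapping.lookup m i)"

lemma mon_eval_superset:
  assumes "finite V" "Poly_Mapping.keys m \<subseteq> V"
  shows "mon_eval m x = (\<Prod>i\<in>V. x i ^ Poly_Mapping.lookup m i)"
  unfolding mon_eval_def using assms
  by (intro prod.mono_neutral_left) (auto simp: in_keys_iff)

lemma mon_eval_add: "mon_eval (m + m') x = mon_eval m x * mon_eval m' x"
proof -
  define V where "V = Poly_Mapping.keys m \<union> Poly_Mapping.keys m'"
  have "finite V" "Poly_Mapping.keys m \<subseteq> V" "Poly_Mapping.keys m' \<subseteq> V" "Poly_Mapping.keys (m + m') \<subseteq> V"
    using Poly_Mapping.keys_add[of m m'] by (auto simp: V_def)
  then show ?thesis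
    by (simp add: mon_eval_superset[of V] lookup_add power_add prod.distrib)
qed

lemma mpoly_eval_superset:
  assumes "finite K" "Poly_Mapping.keys f \<subseteq> K"
  shows "mpoly_eval f x = (\<Sum>m\<in>K. Poly_Mapping.lookup f m * mon_eval m x)"
  unfolding mpoly_eval_def mon_eval_def[symmetric] using assms
  by (intro sum.mono_neutral_left) (auto simp: in_keys_iff)

lemma mpoly_eval_add: "mpoly_eval (f + g) x = mpoly_eval f x + mpoly_eval g x"
proof -
  define K where "K = Poly_Mapping.keys f \<union> Poly_Mapping.keys g"
  have "finite K" "Poly_Mapping.keys f \<subseteq> K" "Poly_Mapping.keys g \<subseteq> K" "Poly_Mapping.keys (f + g) \<subseteq> K"
    using Poly_Mapping.keys_add[of f g] by (auto simp: K_def)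
  then show ?thesis
    by (simp add: mpoly_eval_superset[of K] lookup_add algebra_simps sum.distrib)
qed

lemma mpoly_eval_0: "mpoly_eval 0 x = 0"
  by (simp add: mpoly_eval_def)

lemma mpoly_eval_sum: "mpoly_eval (sum f I) x = (\<Sum>i\<in>I. mpoly_eval (f i) x)"
  by (induction I rule: infinite_finite_induct) (auto simp: mpoly_eval_0 mpoly_eval_add)

lemma mpoly_eval_single: "mpoly_eval (Poly_Mapping.single m c) x = c * mon_eval m x"
proof -
  have "Poly_Mapping.keys (Poly_Mapping.single m c) \<subseteq> {m}" by simp
  then have "mpoly_eval (Poly_Mapping.single m c) x =
      (\<Sum>m'\<in>{m}. Poly_Mapping.lookup (Poly_Mapping.single m c) m' * mon_eval m' x)"
    by (intro mpoly_eval_superset) auto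
  then show ?thesis by simp
qed

lemma mpoly_decompose:
  fixes f :: mpoly
  shows "f = (\<Sum>m\<in>Poly_Mapping.keys f. Poly_Mapping.single m (Poly_Mapping.lookup f m))"
proof (rule poly_mapping_eqI)
  fix k
  have "Poly_Mapping.lookup (\<Sum>m\<in>Poly_Mapping.keys f. Poly_Mapping.single m (Poly_Mapping.lookup f m)) k
      = (\<Sum>m\<in>Poly_Mapping.keys f. if m = k then Poly_Mapping.lookup f k else 0)"
    unfolding lookup_sum by (intro sum.cong) (auto simp: lookup_single when_def)
  also have "\<dots> = Poly_Mapping.lookup f k" by (auto simp: in_keys_iff)
  finally show "Poly_Mapping.lookup f k =
      Poly_Mapping.lookup (\<Sum>m\<in>Poly_Mapping.keys f. Poly_Mapping.single m (Poly_Mapping.lookup f m)) k" ..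
qed

lemma mpoly_eval_mult: "mpoly_eval (f * g) x = mpoly_eval f x * mpoly_eval g x"
proof -
  have "mpoly_eval (f * g) x =
     mpoly_eval ((\<Sum>m\<in>Poly_Mapping.keys f. Poly_Mapping.single m (Poly_Mapping.lookup f m)) *
       (\<Sum>m\<in>Poly_Mapping.keys g. Poly_Mapping.single m (Poly_Mapping.lookup g m))) x"
    unfolding mpoly_decompose[symmetric] ..
  also have "\<dots> = (\<Sum>m\<in>Poly_Mapping.keys f. Poly_Mapping.lookup f m * mon_eval m x) *
      (\<Sum>m\<in>Poly_Mapping.keys g. Poly_Mapping.lookup g m * mon_eval m x)"
    unfolding sum_product mpoly_eval_sum mult_single mpoly_eval_single mon_eval_add
    by (simp add: mult_ac)
  finally show ?thesis unfolding mpoly_eval_def mon_eval_def .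
qed

lemma mpoly_eval_mconst: "mpoly_eval (mconst c) x = c"
  unfolding mconst_def mpoly_eval_single by (simp add: mon_eval_def)

lemma mpoly_eval_1: "mpoly_eval 1 x = 1"
  using mpoly_eval_mconst[of 1 x] by (simp add: mconst_def)

lemma mpoly_eval_mvar: "mpoly_eval (mvar i) x = x i"
  unfolding mvar_def mpoly_eval_single by (simp add: mon_eval_def)

lemma mpoly_eval_power: "mpoly_eval (f ^ k) x = mpoly_eval f x ^ k"
  by (induction k) (auto simp: mpoly_eval_1 mpoly_eval_mult)

lemma mpoly_eval_linear_form: "mpoly_eval (linear_form n c) x = (\<Sum>i<n. c i * x i)"
  unfolding linear_form_def mpoly_eval_sum mpoly_eval_mult mpoly_eval_mconst mpoly_eval_mvar ..

lemmas mpoly_eval_simps = mpoly_eval_add mpoly_eval_mult mpoly_eval_mconst mpoly_eval_mvar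
  mpoly_eval_power mpoly_eval_linear_form

section \<open>From identities of functions to identities of polynomials\<close>

text \<open>Viewed as a polynomial in one variable \<open>v\<close>, the sum vanishes at all
  rationals, so the coefficient of each power of \<open>v\<close> vanishes for every choice of the
  other variables. Monomials are abstract indices with an exponent function \<open>e\<close>, so
  that dropping a variable leaves them unchanged; inside \<open>N\<close> the remaining exponents
  still tell them apart.\<close>

lemma monomials_independent:
  fixes c :: "'m \<Rightarrow> rat" and e :: "'m \<Rightarrow> nat \<Rightarrow> nat"
  assumes "finite V" "finite M"
    and "\<And>m m'. m \<in> M \<Longrightarrow> m' \<in> M \<Longrightarrow> (\<And>i. i \<in> V \<Longrightarrow> e m i = e m' i) \<Longrightarrow> m = m'"
    and "\<And>x. (\<Sum>m\<in>M. c m * (\<Prod>i\<in>V. x i ^ e m i)) = 0"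
    and "m \<in> M"
  shows "c m = 0"
  using assms
proof (induction V arbitrary: M rule: finite_induct)
  case empty
  then have "M = {m}" by auto
  then show ?case using empty.prems(3) by simp
next
  case (insert v V)
  define N where "N = {m' \<in> M. e m' v = e m v}"
  show ?case
  proof (rule insert.IH)
    show "finite N" using insert.prems by (simp add: N_def)
    show "m \<in> N" using insert.prems by (simp add: N_def)
    show "p = p'" if "p \<in> N" "p' \<in> N" "\<And>i. i \<in> V \<Longrightarrow> e p i = e p' i" for p p'
      using that by (intro insert.prems(2)) (auto simp: N_def)
    fix x :: "nat \<Rightarrow> rat"
    define w where "w p = c p * (\<Prod>i\<in>V. x i ^ e p i)" for p
    define P where "P = (\<Sum>p\<in>M. monom (w p) (e p v))"
    have "poly P t = 0" for t
    proof -
      have pr: "(\<Prod>i\<in>V. (x(v := t)) i ^ e p i) = (\<Prod>i\<in>V. x i ^ e p i)" for p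
        using insert.hyps by (intro prod.cong) auto
      have "poly P t = (\<Sum>p\<in>M. c p * (\<Prod>i\<in>insert v V. (x(v := t)) i ^ e p i))"
        using insert.hyps by (simp add: P_def poly_sum poly_monom w_def pr mult_ac del: fun_upd_apply) (simp add: mult_ac)
      then show ?thesis using insert.prems(3)[of "x(v := t)"] by simp
    qed
    then have "P = 0" using poly_all_0_iff_0 by blast
    then have "0 = coeff P (e m v)" by simp
    also have "\<dots> = (\<Sum>p\<in>M. if e p v = e m v then w p else 0)" by (simp add: P_def coeff_sum)
    also have "\<dots> = (\<Sum>p\<in>N. w p)"
      unfolding N_def using insert.prems(1) by (simp add: sum.inter_filter)
    finally show "(\<Sum>p\<in>N. c p * (\<Prod>i\<in>V. x i ^ e p i)) = 0" by (simp add: w_def)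
  qed
qed

text \<open>The coefficients of the difference vanish by \<open>monomials_independent\<close>. Thus
  factorisations found for functions are factorisations in \<open>mpoly\<close>, and no square has
  to be completed there.\<close>

lemma mpoly_eval_inject:
  assumes "\<And>x. mpoly_eval f x = mpoly_eval g x"
  shows "f = g"
proof (rule poly_mapping_eqI)
  fix k
  define M where "M = Poly_Mapping.keys f \<union> Poly_Mapping.keys g"
  define V where "V = (\<Union>m\<in>M. Poly_Mapping.keys m)"
  have fin: "finite V" "finite M" by (auto simp: V_def M_def)
  have "Poly_Mapping.lookup f k - Poly_Mapping.lookup g k = 0" if "k \<in> M"
  proof (rule monomials_independent[OF fin _ _ that, where e = Poly_Mapping.lookup])
    fix m m' assume m: "m \<in> M" "m' \<in> M" "\<And>i. i \<in> V \<Longrightarrow> Poly_Mapping.lookup m i = Poly_Mapping.lookup m' i"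
    show "m = m'"
    proof (rule poly_mapping_eqI)
      fix i
      show "Poly_Mapping.lookup m i = Poly_Mapping.lookup m' i"
      proof (cases "i \<in> V")
        case False
        then have "i \<notin> Poly_Mapping.keys m" "i \<notin> Poly_Mapping.keys m'" using m by (auto simp: V_def)
        then show ?thesis by (simp add: in_keys_iff)
      qed (use m in auto)
    qed
  next
    fix x
    have "(\<Sum>m\<in>M. (Poly_Mapping.lookup f m - Poly_Mapping.lookup g m) * (\<Prod>i\<in>V. x i ^ Poly_Mapping.lookup m i))
        = (\<Sum>m\<in>M. (Poly_Mapping.lookup f m - Poly_Mapping.lookup g m) * mon_eval m x)"
    proof (intro sum.cong refl)
      fix m assume "m \<in> M"
      then have "mon_eval m x = (\<Prod>i\<in>V. x i ^ Poly_Mapping.lookup m i)"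
        by (intro mon_eval_superset fin) (auto simp: V_def)
      then show "(Poly_Mapping.lookup f m - Poly_Mapping.lookup g m) * (\<Prod>i\<in>V. x i ^ Poly_Mapping.lookup m i)
        = (Poly_Mapping.lookup f m - Poly_Mapping.lookup g m) * mon_eval m x" by simp
    qed
    also have "\<dots> = mpoly_eval f x - mpoly_eval g x"
      using mpoly_eval_superset[OF fin(2), of f x] mpoly_eval_superset[OF fin(2), of g x]
      by (simp add: M_def left_diff_distrib sum_subtractf)
    finally show "(\<Sum>m\<in>M. (Poly_Mapping.lookup f m - Poly_Mapping.lookup g m) * (\<Prod>i\<in>V. x i ^ Poly_Mapping.lookup m i)) = 0"
      using assms by simp
  qed
  then show "Poly_Mapping.lookup f k = Poly_Mapping.lookup g k"
    by (cases "k \<in> M") (auto simp: M_def in_keys_iff)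
qed

lemma not_unit_if_zero:
  assumes "mpoly_eval f x = 0"
  shows "\<not> f dvd 1"
proof
  assume "f dvd 1"
  then obtain g where "1 = f * g" by blast
  then have "mpoly_eval 1 x = mpoly_eval f x * mpoly_eval g x" by (metis mpoly_eval_mult)
  then show False using assms by (simp add: mpoly_eval_1)
qed

text \<open>A polynomial with a rational zero is not a unit, so equality of the functions would
  factor \<open>f\<close> into nonunits. This is the source of the zeros required in
  \<open>quadric_bound\<close>.\<close>

lemma irreducible_eval_factor:
  assumes "irreducible f" "mpoly_eval p x = 0" "mpoly_eval q y = 0"
  shows "\<exists>z. mpoly_eval f z \<noteq> mpoly_eval p z * mpoly_eval q z"
proof (rule ccontr)
  assume "\<not> ?thesis"
  then have "f = p * q" by (intro mpoly_eval_inject) (simp add: mpoly_eval_mult)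
  then have "p dvd 1 \<or> q dvd 1" using assms(1) irreducibleD by blast
  then show False using assms not_unit_if_zero by blast
qed

lemma aff_mpoly:
  assumes "aff {..<n} L"
  obtains p where "\<And>x. L x = mpoly_eval p x"
proof -
  obtain r c where "\<And>x. L x = r + (\<Sum>i<n. c i * x i)"
    by (rule affE[OF assms(1)]) (rule that)
  then show ?thesis by (intro that[of "mconst r + linear_form n c"]) (simp add: mpoly_eval_simps)
qed

text \<open>Such a monomial involves at most two variables and is a product of two affine functions,
  each a coordinate or 1.\<close>

lemma mon_eval_quad:
  assumes "Poly_Mapping.keys m \<subseteq> {..<n}" "mon_degree m \<le> 2"
  shows "quad {..<n} (mon_eval m)"
proof -
  have one: "aff {..<n} (\<lambda>x. 1)" by (rule affI[where r = 1 and c = "\<lambda>_. 0"]) simp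
  have co: "aff {..<n} (\<lambda>x. x i)" if "i \<in> Poly_Mapping.keys m" for i using that assms(1) by (intro aff_coord) auto
  have pos: "Poly_Mapping.lookup m i \<ge> 1" if "i \<in> Poly_Mapping.keys m" for i
    using that by (simp add: in_keys_iff Suc_leI)
  have "(\<Sum>i\<in>Poly_Mapping.keys m. 1) \<le> mon_degree m"
    unfolding mon_degree_def using pos by (intro sum_mono) auto
  then have "card (Poly_Mapping.keys m) \<le> 2" using assms(2) by simp
  then consider "card (Poly_Mapping.keys m) = 0" | "card (Poly_Mapping.keys m) = 1" | "card (Poly_Mapping.keys m) = 2"
    by linarith
  then have "\<exists>L M. aff {..<n} L \<and> aff {..<n} M \<and> mon_eval m = (\<lambda>x. L x * M x)"
  proof cases
    case 1
    then have "mon_eval m = (\<lambda>x. 1 * 1)" by (auto simp: mon_eval_def)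
    then show ?thesis using one by blast
  next
    case 2
    then obtain i where i: "Poly_Mapping.keys m = {i}" by (rule card_1_singletonE)
    then have "Poly_Mapping.lookup m i = 1 \<or> Poly_Mapping.lookup m i = 2"
      using pos[of i] assms(2) by (auto simp: mon_degree_def)
    then have "mon_eval m = (\<lambda>x. x i * 1) \<or> mon_eval m = (\<lambda>x. x i * x i)"
      using i by (auto simp: mon_eval_def power2_eq_square)
    then show ?thesis using one co[of i] i by blast
  next
    case 3
    then obtain i j where ij: "Poly_Mapping.keys m = {i, j}" "i \<noteq> j" by (auto simp: card_2_iff)
    then have "Poly_Mapping.lookup m i = 1" "Poly_Mapping.lookup m j = 1"
      using pos[of i] pos[of j] assms(2) by (auto simp: mon_degree_def)
    then have "mon_eval m = (\<lambda>x. x i * x j)" using ij by (auto simp: mon_eval_def)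
    then show ?thesis using co[of i] co[of j] ij by blast
  qed
  then show ?thesis using quad_aff_mult by force
qed

lemma mpoly_eval_quad:
  assumes "vars_below n f" "total_degree f \<le> 2"
  shows "quad {..<n} (mpoly_eval f)"
proof -
  have zero: "quad {..<n} (\<lambda>x. 0)" by (rule quadI[where A = "\<lambda>_ _. 0" and b = "\<lambda>_. 0" and c = 0]) simp
  have deg: "mon_degree m \<le> 2" if "m \<in> Poly_Mapping.keys f" for m
  proof -
    have "mon_degree m \<le> total_degree f" unfolding total_degree_def using that by (intro Max_ge) auto
    then show ?thesis using assms(2) by simp
  qed
  have "quad {..<n} (\<lambda>x. \<Sum>m\<in>K. Poly_Mapping.lookup f m * mon_eval m x)" if "finite K" "K \<subseteq> Poly_Mapping.keys f" for K
    using that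
  proof (induction K rule: finite_induct)
    case empty
    then show ?case using zero by simp
  next
    case (insert m K)
    have "quad {..<n} (\<lambda>x. Poly_Mapping.lookup f m * mon_eval m x)"
      using insert.prems assms(1) deg by (intro quad_cmult mon_eval_quad) (auto simp: vars_below_def)
    then have "quad {..<n} (\<lambda>x. Poly_Mapping.lookup f m * mon_eval m x + (\<Sum>m\<in>K. Poly_Mapping.lookup f m * mon_eval m x))"
      using insert by (intro quad_add) auto
    then show ?case using insert.hyps by simp
  qed
  from this[OF _ subset_refl] show ?thesis
    unfolding mpoly_eval_def[abs_def] mon_eval_def[symmetric] by simp
qed

lemma mon_eval_scale: "mon_eval m (\<lambda>i. t * x i) = t ^ mon_degree m * mon_eval m x"
  unfolding mon_eval_def mon_degree_def by (simp add: power_mult_distrib prod.distrib power_sum)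

text \<open>Each monomial contributes t to the power of its degree, and a polynomial in
  \<open>t\<close> is determined by its values. Homogeneous parts can so be read off from any
  formula for \<open>f\<close> on lines through the origin, without comparing monomials.\<close>

lemma hom_part_eval:
  assumes "\<And>x t. mpoly_eval f (\<lambda>i. t * x i) = poly (p x) t"
  shows "mpoly_eval (hom_part d f) x = coeff (p x) d"
proof -
  define P where "P = (\<Sum>m\<in>Poly_Mapping.keys f. monom (Poly_Mapping.lookup f m * mon_eval m x) (mon_degree m))"
  have "poly P t = mpoly_eval f (\<lambda>i. t * x i)" for t
    unfolding P_def mpoly_eval_def mon_eval_def[symmetric] mon_eval_scale
    by (simp add: poly_sum poly_monom mult_ac)
  then have "poly P t = poly (p x) t" for t using assms by simp
  then have "P = p x" using poly_eq_poly_eq_iff by blast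
  moreover have "coeff P d = (\<Sum>m\<in>Poly_Mapping.keys f. if mon_degree m = d then Poly_Mapping.lookup f m * mon_eval m x else 0)"
    by (simp add: P_def coeff_sum)
  then have "coeff P d = (\<Sum>m\<in>{m\<in>Poly_Mapping.keys f. mon_degree m = d}. Poly_Mapping.lookup f m * mon_eval m x)"
    by (simp add: sum.inter_filter)
  ultimately show ?thesis unfolding hom_part_def mpoly_eval_sum mpoly_eval_single by simp
qed

lemma vars_below_mconst: "vars_below n (mconst c)"
  by (simp add: vars_below_def mconst_def)

lemma vars_below_mvar: "i < n \<Longrightarrow> vars_below n (mvar i)"
  by (simp add: vars_below_def mvar_def)

lemma vars_below_add: "vars_below n f \<Longrightarrow> vars_below n g \<Longrightarrow> vars_below n (f + g)"
  unfolding vars_below_def using Poly_Mapping.keys_add[of f g] by blast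

lemma vars_below_mult:
  assumes "vars_below n f" "vars_below n g"
  shows "vars_below n (f * g)"
  unfolding vars_below_def
proof
  fix m assume "m \<in> Poly_Mapping.keys (f * g)"
  then obtain a b where m: "m = a + b" "a \<in> Poly_Mapping.keys f" "b \<in> Poly_Mapping.keys g"
    using Poly_Mapping.keys_mult[of f g] by blast
  then have "Poly_Mapping.keys a \<subseteq> {..<n}" "Poly_Mapping.keys b \<subseteq> {..<n}"
    using assms by (auto simp: vars_below_def)
  then show "Poly_Mapping.keys m \<subseteq> {..<n}" unfolding m(1) using Poly_Mapping.keys_add[of a b] by blast
qed

lemma subst2_eval:
  assumes "vars_below 2 g"
  shows "mpoly_eval (subst2 g p q) x = mpoly_eval g (\<lambda>i. if i = 0 then mpoly_eval p x else mpoly_eval q x)"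
proof -
  define y where "y = (\<lambda>i::nat. if i = 0 then mpoly_eval p x else mpoly_eval q x)"
  have "mon_eval m y = mpoly_eval p x ^ Poly_Mapping.lookup m 0 * mpoly_eval q x ^ Poly_Mapping.lookup m 1"
    if "m \<in> Poly_Mapping.keys g" for m
  proof -
    have "Poly_Mapping.keys m \<subseteq> {..<2}" using assms that by (auto simp: vars_below_def)
    also have "{..<2::nat} = {0, 1}" by auto
    finally have "Poly_Mapping.keys m \<subseteq> {0, 1}" .
    then have "mon_eval m y = (\<Prod>i\<in>{0, 1}. y i ^ Poly_Mapping.lookup m i)" by (intro mon_eval_superset) auto
    then show ?thesis by (simp add: y_def)
  qed
  then show ?thesis
    unfolding y_def[symmetric] subst2_def mpoly_eval_sum mpoly_eval_def[of g] mon_eval_def[symmetric]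
    by (intro sum.cong) (auto simp: mpoly_eval_simps mult.assoc)
qed

text \<open>The excluded shape violates both alternatives: it is a polynomial in the linear parts of
  \<open>L\<close> and \<open>M\<close>, and its quadratic part is \<kappa> times the square of the
  linear part of \<open>L\<close>, a product of two factors that vanish at the origin.\<close>

lemma square_minus_affine_excluded:
  assumes "\<not> poly_in_two_linear_forms n f \<or> irreducible (hom_part 2 f)" "aff {..<n} L" "aff {..<n} M"
  shows "\<not> (\<forall>x. mpoly_eval f x = \<kappa> * ((L x)\<^sup>2 - M x))"
proof
  assume eq: "\<forall>x. mpoly_eval f x = \<kappa> * ((L x)\<^sup>2 - M x)"
  obtain r c where L: "\<And>x. L x = r + (\<Sum>i<n. c i * x i)" by (rule affE[OF assms(2)]) (rule that)
  obtain r' c' where M: "\<And>x. M x = r' + (\<Sum>i<n. c' i * x i)" by (rule affE[OF assms(3)]) (rule that)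
  \<comment> \<open>In variables u, v this is \<kappa> ((u + r)^2 - (v + r')), so the constant terms
    of \<open>L\<close> and \<open>M\<close> are absorbed and only linear forms are
    substituted.\<close>
  define g where "g = mconst \<kappa> * ((mvar 0 + mconst r) * (mvar 0 + mconst r) + mconst (- 1) * (mvar 1 + mconst r'))"
  have g: "vars_below 2 g" unfolding g_def
    by (intro vars_below_mult vars_below_add vars_below_mconst vars_below_mvar) auto
  have "f = subst2 g (linear_form n c) (linear_form n c')"
  proof (rule mpoly_eval_inject)
    fix x
    have "mpoly_eval (subst2 g (linear_form n c) (linear_form n c')) x =
        \<kappa> * (((\<Sum>i<n. c i * x i) + r) * ((\<Sum>i<n. c i * x i) + r) + - 1 * ((\<Sum>i<n. c' i * x i) + r'))"
      unfolding subst2_eval[OF g] unfolding g_def mpoly_eval_simps by simp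
    also have "\<dots> = \<kappa> * ((L x)\<^sup>2 - M x)" unfolding L M by (simp add: power2_eq_square algebra_simps)
    finally show "mpoly_eval f x = mpoly_eval (subst2 g (linear_form n c) (linear_form n c')) x"
      using eq by simp
  qed
  then have "poly_in_two_linear_forms n f" unfolding poly_in_two_linear_forms_def using g by blast
  then have irr: "irreducible (hom_part 2 f)" using assms(1) by blast
  define p where "p x = [:\<kappa> * (r\<^sup>2 - r'), \<kappa> * (2 * r * (\<Sum>i<n. c i * x i) - (\<Sum>i<n. c' i * x i)),
      \<kappa> * (\<Sum>i<n. c i * x i)\<^sup>2:]" for x
  have "mpoly_eval f (\<lambda>i. t * x i) = poly (p x) t" for x t
  proof -
    have s: "(\<Sum>i<n. d i * (t * x i)) = t * (\<Sum>i<n. d i * x i)" for d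
      by (simp add: sum_distrib_left mult_ac)
    show ?thesis unfolding eq[rule_format] L M s p_def by (simp add: power2_eq_square algebra_simps)
  qed
  then have "mpoly_eval (hom_part 2 f) x = coeff (p x) 2" for x by (rule hom_part_eval)
  then have hom: "mpoly_eval (hom_part 2 f) x = \<kappa> * (\<Sum>i<n. c i * x i)\<^sup>2" for x
    by (simp add: p_def eval_nat_numeral)
  have "mpoly_eval (mconst \<kappa> * linear_form n c) (\<lambda>_. 0) = 0" "mpoly_eval (linear_form n c) (\<lambda>_. 0) = 0"
    by (simp_all add: mpoly_eval_simps)
  from irreducible_eval_factor[OF irr this] show False
    by (simp add: hom mpoly_eval_simps power2_eq_square)
qed

section \<open>Deduction of the theorem\<close>

theorem theorem2:
  fixes n :: nat and \<epsilon> :: real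
  assumes "n \<ge> 3" and "\<epsilon> > 0"
  shows "\<exists>C. \<forall>(f :: mpoly) (B :: real).
           vars_below n f \<and> total_degree f = 2 \<and> irreducible f \<and>
           (\<not> poly_in_two_linear_forms n f \<or> irreducible (hom_part 2 f)) \<and> B \<ge> 1
           \<longrightarrow> real (count_zeros n f B) \<le> C * B powr (real n - 2 + \<epsilon>)"
proof -
  have "n \<ge> 2" using assms by simp
  show ?thesis
  proof (rule quadric_bound[OF assms(2) \<open>n \<ge> 2\<close>])
    fix C :: real
    assume C: "C \<ge> 0"
    "\<And>J F b. finite J \<Longrightarrow> card J = n \<Longrightarrow> quad J F \<Longrightarrow> b \<ge> 1 \<Longrightarrow>
      (\<And>L M. aff J L \<Longrightarrow> aff J M \<Longrightarrow> \<exists>x. L x = 0 \<Longrightarrow> \<exists>x. M x = 0 \<Longrightarrow> \<not> (\<forall>x. F x = L x * M x)) \<Longrightarrow>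
      (\<And>\<kappa> L M. aff J L \<Longrightarrow> aff J M \<Longrightarrow> \<not> (\<forall>x. F x = \<kappa> * ((L x)\<^sup>2 - M x))) \<Longrightarrow>
      real (card {a \<in> box J b. F (\<lambda>k. of_int (a k)) = 0}) \<le> C * real b ^ (n - 2) * real b powr \<epsilon>"
    show ?thesis
    proof (intro exI[of _ C] allI impI, elim conjE)
      fix f :: mpoly and B :: real
      assume f: "vars_below n f" "total_degree f = 2" "irreducible f"
        "\<not> poly_in_two_linear_forms n f \<or> irreducible (hom_part 2 f)" and B: "B \<ge> 1"
      \<comment> \<open>Integral points see only the integer part of \<open>B\<close>, and B \<ge> 1
        makes it at least 1.\<close>
      define b where "b = nat \<lfloor>B\<rfloor>"
      have b: "b \<ge> 1" "int b = \<lfloor>B\<rfloor>" "real b \<le> B" using B unfolding b_def by (auto simp: le_nat_iff le_floor_iff)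
      have "\<bar>real_of_int k\<bar> \<le> B \<longleftrightarrow> \<bar>k\<bar> \<le> int b" for k unfolding b(2) by linarith
      then have "count_zeros n f B = card {a \<in> box {..<n} b. mpoly_eval f (\<lambda>k. of_int (a k)) = 0}"
        unfolding count_zeros_def box_def by (simp add: not_less conj_assoc Ball_def)
      also have "real \<dots> \<le> C * real b ^ (n - 2) * real b powr \<epsilon>"
      proof (rule C(2))
        show "quad {..<n} (mpoly_eval f)" using f by (intro mpoly_eval_quad) auto
      next
        fix L M assume L: "aff {..<n} L" "\<exists>x. L x = 0" and M: "aff {..<n} M" "\<exists>x. M x = 0"
        obtain p q where "\<And>x. L x = mpoly_eval p x" "\<And>x. M x = mpoly_eval q x"
          using aff_mpoly[OF L(1)] aff_mpoly[OF M(1)] by metis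
        then show "\<not> (\<forall>x. mpoly_eval f x = L x * M x)"
          using irreducible_eval_factor[OF f(3)] L(2) M(2) by metis
      next
        fix \<kappa> L M assume "aff {..<n} L" "aff {..<n} M"
        then show "\<not> (\<forall>x. mpoly_eval f x = \<kappa> * ((L x)\<^sup>2 - M x))"
          by (rule square_minus_affine_excluded[OF f(4)])
      qed (use b in auto)
      also have "\<dots> \<le> C * B ^ (n - 2) * B powr \<epsilon>"
        using C(1) b assms by (intro mult_mono power_mono powr_mono2) auto
      also have "\<dots> = C * B powr (real n - 2 + \<epsilon>)"
      proof -
        have n2: "real n - 2 = real (n - 2)" using assms by simp
        have "B powr real (n - 2) = B ^ (n - 2)" using B by (intro powr_realpow) simp
        then show ?thesis unfolding n2 powr_add by (simp only: mult.assoc)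
      qed
      finally show "real (count_zeros n f B) \<le> C * B powr (real n - 2 + \<epsilon>)" .
    qed
  qed
qed

end
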